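(* Assume that $n\geq 4$. Let $V$ be a complex vector space with basis $v_1,\ldots,v_n$, on which the hyperoctahedral group $G(2,1,n)$ acts naturally by signed permutation matrices. Let $q_{ii}=1$ and $q_{ij}=-1$ for $i\neq j$. The maps $\kappa:V\times V\to\mathbb{C}G(2,1,n)$ for which $\mathcal{H}_{\mathbf{q},\kappa}$ is a quantum Drinfeld Hecke algebra form a two-dimensional vector space with basis consisting of the maps $V\times V\to\mathbb{C}G(2,1,n)$ determined by their effect on pairs $(v_i,v_j)$, $i\neq j$, given respectively by \begin{align*} &(v_i,v_j)\mapsto (ij)-\zeta_i\zeta_j(ij),\\ &(v_i,v_j)\mapsto \sum_{k\neq i,j}\Big((ijk)-\zeta_i\zeta_j(ijk)-\zeta_j\zeta_k(ijk)+\zeta_i\zeta_k(ijk)\\ &\hspace{3cm}+(ikj)-\zeta_i\zeta_j(ikj)+\zeta_j\zeta_k(ikj)-\zeta_i\zeta_k(ikj)\Big). \end{align*}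
   Context: $\zeta_i=\mathrm{diag}(1,\ldots,-1,\ldots,1)$ is the diagonal matrix with $-1$ in the $i$th position; $S_n$ is identified with the permutation matrices, acting by ${}^{\sigma}v_i=v_{\sigma(i)}$; and $G(2,1,n)$ is the group of all products $\zeta_1^{\lambda_1}\cdots\zeta_n^{\lambda_n}\sigma$ with $\lambda_i\in\mathbb{Z}/2\mathbb{Z}$, $\sigma\in S_n$. Products such as $\zeta_i\zeta_j(ij)$ are products in this group, permutations being written in cycle notation ($(ijk)$ sends $i\mapsto j\mapsto k\mapsto i$). $S_{\mathbf{q}}(V)=\mathbb{C}\langle v_1,\ldots,v_n\mid v_iv_j=q_{ij}v_jv_i\ \forall i,j\rangle$, i.e. here $v_iv_j=-v_jv_i$ for $i\ne j$; the action of $G=G(2,1,n)$ extends to it by algebra automorphisms. $T(V)$ is the tensor algebra. For an algebra $A$ with an action of $G$ by automorphisms $a\mapsto{}^g a$, the skew group algebra $A\rtimes G$ is the free left $A$-module with basis $G$ and multiplication $(ag)(bh)=a({}^g b)\,gh$. The maps $\kappa:V\times V\to\mathbb{C}G$ under consideration are bilinear and satisfy $\kappa(v_i,v_j)=-q_{ij}\kappa(v_j,v_i)$ for all $i,j$ (so here $\kappa(v_i,v_i)=0$ and $\kappa(v_i,v_j)=\kappa(v_j,v_i)$ for $i\neq j$). For such $\kappa$, $$\mathcal{H}_{\mathbf{q},\kappa}=T(V)\rtimes G\,/\,(v_iv_j-q_{ij}v_jv_i-\kappa(v_i,v_j)\mid 1\le i,j\le n),$$ filtered with each $v_i$ in degree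 $1$ and each $g\in G$ in degree $0$; it is called a quantum Drinfeld Hecke algebra if its associated graded algebra is isomorphic (as a graded algebra) to $S_{\mathbf{q}}(V)\rtimes G$. *)

theory Defs
  imports
    "HOL-Analysis.Analysis"
    "HOL-Algebra.QuotRing"
    "HOL-Algebra.Module"
    "HOL-Combinatorics.Cycles"
    "HOL-Library.Poly_Mapping"
    "HOL-Library.Function_Algebras"
begin

text \<open>
  The basis of \<open>V\<close> is indexed by a finite type \<open>'n\<close>, so \<open>V\<close> is \<open>complex ^ 'n\<close>, with basis
  \<open>v\<^sub>i = axis i 1\<close>.  Associative algebras over the complex numbers are records of type
  \<open>(complex, 'a) module\<close>.
\<close>

section \<open>The group \<open>G(2,1,n)\<close>\<close>

abbreviation bas :: "'n::finite \<Rightarrow> complex ^ 'n" where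
  "bas i \<equiv> axis i 1"

definition zeta :: "'n::finite \<Rightarrow> complex ^ 'n ^ 'n" where
  "zeta i = (\<chi> a b. if a = b then (if a = i then - 1 else 1) else 0)"

text \<open>
  The exponent vector \<open>\<lambda>\<close> in \<open>(\<int>/2\<int>)\<^sup>n\<close> is encoded by its support \<open>L\<close>; the two lemmas after
  the definition show that this is the product of the (commuting) matrices \<open>zeta i\<close>, \<open>i \<in> L\<close>.
\<close>
definition sign_mat :: "'n::finite set \<Rightarrow> complex ^ 'n ^ 'n" where
  "sign_mat L = (\<chi> a b. if a = b then (if a \<in> L then - 1 else 1) else 0)"

lemma sign_mat_empty: "sign_mat {} = mat 1"
  by (simp add: sign_mat_def mat_def vec_eq_iff)

lemma sign_mat_insert: "i \<notin> L \<Longrightarrow> sign_mat (insert i L) = zeta i ** sign_mat L"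
  by (auto simp: sign_mat_def zeta_def matrix_matrix_mult_def vec_eq_iff
      if_distrib [of "\<lambda>x. x * _"] if_distrib [of "\<lambda>x. _ * x"] cong: if_cong)

definition perm_mat :: "('n::finite \<Rightarrow> 'n) \<Rightarrow> complex ^ 'n ^ 'n" where
  "perm_mat \<sigma> = (\<chi> a b. if a = \<sigma> b then 1 else 0)"

lemma perm_mat_bas: "perm_mat \<sigma> *v bas i = bas (\<sigma> i)"
  by (auto simp: perm_mat_def axis_def matrix_vector_mult_def vec_eq_iff
      if_distrib [of "\<lambda>x. _ * x"] cong: if_cong)

definition G21 :: "(complex ^ 'n::finite ^ 'n) monoid" where
  "G21 = \<lparr>carrier = {sign_mat L ** perm_mat \<sigma> | L \<sigma>. \<sigma> permutes UNIV},
          monoid.mult = (**), one = mat 1\<rparr>"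

text \<open>\<open>cycle_of_list [i, j, k]\<close> sends \<open>i\<close> to \<open>j\<close>, \<open>j\<close> to \<open>k\<close> and \<open>k\<close> to \<open>i\<close>.\<close>
abbreviation cyc :: "'n::finite list \<Rightarrow> complex ^ 'n ^ 'n" where
  "cyc l \<equiv> perm_mat (cycle_of_list l)"


section \<open>Quotients, skew group algebras, associated graded algebras\<close>

text \<open>The library's quotient ring, with the induced scalar multiplication on cosets.\<close>
definition quot_alg :: "(complex, 'a) module \<Rightarrow> 'a set \<Rightarrow> (complex, 'a set) module" where
  "quot_alg A I = ring.extend (A Quot I)
     (module.fields (\<lambda>c X. \<Union>x\<in>X. I +>\<^bsub>A\<^esub> (c \<odot>\<^bsub>A\<^esub> x)))"

text \<open>
  The element \<open>\<Sum>\<^sub>g a\<^sub>g g\<close> is the finitely supported function \<open>g \<mapsto> a\<^sub>g\<close>, extended by zero outside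
  the group.  The coefficient of \<open>k\<close> in \<open>(\<Sum>\<^sub>g a\<^sub>g g) (\<Sum>\<^sub>h b\<^sub>h h)\<close> is the sum of all
  \<open>a\<^sub>g (act g b\<^sub>h)\<close> with \<open>g h = k\<close>.
\<close>
definition skew_group_alg ::
  "(complex, 'a) module \<Rightarrow> 'g monoid \<Rightarrow> ('g \<Rightarrow> 'a \<Rightarrow> 'a) \<Rightarrow> (complex, 'g \<Rightarrow> 'a) module" where
  "skew_group_alg A G act =
    \<lparr>carrier = {a. (\<forall>g\<in>carrier G. a g \<in> carrier A) \<and> (\<forall>g. g \<notin> carrier G \<longrightarrow> a g = \<zero>\<^bsub>A\<^esub>)
                   \<and> finite {g. a g \<noteq> \<zero>\<^bsub>A\<^esub>}},
     monoid.mult = (\<lambda>a b k. if k \<in> carrier G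
       then finsum A (\<lambda>g. a g \<otimes>\<^bsub>A\<^esub> act g (b (inv\<^bsub>G\<^esub> g \<otimes>\<^bsub>G\<^esub> k))) {g \<in> carrier G. a g \<noteq> \<zero>\<^bsub>A\<^esub>}
       else \<zero>\<^bsub>A\<^esub>),
     one = (\<lambda>k. if k = \<one>\<^bsub>G\<^esub> then \<one>\<^bsub>A\<^esub> else \<zero>\<^bsub>A\<^esub>),
     zero = (\<lambda>_. \<zero>\<^bsub>A\<^esub>),
     add = (\<lambda>a b k. a k \<oplus>\<^bsub>A\<^esub> b k),
     smult = (\<lambda>c a k. c \<odot>\<^bsub>A\<^esub> a k)\<rparr>"

text \<open>\<open>filt_pred A F d\<close> is \<open>F\<^sub>d\<^sub>-\<^sub>1\<close>, where \<open>F\<^sub>-\<^sub>1 = 0\<close>.\<close>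
definition filt_pred :: "(complex, 'a) module \<Rightarrow> (nat \<Rightarrow> 'a set) \<Rightarrow> nat \<Rightarrow> 'a set" where
  "filt_pred A F d = (case d of 0 \<Rightarrow> {\<zero>\<^bsub>A\<^esub>} | Suc e \<Rightarrow> F e)"

text \<open>
  The associated graded algebra of \<open>A\<close> with filtration \<open>F\<close> is the direct sum of the
  \<open>F\<^sub>d / F\<^sub>d\<^sub>-\<^sub>1\<close>; its elements are finitely supported families of cosets.  As in the library's
  \<^const>\<open>rcoset_mult\<close>, operations on cosets are written as unions over all representatives.
\<close>
definition assoc_graded ::
  "(complex, 'a) module \<Rightarrow> (nat \<Rightarrow> 'a set) \<Rightarrow> (complex, nat \<Rightarrow> 'a set) module" where
  "assoc_graded A F =
    \<lparr>carrier = {x. (\<forall>d. \<exists>a\<in>F d. x d = filt_pred A F d +>\<^bsub>A\<^esub> a)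
                   \<and> finite {d. x d \<noteq> filt_pred A F d}},
     monoid.mult = (\<lambda>x y d. \<Union>a\<in>{a. \<forall>i. a i \<in> x i}. \<Union>b\<in>{b. \<forall>i. b i \<in> y i}.
       filt_pred A F d +>\<^bsub>A\<^esub> finsum A (\<lambda>i. a i \<otimes>\<^bsub>A\<^esub> b (d - i)) {..d}),
     one = (\<lambda>d. if d = 0 then filt_pred A F 0 +>\<^bsub>A\<^esub> \<one>\<^bsub>A\<^esub> else filt_pred A F d),
     zero = filt_pred A F,
     add = (\<lambda>x y d. set_add A (x d) (y d)),
     smult = (\<lambda>c x d. \<Union>a\<in>x d. filt_pred A F d +>\<^bsub>A\<^esub> (c \<odot>\<^bsub>A\<^esub> a))\<rparr>"

definition assoc_graded_deg ::
  "(complex, 'a) module \<Rightarrow> (nat \<Rightarrow> 'a set) \<Rightarrow> nat \<Rightarrow> (nat \<Rightarrow> 'a set) set" where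
  "assoc_graded_deg A F d =
    {x \<in> carrier (assoc_graded A F). \<forall>e. e \<noteq> d \<longrightarrow> x e = filt_pred A F e}"

text \<open>The sets \<open>D d\<close> and \<open>E d\<close> are the homogeneous components of degree \<open>d\<close>.\<close>
definition graded_alg_isomorphic ::
  "(complex, 'a) module \<Rightarrow> (nat \<Rightarrow> 'a set) \<Rightarrow> (complex, 'b) module \<Rightarrow> (nat \<Rightarrow> 'b set) \<Rightarrow> bool" where
  "graded_alg_isomorphic A D B E \<longleftrightarrow>
    (\<exists>h\<in>ring_iso A B. (\<forall>c. \<forall>x\<in>carrier A. h (c \<odot>\<^bsub>A\<^esub> x) = c \<odot>\<^bsub>B\<^esub> h x) \<and> (\<forall>d. h ` D d = E d))"


section \<open>The tensor algebra \<open>T(V)\<close>\<close>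

text \<open>
  \<open>T(V)\<close> is the free algebra on the \<open>v\<^sub>i\<close>, that is, the monoid algebra of the free monoid of words
  in \<open>'n\<close>.  The convolution product of \<^typ>\<open>'a \<Rightarrow>\<^sub>0 'b\<close> uses the additive notation for the monoid,
  so \<open>+\<close> below is (noncommutative) concatenation.
\<close>
datatype 'n fmon = Word (letters: "'n list")

instantiation fmon :: (type) monoid_add
begin

definition "0 = Word []"
definition "u + w = Word (letters u @ letters w)"

instance
  by standard (simp_all add: zero_fmon_def plus_fmon_def)

end

type_synonym 'n tensor = "'n fmon \<Rightarrow>\<^sub>0 complex"

definition cscale :: "complex \<Rightarrow> ('a \<Rightarrow>\<^sub>0 complex) \<Rightarrow> ('a \<Rightarrow>\<^sub>0 complex)" where
  "cscale c x = Poly_Mapping.map ((*) c) x"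

lemma lookup_cscale [simp]: "Poly_Mapping.lookup (cscale c x) k = c * Poly_Mapping.lookup x k"
  by (simp add: cscale_def map.rep_eq when_def)

definition tensor_alg :: "(complex, 'n tensor) module" where
  "tensor_alg = \<lparr>carrier = UNIV, monoid.mult = (*), one = 1, zero = 0, add = (+), smult = cscale\<rparr>"

definition vec_tensor :: "complex ^ 'n::finite \<Rightarrow> 'n tensor" where
  "vec_tensor v = (\<Sum>i\<in>UNIV. Poly_Mapping.single (Word [i]) (v $ i))"

text \<open>The extension of the linear map \<open>g\<close> to an algebra endomorphism.\<close>
definition tensor_act :: "complex ^ 'n::finite ^ 'n \<Rightarrow> 'n tensor \<Rightarrow> 'n tensor" where
  "tensor_act g x = (\<Sum>w\<in>Poly_Mapping.keys x. cscale (Poly_Mapping.lookup x w)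
     (prod_list (map (\<lambda>i. vec_tensor (g *v bas i)) (letters w))))"

definition tensor_deg :: "nat \<Rightarrow> 'n tensor set" where
  "tensor_deg d = {x. \<forall>w\<in>Poly_Mapping.keys x. length (letters w) = d}"

definition tensor_filt :: "nat \<Rightarrow> 'n tensor set" where
  "tensor_filt d = {x. \<forall>w\<in>Poly_Mapping.keys x. length (letters w) \<le> d}"

definition qcomm :: "('n::finite \<Rightarrow> 'n \<Rightarrow> complex) \<Rightarrow> 'n \<Rightarrow> 'n \<Rightarrow> 'n tensor" where
  "qcomm q i j = vec_tensor (bas i) * vec_tensor (bas j)
                 - cscale (q i j) (vec_tensor (bas j) * vec_tensor (bas i))"


section \<open>\<open>S\<^sub>q(V)\<close> and \<open>S\<^sub>q(V) \<rtimes> G\<close>\<close>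

definition Sq_ideal :: "('n::finite \<Rightarrow> 'n \<Rightarrow> complex) \<Rightarrow> 'n tensor set" where
  "Sq_ideal q = Idl\<^bsub>tensor_alg\<^esub> {qcomm q i j | i j. True}"

definition Sq :: "('n::finite \<Rightarrow> 'n \<Rightarrow> complex) \<Rightarrow> (complex, 'n tensor set) module" where
  "Sq q = quot_alg tensor_alg (Sq_ideal q)"

text \<open>When \<open>g\<close> preserves the defining ideal, its action on a coset is the elementwise image.\<close>
definition Sq_act :: "complex ^ 'n::finite ^ 'n \<Rightarrow> 'n tensor set \<Rightarrow> 'n tensor set" where
  "Sq_act g X = tensor_act g ` X"

definition Sq_skew ::
  "('n::finite \<Rightarrow> 'n \<Rightarrow> complex) \<Rightarrow> (complex, complex ^ 'n ^ 'n \<Rightarrow> 'n tensor set) module" where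
  "Sq_skew q = skew_group_alg (Sq q) G21 Sq_act"

definition Sq_skew_deg ::
  "('n::finite \<Rightarrow> 'n \<Rightarrow> complex) \<Rightarrow> nat \<Rightarrow> (complex ^ 'n ^ 'n \<Rightarrow> 'n tensor set) set" where
  "Sq_skew_deg q d = {a \<in> carrier (Sq_skew q).
     \<forall>g\<in>carrier G21. \<exists>x\<in>tensor_deg d. a g = Sq_ideal q +>\<^bsub>tensor_alg\<^esub> x}"


section \<open>The algebra \<open>H\<^sub>q\<^sub>,\<^sub>\<kappa>\<close>\<close>

text \<open>
  An element of the group algebra of \<open>G\<close> is a finitely supported function on all matrices whose
  support lies in \<open>G\<close>.
\<close>
type_synonym 'n gralg = "complex ^ 'n ^ 'n \<Rightarrow>\<^sub>0 complex"

type_synonym 'n kmap = "complex ^ 'n \<Rightarrow> complex ^ 'n \<Rightarrow> 'n gralg"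

definition tensor_skew :: "(complex, complex ^ 'n::finite ^ 'n \<Rightarrow> 'n tensor) module" where
  "tensor_skew = skew_group_alg tensor_alg G21 tensor_act"

definition tensor_skew_filt :: "nat \<Rightarrow> (complex ^ 'n::finite ^ 'n \<Rightarrow> 'n tensor) set" where
  "tensor_skew_filt d = {a \<in> carrier tensor_skew. \<forall>g. a g \<in> tensor_filt d}"

definition tensor_emb :: "'n tensor \<Rightarrow> (complex ^ 'n::finite ^ 'n \<Rightarrow> 'n tensor)" where
  "tensor_emb x = (\<lambda>g. if g = mat 1 then x else 0)"

definition gralg_emb :: "'n gralg \<Rightarrow> (complex ^ 'n::finite ^ 'n \<Rightarrow> 'n tensor)" where
  "gralg_emb y = (\<lambda>g. cscale (Poly_Mapping.lookup y g) 1)"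

definition H_ideal ::
  "('n::finite \<Rightarrow> 'n \<Rightarrow> complex) \<Rightarrow> 'n kmap \<Rightarrow> (complex ^ 'n ^ 'n \<Rightarrow> 'n tensor) set" where
  "H_ideal q \<kappa> = Idl\<^bsub>tensor_skew\<^esub>
     {tensor_emb (qcomm q i j) - gralg_emb (\<kappa> (bas i) (bas j)) | i j. True}"

definition H_alg ::
  "('n::finite \<Rightarrow> 'n \<Rightarrow> complex) \<Rightarrow> 'n kmap \<Rightarrow>
   (complex, (complex ^ 'n ^ 'n \<Rightarrow> 'n tensor) set) module" where
  "H_alg q \<kappa> = quot_alg tensor_skew (H_ideal q \<kappa>)"

definition H_filt ::
  "('n::finite \<Rightarrow> 'n \<Rightarrow> complex) \<Rightarrow> 'n kmap \<Rightarrow> nat \<Rightarrow> (complex ^ 'n ^ 'n \<Rightarrow> 'n tensor) set set" where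
  "H_filt q \<kappa> d = {H_ideal q \<kappa> +>\<^bsub>tensor_skew\<^esub> a | a. a \<in> tensor_skew_filt d}"

definition is_quantum_DH :: "('n::finite \<Rightarrow> 'n \<Rightarrow> complex) \<Rightarrow> 'n kmap \<Rightarrow> bool" where
  "is_quantum_DH q \<kappa> \<longleftrightarrow> graded_alg_isomorphic
     (assoc_graded (H_alg q \<kappa>) (H_filt q \<kappa>)) (assoc_graded_deg (H_alg q \<kappa>) (H_filt q \<kappa>))
     (Sq_skew q) (Sq_skew_deg q)"


section \<open>The maps \<open>\<kappa>\<close>\<close>

definition kscale :: "complex \<Rightarrow> 'n::finite kmap \<Rightarrow> 'n kmap" where
  "kscale c \<kappa> = (\<lambda>v w. cscale c (\<kappa> v w))"

global_interpretation kmaps: vector_space kscale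
  by standard
    (auto simp: kscale_def fun_eq_iff lookup_add algebra_simps intro!: poly_mapping_eqI)

text \<open>The maps under consideration: bilinear, with values in the group algebra, and satisfying
  \<open>\<kappa>(v\<^sub>i,v\<^sub>j) = -q\<^sub>i\<^sub>j \<kappa>(v\<^sub>j,v\<^sub>i)\<close>.\<close>
definition admissible :: "('n::finite \<Rightarrow> 'n \<Rightarrow> complex) \<Rightarrow> 'n kmap \<Rightarrow> bool" where
  "admissible q \<kappa> \<longleftrightarrow>
     (\<forall>v. Vector_Spaces.linear (*s) cscale (\<kappa> v)) \<and>
     (\<forall>w. Vector_Spaces.linear (*s) cscale (\<lambda>v. \<kappa> v w)) \<and>
     (\<forall>v w. Poly_Mapping.keys (\<kappa> v w) \<subseteq> carrier G21) \<and>
     (\<forall>i j. \<kappa> (bas i) (bas j) = cscale (- q i j) (\<kappa> (bas j) (bas i)))"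

definition quantum_DH_maps :: "('n::finite \<Rightarrow> 'n \<Rightarrow> complex) \<Rightarrow> 'n kmap set" where
  "quantum_DH_maps q = {\<kappa>. admissible q \<kappa> \<and> is_quantum_DH q \<kappa>}"

text \<open>The bilinear map with value \<open>f i j\<close> at \<open>(v\<^sub>i, v\<^sub>j)\<close> for \<open>i \<noteq> j\<close> and \<open>0\<close> at \<open>(v\<^sub>i, v\<^sub>i)\<close>.\<close>
definition kmap_of :: "('n::finite \<Rightarrow> 'n \<Rightarrow> 'n gralg) \<Rightarrow> 'n kmap" where
  "kmap_of f = (\<lambda>v w. \<Sum>i\<in>UNIV. \<Sum>j\<in>UNIV - {i}. cscale (v $ i * w $ j) (f i j))"

abbreviation gel :: "complex ^ 'n::finite ^ 'n \<Rightarrow> 'n gralg" where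
  "gel g \<equiv> Poly_Mapping.single g 1"

definition kappa1 :: "'n::finite kmap" where
  "kappa1 = kmap_of (\<lambda>i j. gel (cyc [i, j]) - gel (zeta i ** zeta j ** cyc [i, j]))"

definition kappa2 :: "'n::finite kmap" where
  "kappa2 = kmap_of (\<lambda>i j. \<Sum>k\<in>UNIV - {i, j}.
       gel (cyc [i, j, k])
     - gel (zeta i ** zeta j ** cyc [i, j, k])
     - gel (zeta j ** zeta k ** cyc [i, j, k])
     + gel (zeta i ** zeta k ** cyc [i, j, k])
     + gel (cyc [i, k, j])
     - gel (zeta i ** zeta j ** cyc [i, k, j])
     + gel (zeta j ** zeta k ** cyc [i, k, j])
     - gel (zeta i ** zeta k ** cyc [i, k, j]))"

end

theory Submission
  imports Defs
begin

text \<open>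
  Write \<open>\<kappa>(v\<^sub>i, v\<^sub>j) = \<Sum> k\<^sub>i\<^sub>j(g) g\<close>.  The algebra is a quantum Drinfeld Hecke algebra if and only if \<open>k\<close> is
  invariant under conjugation and satisfies the super Jacobi identity that comes from
  \<open>[v\<^sub>i, {v\<^sub>j, v\<^sub>l}]\<close> summed cyclically.

  Sufficiency is a diamond lemma in dual form: sorting words step by step shows that every functional
  on \<open>T(V)\<^sub>d \<rtimes> G\<close> that kills the homogeneous relations extends, by zero in lower degrees, to a
  functional on \<open>T(V) \<rtimes> G\<close> that kills the ideal.  Hence leading terms of elements of the ideal vanish
  in \<open>S\<^sub>q(V) \<rtimes> G\<close>.  For necessity, comparing dimensions in degrees \<open>0\<close> and \<open>1\<close> shows that
  the ideal contains no nonzero element of filtration degree at most \<open>1\<close>; conjugating the relations and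
  forming the Jacobi sum produces such elements.

  If \<open>k\<^sub>i\<^sub>j(g) \<noteq> 0\<close>, invariance under diagonal matrices and the Jacobi identity force \<open>g\<close> to be conjugate
  to a transposition or a \<open>3\<close>-cycle moving \<open>i\<close> and \<open>j\<close>.  By invariance \<open>k\<close> is then determined by
  two numbers, and on these two classes \<open>\<kappa>\<^sub>1\<close> and \<open>\<kappa>\<^sub>2\<close> have the coefficients
  \<open>g\<^sub>i\<^sub>j\<close> and \<open>g\<^sub>i\<^sub>j + g\<^sub>j\<^sub>i\<close> (matrix entries).
\<close>

section \<open>Signed permutation matrices\<close>

text \<open>A quantum Drinfeld Hecke algebra only has to admit some graded isomorphism; the
  canonical map need not be the one. So necessity turns an arbitrary isomorphism into a surjective
  linear endomorphism of a finite-dimensional degree component of T(V) \<rtimes> G, which is then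
  injective. This works where the quadratic ideal is zero, in degrees 0 and 1, and these suffice
  because the quadratic or cubic parts cancel in the elements considered; for the Jacobi sum this is
  [x,{y,z}] + [y,{z,x}] + [z,{x,y}] = 0, valid in every associative algebra.

  For sufficiency, functionals avoid any normal form in the quotient: one functional that kills an
  ideal shows that an element lies outside it. The two kinds of ambiguity in sorting match the two
  conditions: disjoint descents need invariance, overlapping descents need the Jacobi identity. The
  action is monomial, so moving a group element past a word costs one sign and one relabelling of
  letters.\<close>

definition smat :: "('n::finite \<Rightarrow> 'n) \<Rightarrow> ('n \<Rightarrow> complex) \<Rightarrow> complex ^ 'n ^ 'n" where
  "smat p s = (\<chi> a b. if a = p b then s b else 0)"

definition mperm :: "complex ^ 'n ^ 'n \<Rightarrow> 'n::finite \<Rightarrow> 'n" where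
  "mperm g b = (THE a. g $ a $ b \<noteq> 0)"

text \<open>A signed permutation matrix has one nonzero entry per column, so the column sum is that
  entry: \<open>g\<close> sends \<open>v_b\<close> to \<open>msign g b\<close> times the basis
  vector with index \<open>mperm g b\<close>.\<close>

definition msign :: "complex ^ 'n ^ 'n \<Rightarrow> 'n::finite \<Rightarrow> complex" where
  "msign g b = (\<Sum>a\<in>UNIV. g $ a $ b)"

abbreviation GG :: "(complex ^ 'n::finite ^ 'n) set" where
  "GG \<equiv> carrier G21"

lemma smat_nth: "smat p s $ a $ b = (if a = p b then s b else 0)"
  by (simp add: smat_def)

lemma msign_smat [simp]: "msign (smat p s) = s"
  by (auto simp: msign_def smat_nth)

lemma mperm_smat: "s b \<noteq> 0 \<Longrightarrow> mperm (smat p s) b = p b"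
  by (auto simp: mperm_def smat_nth)

lemma smat_mult: "smat p s ** smat p' s' = smat (p \<circ> p') (\<lambda>b. s (p' b) * s' b)"
  by (auto simp: smat_def matrix_matrix_mult_def vec_eq_iff
      if_distrib [of "\<lambda>x. x * _"] if_distrib [of "\<lambda>x. _ * x"] cong: if_cong)

lemma smat_one: "mat 1 = smat id (\<lambda>_. 1)"
  by (simp add: smat_def mat_def vec_eq_iff)

lemma sign_perm_smat:
  assumes "bij \<sigma>"
  shows "sign_mat L ** perm_mat \<sigma> = smat \<sigma> (\<lambda>b. if \<sigma> b \<in> L then - 1 else 1)"
proof -
  have "sign_mat L = smat id (\<lambda>b. if b \<in> L then - 1 else 1)" "perm_mat \<sigma> = smat \<sigma> (\<lambda>_. 1)"
    by (simp_all add: sign_mat_def perm_mat_def smat_def vec_eq_iff)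
  then show ?thesis by (simp add: smat_mult)
qed

lemma GG_smat:
  assumes "g \<in> GG"
  obtains p s where "bij p" "\<And>b. s b = 1 \<or> s b = -1" "g = smat p s"
proof -
  obtain L \<sigma> where \<sigma>: "\<sigma> permutes UNIV" and g: "g = sign_mat L ** perm_mat \<sigma>"
    using assms unfolding G21_def by auto
  have b: "bij \<sigma>" using \<sigma> by (simp add: permutes_bij)
  show ?thesis
    by (rule that [OF b, of "\<lambda>b. if \<sigma> b \<in> L then - 1 else 1"]) (use g sign_perm_smat [OF b] in auto)
qed

lemma smat_in_GG:
  assumes "bij p" "\<And>b. s b = 1 \<or> s b = -1"
  shows "smat p s \<in> GG"
proof -
  \<comment> \<open>Signs stand to the left of the permutation, so the sign of column
    \<open>b\<close> belongs to row \<open>p b\<close>; hence the image under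
    \<open>p\<close>.\<close>
  have "smat p s = sign_mat (p ` {b. s b = -1}) ** perm_mat p"
    using assms by (auto simp: sign_perm_smat smat_def vec_eq_iff inj_image_mem_iff bij_is_inj)
  then show ?thesis
    using assms(1) unfolding G21_def
    by (auto simp: permutes_def bij_iff)
qed

lemma GG_decomp:
  assumes "g \<in> GG"
  shows bij_mperm: "bij (mperm g)" and msign_cases: "msign g b = 1 \<or> msign g b = -1"
    and smat_mperm: "smat (mperm g) (msign g) = g"
proof -
  obtain p s where p: "bij p" and s: "\<And>b. s b = 1 \<or> s b = -1" and g: "g = smat p s"
    using GG_smat [OF assms] by metis
  have "mperm g b = p b" for b
    using s [of b] unfolding g by (subst mperm_smat) auto
  then have "mperm g = p" by auto
  then show "bij (mperm g)" "msign g b = 1 \<or> msign g b = -1" "smat (mperm g) (msign g) = g"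
    using p s g by auto
qed

lemma msign_sq: "g \<in> GG \<Longrightarrow> msign g b * msign g b = 1"
  using msign_cases [of g b] by auto

lemma msign_nz: "g \<in> GG \<Longrightarrow> msign g b \<noteq> 0"
  using msign_cases [of g b] by auto

lemma GG_nth: "g \<in> GG \<Longrightarrow> g $ a $ b = (if a = mperm g b then msign g b else 0)"
  using smat_mperm [of g] smat_nth by metis

lemma mperm_inj: "g \<in> GG \<Longrightarrow> mperm g a = mperm g b \<longleftrightarrow> a = b"
  using bij_mperm [of g] by (meson bij_is_inj injD)

lemma GG_eqI:
  assumes "g \<in> GG" "h \<in> GG" "mperm g = mperm h" "msign g = msign h"
  shows "g = h"
  using smat_mperm assms by metis

lemma mperm_smat': "(\<And>b. s b = 1 \<or> s b = -1) \<Longrightarrow> mperm (smat p s) = p"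
  by (rule ext, rule mperm_smat) (metis zero_neq_one neg_equal_0_iff_equal)

lemma
  assumes "g \<in> GG" "h \<in> GG"
  shows GG_mult [simp, intro]: "g ** h \<in> GG"
    and mperm_mult: "mperm (g ** h) = mperm g \<circ> mperm h"
    and msign_mult: "msign (g ** h) = (\<lambda>b. msign g (mperm h b) * msign h b)"
proof -
  have e: "g ** h = smat (mperm g \<circ> mperm h) (\<lambda>b. msign g (mperm h b) * msign h b)"
    using smat_mult smat_mperm assms by metis
  have s: "msign g (mperm h b) * msign h b = 1 \<or> msign g (mperm h b) * msign h b = - 1" for b
    using msign_cases [OF assms(1), of "mperm h b"] msign_cases [OF assms(2), of b] by auto
  show "g ** h \<in> GG"
    unfolding e by (rule smat_in_GG) (use s assms in \<open>auto intro: bij_comp bij_mperm\<close>)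
  show "mperm (g ** h) = mperm g \<circ> mperm h"
    unfolding e by (rule mperm_smat') (use s in auto)
  show "msign (g ** h) = (\<lambda>b. msign g (mperm h b) * msign h b)"
    unfolding e by simp
qed

lemma GG_one [simp, intro]: "mat 1 \<in> GG"
  unfolding smat_one by (rule smat_in_GG) auto

lemma mperm_one [simp]: "mperm (mat 1) = id"
  unfolding smat_one by (rule mperm_smat') auto

lemma msign_one [simp]: "msign (mat 1) = (\<lambda>_. 1)"
  unfolding smat_one by simp

lemma G21_simps [simp]:
  "x \<otimes>\<^bsub>G21\<^esub> y = x ** y" "\<one>\<^bsub>G21\<^esub> = mat 1"
  by (simp_all add: G21_def)

lemma group_G21: "group (G21 :: (complex ^ 'n::finite ^ 'n) monoid)"
proof (rule groupI; simp?)
  fix x y z :: "complex ^ 'n ^ 'n"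
  show "x ** y ** z = x ** (y ** z)" by (simp add: matrix_mul_assoc)
next
  fix g :: "complex ^ 'n ^ 'n"
  assume g: "g \<in> GG"
  define p s where "p = inv_into UNIV (mperm g)" and "s = (\<lambda>b. msign g (p b))"
  have b: "bij (mperm g)" using g by (rule bij_mperm)
  have s: "s b = 1 \<or> s b = -1" for b
    unfolding s_def by (rule msign_cases [OF g])
  have in_G: "smat p s \<in> GG"
    by (rule smat_in_GG) (use s b in \<open>auto simp: p_def bij_imp_bij_inv\<close>)
  have "smat p s ** g = smat p s ** smat (mperm g) (msign g)"
    using smat_mperm [OF g] by simp
  also have "\<dots> = mat 1"
    unfolding smat_mult smat_one s_def p_def
    using b msign_sq [OF g] by (auto simp: smat_def vec_eq_iff bij_is_inj inv_f_f)
  finally show "\<exists>y\<in>GG. y ** g = mat 1"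
    using in_G by blast
qed

global_interpretation G21: group "G21 :: (complex ^ 'n::finite ^ 'n) monoid"
  by (rule group_G21)

abbreviation ginv :: "complex ^ 'n::finite ^ 'n \<Rightarrow> complex ^ 'n ^ 'n" where
  "ginv g \<equiv> inv\<^bsub>G21\<^esub> g"

lemma ginv_facts:
  assumes "g \<in> GG"
  shows "ginv g \<in> GG" "ginv g ** g = mat 1" "g ** ginv g = mat 1"
  using G21.inv_closed [OF assms] G21.l_inv [OF assms] G21.r_inv [OF assms] by simp_all

lemma ginv_cancel:
  assumes "g \<in> GG"
  shows "ginv g ** (g ** h) = h" "g ** (ginv g ** h) = h"
    "(h ** g) ** ginv g = h" "(h ** ginv g) ** g = h"
  using ginv_facts [OF assms] by (simp_all add: matrix_mul_assoc flip: matrix_mul_assoc [of h])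

lemma ginv_one [simp]: "ginv (mat 1) = mat 1"
  using G21.inv_one by simp

lemma finite_GG [simp, intro]: "finite (GG :: (complex ^ 'n::finite ^ 'n) set)"
proof -
  have "GG \<subseteq> (\<lambda>(L, \<sigma>). sign_mat L ** perm_mat \<sigma> :: complex ^ 'n ^ 'n) ` UNIV"
    unfolding G21_def by auto
  moreover have "finite (UNIV :: ('n set \<times> ('n \<Rightarrow> 'n)) set)"
    by simp
  ultimately show ?thesis
    by (meson finite_imageI finite_subset)
qed

lemma sum_GG_left_mult:
  assumes "h \<in> GG"
  shows "(\<Sum>g\<in>GG. f (h ** g)) = (\<Sum>g\<in>GG. f g)"
  by (rule sum.reindex_bij_witness [of _ "\<lambda>g. ginv h ** g" "\<lambda>g. h ** g"])
    (use assms ginv_facts [OF assms] ginv_cancel [OF assms] in auto)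

lemma sum_GG_right_mult:
  assumes "h \<in> GG"
  shows "(\<Sum>g\<in>GG. f (g ** h)) = (\<Sum>g\<in>GG. f g)"
  by (rule sum.reindex_bij_witness [of _ "\<lambda>g. g ** ginv h" "\<lambda>g. g ** h"])
    (use assms ginv_facts [OF assms] ginv_cancel [OF assms] in auto)

lemma sum_GG_conj:
  assumes "h \<in> GG"
  shows "(\<Sum>g\<in>GG. f (h ** g ** ginv h)) = (\<Sum>g\<in>GG. f g)"
  using sum_GG_left_mult [OF assms, of "\<lambda>g. f (g ** ginv h)"]
    sum_GG_right_mult [OF ginv_facts(1) [OF assms], of f] by simp

section \<open>Functionals on words that respect the relations\<close>

definition msigns :: "complex ^ 'n ^ 'n \<Rightarrow> 'n::finite list \<Rightarrow> complex" where
  "msigns g w = prod_list (map (msign g) w)"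

lemma msigns_simps [simp]:
  "msigns g [] = 1" "msigns g (x # w) = msign g x * msigns g w"
  "msigns g (v @ w) = msigns g v * msigns g w"
  by (simp_all add: msigns_def)

lemma msigns_mult:
  "g \<in> GG \<Longrightarrow> h \<in> GG \<Longrightarrow> msigns (g ** h) w = msigns g (map (mperm h) w) * msigns h w"
  by (induction w) (simp_all add: msign_mult)

text \<open>If \<open>F w g\<close> is the value of a functional on the basis element
  \<open>w g\<close> of T(V) \<rtimes> G, this is its value on \<open>u\<close> \<kappa>(v_i, v_j)
  \<open>z g\<close>: each \<open>h\<close> occurring in \<kappa>(v_i, v_j) is moved to the right
  past \<open>z\<close>.\<close>

definition contr ::
  "('n::finite \<Rightarrow> 'n \<Rightarrow> complex ^ 'n ^ 'n \<Rightarrow> complex) \<Rightarrow> ('n list \<Rightarrow> complex ^ 'n ^ 'n \<Rightarrow> complex) \<Rightarrow>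
    'n \<Rightarrow> 'n \<Rightarrow> 'n list \<Rightarrow> 'n list \<Rightarrow> complex ^ 'n ^ 'n \<Rightarrow> complex" where
  "contr k F i j u z g =
    (\<Sum>h\<in>GG. k i j h * msigns h z * F (u @ map (mperm h) z) (h ** g))"

text \<open>Coefficientwise form of \<kappa>(h v_i, h v_j) = h \<kappa>(v_i, v_j) h^{-1}. The signs
  of h v_i and h v_j are their own inverses, so they may stand on either side.\<close>

definition invariant :: "('n::finite \<Rightarrow> 'n \<Rightarrow> complex ^ 'n ^ 'n \<Rightarrow> complex) \<Rightarrow> bool" where
  "invariant k \<longleftrightarrow> (\<forall>h\<in>GG. \<forall>g\<in>GG. \<forall>i j. i \<noteq> j \<longrightarrow>
     k (mperm h i) (mperm h j) (h ** g ** ginv h) = msign h i * msign h j * k i j g)"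

text \<open>The Jacobi identity \<open>\<Sum> k(v\<^sub>b, v\<^sub>c)(g) (g v\<^sub>a - v\<^sub>a) = 0\<close> (cyclic sum), tested against all linear
  functionals \<open>f\<close> on \<open>V\<close>.\<close>
definition jacobi :: "('n::finite \<Rightarrow> 'n \<Rightarrow> complex ^ 'n ^ 'n \<Rightarrow> complex) \<Rightarrow> bool" where
  "jacobi k \<longleftrightarrow> (\<forall>g\<in>GG. \<forall>a b c. \<forall>f :: 'n \<Rightarrow> complex. a \<noteq> b \<longrightarrow> b \<noteq> c \<longrightarrow> a \<noteq> c \<longrightarrow>
     k b c g * (msign g a * f (mperm g a) - f a)
   + k c a g * (msign g b * f (mperm g b) - f b)
   + k a b g * (msign g c * f (mperm g c) - f c) = 0)"

text \<open>The ambiguity of three neighbouring letters. It is resolved for each group element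
  \<open>h\<close> separately: the six terms differ only in the letter between \<open>u\<close> and
  the image of \<open>z\<close>, and with \<open>F\<close> viewed as a function of this letter they
  form the Jacobi identity.\<close>

lemma contr_overlap:
  assumes "jacobi k" "a \<noteq> b" "b \<noteq> c" "a \<noteq> c"
  shows "contr k F b c u (a # z) g - contr k F b c (u @ [a]) z g
    + (contr k F c a u (b # z) g - contr k F c a (u @ [b]) z g)
    + (contr k F a b u (c # z) g - contr k F a b (u @ [c]) z g) = 0"
proof -
  have *: "k b c h * msigns h (a # z) * F (u @ map (mperm h) (a # z)) (h ** g)
      - k b c h * msigns h z * F ((u @ [a]) @ map (mperm h) z) (h ** g)
      + (k c a h * msigns h (b # z) * F (u @ map (mperm h) (b # z)) (h ** g)
      - k c a h * msigns h z * F ((u @ [b]) @ map (mperm h) z) (h ** g))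
      + (k a b h * msigns h (c # z) * F (u @ map (mperm h) (c # z)) (h ** g)
      - k a b h * msigns h z * F ((u @ [c]) @ map (mperm h) z) (h ** g)) = 0"
    (is "?L = 0") if h: "h \<in> GG" for h
  proof -
    define f where "f l = F (u @ l # map (mperm h) z) (h ** g)" for l
    have "?L = msigns h z * (k b c h * (msign h a * f (mperm h a) - f a)
        + k c a h * (msign h b * f (mperm h b) - f b)
        + k a b h * (msign h c * f (mperm h c) - f c))"
      by (simp add: f_def algebra_simps)
    then show ?thesis
      using assms h unfolding jacobi_def by simp
  qed
  show ?thesis
    unfolding contr_def sum_subtractf [symmetric] sum.distrib [symmetric]
    by (rule sum.neutral) (use * in blast)
qed

text \<open>The ambiguity of two separate pairs: contracting both, in either order, gives the same
  double sum. Contracting \<open>c d\<close> first moves a group element past \<open>a b\<close>,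
  and invariance undoes the resulting conjugation. The bound \<open>m\<close> allows use inside an
  induction, where the relations for \<open>F\<close> are known on short words only.\<close>

lemma contr_disjoint:
  fixes k :: "'n::finite \<Rightarrow> 'n \<Rightarrow> complex ^ 'n ^ 'n \<Rightarrow> complex"
  assumes k: "invariant k"
    and F: "\<And>u a b z g. length u + length z < m \<Longrightarrow> a \<noteq> b \<Longrightarrow>
      F (u @ a # b # z) g + F (u @ b # a # z) g = contr k F a b u z g"
    and m: "length u + length y + length z < m" and "c \<noteq> d" "a \<noteq> b"
  shows "contr k F c d u (y @ a # b # z) g + contr k F c d u (y @ b # a # z) g
       = contr k F a b (u @ c # d # y) z g + contr k F a b (u @ d # c # y) z g"
proof -
  let ?t = "\<lambda>h l. k c d h * k a b l * msigns h y * msigns (h ** l) z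
    * F (u @ map (mperm h) y @ map (mperm h \<circ> mperm l) z) (h ** l ** g)"
  have left: "k c d h * msigns h (y @ a # b # z) * F (u @ map (mperm h) (y @ a # b # z)) (h ** g)
      + k c d h * msigns h (y @ b # a # z) * F (u @ map (mperm h) (y @ b # a # z)) (h ** g)
      = (\<Sum>l\<in>GG. ?t h l)" (is "?L = _") if h: "h \<in> GG" for h
  proof -
    let ?p = "mperm h"
    have "?L = k c d h * msigns h (y @ a # b # z)
       * contr k F (?p a) (?p b) (u @ map ?p y) (map ?p z) (h ** g)"
      using F [of "u @ map ?p y" "map ?p z" "?p a" "?p b" "h ** g", symmetric] m \<open>a \<noteq> b\<close> h
      by (simp add: algebra_simps mperm_inj)
    \<comment> \<open>The sum runs over the conjugates \<open>h l h^-1\<close>, since the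
      coefficient of the moved pair there is, up to sign, that of the original pair at
      \<open>l\<close>.\<close>
    also have "contr k F (?p a) (?p b) (u @ map ?p y) (map ?p z) (h ** g) =
        (\<Sum>l\<in>GG. k (?p a) (?p b) (h ** l ** ginv h) * msigns (h ** l ** ginv h) (map ?p z)
          * F ((u @ map ?p y) @ map (mperm (h ** l ** ginv h)) (map ?p z))
            (h ** l ** ginv h ** (h ** g)))"
      unfolding contr_def by (rule sum_GG_conj [OF h, symmetric])
    also have "k c d h * msigns h (y @ a # b # z) * \<dots> = (\<Sum>l\<in>GG. ?t h l)"
      unfolding sum_distrib_left
    proof (rule sum.cong [OF refl])
      fix l :: "complex ^ 'n ^ 'n" assume l: "l \<in> GG"
      let ?c = "h ** l ** ginv h"
      have c: "?c \<in> GG" "?c ** h = h ** l"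
        using h l ginv_facts ginv_cancel by auto
      have 1: "?c ** (h ** g) = h ** l ** g"
        by (simp add: c(2) matrix_mul_assoc)
      have 2: "mperm ?c \<circ> ?p = ?p \<circ> mperm l"
        using mperm_mult [OF c(1) h] mperm_mult [OF h l] c(2) by simp
      have 3: "msigns ?c (map ?p z) * msigns h z = msigns (h ** l) z"
        using msigns_mult [OF c(1) h, of z] c(2) by simp
      have 4: "k (?p a) (?p b) ?c = msign h a * msign h b * k a b l"
        using k h l \<open>a \<noteq> b\<close> unfolding invariant_def by blast
      have 5: "msign h a * msign h a = 1" "msign h b * msign h b = 1"
        using h by (simp_all add: msign_sq)
      have "k c d h * msigns h (y @ a # b # z) * (k (?p a) (?p b) ?c * msigns ?c (map ?p z) * X)
        = k c d h * k a b l * msigns h y * (msign h a * msign h a) * (msign h b * msign h b)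
          * (msigns ?c (map ?p z) * msigns h z) * X" for X
        unfolding 4 by simp
      then show "k c d h * msigns h (y @ a # b # z) * (k (?p a) (?p b) ?c * msigns ?c (map ?p z)
          * F ((u @ map ?p y) @ map (mperm ?c) (map ?p z)) (?c ** (h ** g))) = ?t h l"
        unfolding 5 3 1 by (simp add: 2)
    qed
    finally show ?thesis .
  qed
  have right: "k a b l * msigns l z * F ((u @ c # d # y) @ map (mperm l) z) (l ** g)
      + k a b l * msigns l z * F ((u @ d # c # y) @ map (mperm l) z) (l ** g)
      = (\<Sum>h\<in>GG. ?t h l)" (is "?R = _") if l: "l \<in> GG" for l
  proof -
    have "?R = k a b l * msigns l z * contr k F c d u (y @ map (mperm l) z) (l ** g)"
      using F [of u "y @ map (mperm l) z" c d "l ** g", symmetric] m \<open>c \<noteq> d\<close>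
      by (simp add: algebra_simps)
    also have "\<dots> = (\<Sum>h\<in>GG. ?t h l)"
      unfolding contr_def sum_distrib_left
      by (rule sum.cong) (use l in \<open>auto simp: msigns_mult matrix_mul_assoc\<close>)
    finally show ?thesis .
  qed
  have "contr k F c d u (y @ a # b # z) g + contr k F c d u (y @ b # a # z) g
      = (\<Sum>h\<in>GG. \<Sum>l\<in>GG. ?t h l)"
    unfolding contr_def sum.distrib [symmetric] by (rule sum.cong [OF refl left])
  also have "\<dots> = (\<Sum>l\<in>GG. \<Sum>h\<in>GG. ?t h l)"
    by (rule sum.swap)
  also have "\<dots> = contr k F a b (u @ c # d # y) z g + contr k F a b (u @ d # c # y) z g"
    unfolding contr_def sum.distrib [symmetric] by (rule sum.cong [OF refl right, symmetric])
  finally show ?thesis .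
qed

lemma diff_eq_diff_shift:
  fixes p1 :: "'a :: ab_group_add"
  assumes "p1 = k1 - q" "p2 = k2 - q" "k3 + k2 = k4 + k1"
  shows "k3 - p1 = k4 - p2"
proof -
  have "k3 = k4 + k1 - k2"
    using assms(3) by (simp add: eq_diff_eq)
  then show ?thesis by (simp add: assms)
qed

section \<open>Sorting words: the diamond lemma\<close>

locale pbw =
  fixes k :: "'n::finite \<Rightarrow> 'n \<Rightarrow> complex ^ 'n ^ 'n \<Rightarrow> complex"
    and rk :: "'n \<Rightarrow> nat"
    and base :: "'n list \<Rightarrow> complex ^ 'n ^ 'n \<Rightarrow> complex"
  assumes k_sym: "k i j = k j i"
    and k_inv: "invariant k"
    and k_jac: "jacobi k"
    and inj_rk: "inj rk"
begin

text \<open>Each letter contributes its rank times the number of letters from it to the end of the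
  word, so moving a letter of larger rank one place to the right lowers the sum.\<close>

fun wt :: "'n list \<Rightarrow> nat" where
  "wt [] = 0"
| "wt (x # w) = rk x * Suc (length w) + wt w"

definition descent :: "'n list \<Rightarrow> 'n list \<times> 'n \<times> 'n \<times> 'n list \<Rightarrow> bool" where
  "descent w = (\<lambda>(u, j, i, z). w = u @ j # i # z \<and> rk i < rk j)"

lemma wt_swap: "rk i < rk j \<Longrightarrow> wt (u @ i # j # z) < wt (u @ j # i # z)"
  by (induction u) auto

text \<open>The termination goals of \<open>Phi\<close> mention a descent only through
  \<open>SOME\<close>; this turns the equation into the shape of the word.\<close>

lemma some_descent:
  "descent w d \<Longrightarrow> (u, j, i, z) = (SOME d. descent w d) \<Longrightarrow> w = u @ j # i # z \<and> rk i < rk j"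
proof -
  assume "descent w d" and e: "(u, j, i, z) = (SOME d. descent w d)"
  then have "descent w (u, j, i, z)"
    by (metis someI)
  then show "w = u @ j # i # z \<and> rk i < rk j"
    by (simp add: descent_def)
qed

text \<open>One sorting step at an arbitrarily chosen descent. The contraction is written out
  instead of using \<open>contr\<close>, so that the recursive calls appear at explicit, shorter
  words. Sorted words take their values from \<open>base\<close>.\<close>

function Phi :: "'n list \<Rightarrow> complex ^ 'n ^ 'n \<Rightarrow> complex" where
  "Phi w = (if \<exists>d. descent w d
     then case SOME d. descent w d of (u, j, i, z) \<Rightarrow>
       (\<lambda>g. (\<Sum>h\<in>GG. k j i h * msigns h z * Phi (u @ map (mperm h) z) (h ** g)) - Phi (u @ i # j # z) g)
     else base w)"
  by auto
termination
  by (relation "measures [length, wt]") (auto dest!: some_descent simp: wt_swap)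

declare Phi.simps [simp del]

lemma Phi_sorted: "\<nexists>d. descent w d \<Longrightarrow> Phi w = base w"
  by (simp add: Phi.simps)

lemma word_induct [case_names sorted descent]:
  assumes "\<And>w. (\<nexists>d. descent w d) \<Longrightarrow> P w"
    and "\<And>u j i z. rk i < rk j \<Longrightarrow> P (u @ i # j # z)
      \<Longrightarrow> (\<And>w. length w < length (u @ j # i # z) \<Longrightarrow> P w) \<Longrightarrow> P (u @ j # i # z)"
  shows "P w"
proof (induction w rule: wf_induct_rule [OF wf_measures [of "[length, wt]"]])
  case (1 w)
  show ?case
  proof (cases "\<exists>d. descent w d")
    case True
    then obtain u j i z where w: "w = u @ j # i # z" and ij: "rk i < rk j"
      by (auto simp: descent_def)
    show ?thesis
      unfolding w by (rule assms(2) [OF ij]) (use 1 wt_swap [OF ij] w in auto)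
  qed (use assms(1) in blast)
qed

text \<open>The heart of the diamond lemma: the recursion holds at every descent, not only at the
  chosen one. The induction hypothesis enters as \<open>lower\<close>, the full relation on shorter
  words, and as \<open>same\<close>, the recursion on words of equal length and smaller weight;
  \<open>indep\<close> compares two descents of \<open>w\<close>.\<close>

lemma Phi_descent: "descent w (u, j, i, z) \<Longrightarrow>
  Phi w g = contr k Phi j i u z g - Phi (u @ i # j # z) g"
proof (induction w arbitrary: u j i z g rule: wf_induct_rule [OF wf_measures [of "[length, wt]"]])
  case (1 w)
  have lower: "Phi (u @ a # b # z) g + Phi (u @ b # a # z) g = contr k Phi a b u z g"
    if "length u + length z + 2 < length w" and "a \<noteq> b" for u a b z g
  proof (cases "rk a < rk b")
    case True
    then have "descent (u @ b # a # z) (u, b, a, z)"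
      by (simp add: descent_def)
    then have "Phi (u @ b # a # z) g = contr k Phi b a u z g - Phi (u @ a # b # z) g"
      using that by (intro 1) auto
    moreover have "contr k Phi b a u z g = contr k Phi a b u z g"
      by (simp add: contr_def k_sym [of b a])
    ultimately show ?thesis by simp
  next
    case False
    then have "descent (u @ a # b # z) (u, a, b, z)"
      using inj_rk \<open>a \<noteq> b\<close> by (simp add: descent_def nat_less_le inj_eq)
    then have "Phi (u @ a # b # z) g = contr k Phi a b u z g - Phi (u @ b # a # z) g"
      using that by (intro 1) auto
    then show ?thesis by simp
  qed
  have same: "Phi v g = contr k Phi j i u z g - Phi (u @ i # j # z) g"
    if "v = u @ j # i # z" "rk i < rk j" "length v = length w" "wt v < wt w" for v u j i z g
    using that by (intro 1) (auto simp: descent_def)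
  have indep: "contr k Phi d c u x g - Phi (u @ c # d # x) g
      = contr k Phi b a v z g - Phi (v @ a # b # z) g"
    if D: "descent w (u, d, c, x)" "descent w (v, b, a, z)" and uv: "length u < length v"
    for u d c x v b a z
  proof -
    have w: "w = u @ d # c # x" "w = v @ b # a # z" and o: "rk c < rk d" "rk a < rk b"
      using D by (auto simp: descent_def)
    have e: "u @ d # c # x = v @ b # a # z" using w by simp
    then have tv: "take (length u) v = u"
      using uv by (metis append_eq_append_conv_if append_eq_conv_conj less_imp_le_nat)
    then obtain t where t: "v = u @ t"
      by (metis append_take_drop_id)
    with uv obtain d' t' where t2: "t = d' # t'" by (cases t) auto
    have d: "d' = d" and e2: "c # x = t' @ b # a # z"
      using e unfolding t t2 by auto
    show ?thesis
    proof (cases t')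
      \<comment> \<open>The descents share a letter: the word contains \<open>d c a\<close> with
        falling ranks, and both ways of sorting it end in \<open>a c d\<close>. The contractions
        along the two paths differ by the Jacobi sum.\<close>
      case Nil
      then have bc: "b = c" and x: "x = a # z" and v: "v = u @ [d]"
        using e2 t t2 d by auto
      have w: "w = u @ d # c # a # z" using w x by simp
      have ne: "a \<noteq> c" "c \<noteq> d" "a \<noteq> d" using o bc by auto
      have r: "rk a < rk d" using o bc by simp
      have w1: "wt (u @ c # d # a # z) < wt w"
        unfolding w using wt_swap [OF o(1), of u "a # z"] by simp
      have w2: "wt (u @ d # a # c # z) < wt w"
        unfolding w using wt_swap [OF o(2), of "u @ [d]" z] bc by simp
      have w3: "wt (u @ c # a # d # z) < wt w"
        using w1 wt_swap [OF r, of "u @ [c]" z] by simp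
      have w4: "wt (u @ a # d # c # z) < wt w"
        using w2 wt_swap [OF r, of "u" "c # z"] by simp
      have "Phi (u @ c # d # a # z) g
          = contr k Phi d a (u @ [c]) z g - Phi ((u @ [c]) @ a # d # z) g"
        by (rule same) (use w w1 r in auto)
      moreover have "Phi (u @ c # a # d # z) g
          = contr k Phi c a u (d # z) g - Phi (u @ a # c # d # z) g"
        by (rule same) (use w w3 o bc in auto)
      moreover have "Phi (u @ d # a # c # z) g
          = contr k Phi d a u (c # z) g - Phi (u @ a # d # c # z) g"
        by (rule same) (use w w2 r in auto)
      moreover have "Phi (u @ a # d # c # z) g
          = contr k Phi d c (u @ [a]) z g - Phi ((u @ [a]) @ c # d # z) g"
        by (rule same) (use w w4 o in auto)
      moreover have "contr k Phi d c u (a # z) g - contr k Phi d c (u @ [a]) z g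
          + (contr k Phi c a u (d # z) g - contr k Phi c a (u @ [d]) z g)
          + (contr k Phi a d u (c # z) g - contr k Phi a d (u @ [c]) z g) = 0"
        by (rule contr_overlap [OF k_jac]) (use ne in auto)
      moreover have "contr k Phi a d u (c # z) g = contr k Phi d a u (c # z) g"
        "contr k Phi a d (u @ [c]) z g = contr k Phi d a (u @ [c]) z g"
        by (simp_all add: contr_def k_sym [of a d])
      ultimately have "contr k Phi d c u (a # z) g - Phi (u @ c # d # a # z) g
          - (contr k Phi c a (u @ [d]) z g - Phi (u @ d # a # c # z) g) = 0"
        by (simp only: append_assoc append.simps) (simp add: algebra_simps)
      then show ?thesis
        unfolding x v bc by simp
    next
      \<comment> \<open>The descents are disjoint, so swapping the other pair on each side leads to
        a common word.\<close>
      case (Cons c' y)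
      then have x: "x = y @ b # a # z" and v: "v = u @ d # c # y"
        using e2 t t2 d by auto
      have w: "w = u @ d # c # y @ b # a # z" using w x by simp
      have w1: "wt (u @ c # d # y @ b # a # z) < wt w"
        unfolding w using wt_swap [OF o(1), of u "y @ b # a # z"] by simp
      have w2: "wt (u @ d # c # y @ a # b # z) < wt w"
        unfolding w using wt_swap [OF o(2), of "u @ d # c # y" z] by simp
      have "Phi (u @ c # d # y @ b # a # z) g
          = contr k Phi b a (u @ c # d # y) z g - Phi ((u @ c # d # y) @ a # b # z) g"
        by (rule same) (use w w1 o in auto)
      moreover have "Phi (u @ d # c # y @ a # b # z) g
          = contr k Phi d c u (y @ a # b # z) g - Phi (u @ c # d # y @ a # b # z) g"
        by (rule same) (use w w2 o in auto)
      moreover have "contr k Phi d c u (y @ b # a # z) g + contr k Phi d c u (y @ a # b # z) g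
          = contr k Phi b a (u @ d # c # y) z g + contr k Phi b a (u @ c # d # y) z g"
        \<comment> \<open>A contraction removes two letters, so only relations on words shorter than
          \<open>w\<close> are used. Counted without the pair that is swapped, their lengths lie
          below \<open>length w - 2\<close>.\<close>
        by (rule contr_disjoint [OF k_inv, of "length w - 2"])
          (use lower o w in auto)
      ultimately have "contr k Phi d c u (y @ b # a # z) g - Phi (u @ c # d # y @ b # a # z) g
          = contr k Phi b a (u @ d # c # y) z g - Phi (u @ d # c # y @ a # b # z) g"
        unfolding append_assoc append.simps by (rule diff_eq_diff_shift)
      then show ?thesis
        unfolding x v by simp
    qed
  qed
  obtain u' j' i' z' where s: "(SOME d. descent w d) = (u', j', i', z')"
    by (metis prod_cases4)
  then have D': "descent w (u', j', i', z')"
    using 1(2) by (metis someI_ex)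
  have P: "Phi w g = contr k Phi j' i' u' z' g - Phi (u' @ i' # j' # z') g"
    using 1(2) s by (subst Phi.simps) (auto simp: contr_def)
  consider "length u' < length u" | "length u < length u'" | "length u' = length u"
    by linarith
  then show ?case
  proof cases
    case 1
    then show ?thesis using indep [OF D' \<open>descent w (u, j, i, z)\<close>] P by simp
  next
    case 2
    then show ?thesis using indep [OF \<open>descent w (u, j, i, z)\<close> D'] P by simp
  next
    case 3
    then show ?thesis using D' \<open>descent w (u, j, i, z)\<close> P by (auto simp: descent_def)
  qed
qed

lemma Phi_relation:
  assumes "i \<noteq> j"
  shows "Phi (u @ i # j # z) g + Phi (u @ j # i # z) g = contr k Phi i j u z g"
proof (cases "rk i < rk j")
  case True
  then have "Phi (u @ j # i # z) g = contr k Phi j i u z g - Phi (u @ i # j # z) g"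
    by (intro Phi_descent) (simp add: descent_def)
  then show ?thesis by (simp add: contr_def k_sym [of j i])
next
  case False
  then have "Phi (u @ i # j # z) g = contr k Phi i j u z g - Phi (u @ j # i # z) g"
    using assms inj_rk by (intro Phi_descent) (simp add: descent_def nat_less_le inj_eq)
  then show ?thesis by simp
qed

end

text \<open>Take \<open>base\<close> to be \<open>f\<close> in length \<open>d\<close> and zero in
  every other length. Below length \<open>d\<close> the recursion only meets zeros. In length
  \<open>d\<close> all contractions vanish, so sorting uses the homogeneous relations alone, and
  \<open>f\<close> obeys these. In greater length the recursion supplies the values.\<close>

lemma pbw_functional:
  fixes k :: "'n::finite \<Rightarrow> 'n \<Rightarrow> complex ^ 'n ^ 'n \<Rightarrow> complex"
  assumes "\<And>i j. k i j = k j i" "invariant k" "jacobi k"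
    and f: "\<And>u i j z g. i \<noteq> j \<Longrightarrow> f (u @ i # j # z) g + f (u @ j # i # z) g = (0 :: complex)"
  obtains F where
    "\<And>u i j z g. i \<noteq> j \<Longrightarrow> F (u @ i # j # z) g + F (u @ j # i # z) g = contr k F i j u z g"
    "\<And>w g. length w < d \<Longrightarrow> F w g = 0" "\<And>w g. length w = d \<Longrightarrow> F w g = f w g"
proof -
  obtain rk :: "'n \<Rightarrow> nat" where rk: "inj rk"
    using finite_imp_inj_to_nat_seg [of "UNIV :: 'n set"] by auto
  define base where "base w = (if length w = d then f w else (\<lambda>_. 0))" for w
  interpret pbw k rk base
    using assms rk by unfold_locales
  have *: "(length w < d \<longrightarrow> Phi w g = 0) \<and> (length w = d \<longrightarrow> Phi w g = f w g)" for w g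
  proof (induction w arbitrary: g rule: word_induct)
    case (sorted w)
    then show ?case unfolding Phi_sorted [OF sorted] by (simp add: base_def)
  next
    case (descent u j i z)
    have "i \<noteq> j" using descent(1) by auto
    have "contr k Phi j i u z g = 0" if "length (u @ j # i # z) \<le> d"
      unfolding contr_def using descent(3) that by (intro sum.neutral) simp
    moreover have "Phi (u @ j # i # z) g = contr k Phi j i u z g - Phi (u @ i # j # z) g"
      by (rule Phi_descent) (use descent in \<open>simp add: descent_def\<close>)
    moreover have "f (u @ j # i # z) g = - f (u @ i # j # z) g"
      using f [OF \<open>i \<noteq> j\<close>, of u z g] by (simp add: eq_neg_iff_add_eq_0 add.commute)
    ultimately show ?case
      using descent(2) [of g] by auto
  qed
  show ?thesis
    by (rule that [of Phi]) (use * Phi_relation in auto)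
qed

section \<open>The tensor algebra\<close>

abbreviation wd :: "'n list \<Rightarrow> complex \<Rightarrow> 'n tensor" where
  "wd w c \<equiv> Poly_Mapping.single (Word w) c"

lemma sum_fun_apply: "(\<Sum>i\<in>S. f i) x = (\<Sum>i\<in>S. f i x)"
  by (induction S rule: infinite_finite_induct) auto

lemma additive_sum:
  assumes "F 0 = 0" "\<And>x y. F (x + y) = F x + F y"
  shows "F (\<Sum>i\<in>S. f i) = (\<Sum>i\<in>S. F (f i))"
  by (induction S rule: infinite_finite_induct) (auto simp: assms)

lemma wd_mult: "wd u a * wd v b = wd (u @ v) (a * b)"
  by (simp add: mult_single plus_fmon_def)

lemma one_wd: "1 = wd [] 1"
  by (simp flip: single_one zero_fmon_def)

lemma tensor_sum_wd:
  "x = (\<Sum>w\<in>Poly_Mapping.keys x. wd (letters w) (Poly_Mapping.lookup x w))"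
  by (rule poly_mapping_eqI) (auto simp: lookup_sum lookup_single when_def in_keys_iff)

lemma tensor_induct [case_names wd add]:
  assumes "\<And>w c. P (wd w c)" "\<And>x y. P x \<Longrightarrow> P y \<Longrightarrow> P (x + y)"
  shows "P x"
proof -
  have 0: "P 0" using assms(1) [of _ 0] by simp
  have 1: "P (Poly_Mapping.single k c)" for k c using assms(1) [of "letters k" c] by simp
  have "P (\<Sum>w\<in>S. wd (letters w) (f w))" if "finite S" for S f
    using that by induction (auto simp: 0 1 intro: assms(2))
  then show ?thesis by (subst tensor_sum_wd) auto
qed

lemma cscale_single [simp]: "cscale c (Poly_Mapping.single w a) = Poly_Mapping.single w (c * a)"
  by (rule poly_mapping_eqI) (simp add: lookup_single when_def)

lemma cscale_simps [simp]:
  "cscale c (x + y) = cscale c x + cscale c y" "cscale c 0 = 0" "cscale 0 x = 0"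
  "cscale 1 x = x" "cscale c (x - y) = cscale c x - cscale c y"
  "cscale c (cscale d x) = cscale (c * d) x" "cscale (- 1) x = - x"
  by (auto intro!: poly_mapping_eqI simp: lookup_add lookup_minus algebra_simps)

lemma cscale_sum: "cscale c (\<Sum>i\<in>S. f i) = (\<Sum>i\<in>S. cscale c (f i))"
  by (induction S rule: infinite_finite_induct) auto

lemma cscale_add_left: "cscale (c + d) x = cscale c x + cscale d x"
  by (rule poly_mapping_eqI) (simp add: lookup_add algebra_simps)

lemma cscale_mult_left: "cscale c x * y = cscale c (x * y)"
  unfolding cscale_def mult_map_scale_conv_mult by (simp add: mult.assoc)

lemma cscale_mult_right:
  fixes x y :: "'n tensor"
  shows "x * cscale c y = cscale c (x * y)"
proof (induction x rule: tensor_induct)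
  case (wd w a)
  show ?case
    by (induction y rule: tensor_induct) (simp_all add: wd_mult distrib_left mult.left_commute)
qed (simp add: distrib_right)

subsection \<open>Grading\<close>

definition tcomp :: "nat \<Rightarrow> 'n tensor \<Rightarrow> 'n tensor" where
  "tcomp d x = (\<Sum>w\<in>{w \<in> Poly_Mapping.keys x. length (letters w) = d}.
     wd (letters w) (Poly_Mapping.lookup x w))"

lemma lookup_tcomp:
  "Poly_Mapping.lookup (tcomp d x) w = (if length (letters w) = d then Poly_Mapping.lookup x w else 0)"
  by (auto simp: tcomp_def lookup_sum lookup_single when_def in_keys_iff)

lemma tcomp_simps [simp]:
  "tcomp d (x + y) = tcomp d x + tcomp d y" "tcomp d 0 = 0"
  "tcomp d (x - y) = tcomp d x - tcomp d y" "tcomp d (- x) = - tcomp d x"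
  "tcomp d (cscale c x) = cscale c (tcomp d x)"
  "tcomp d (wd w c) = (if length w = d then wd w c else 0)"
  "tcomp d (tcomp e x) = (if d = e then tcomp d x else 0)"
  by (auto intro!: poly_mapping_eqI simp: lookup_tcomp lookup_add lookup_minus lookup_single when_def)

lemma tcomp_sum: "tcomp d (\<Sum>i\<in>S. f i) = (\<Sum>i\<in>S. tcomp d (f i))"
  by (induction S rule: infinite_finite_induct) auto

lemma tcomp_mult: "tcomp d (x * y) = (\<Sum>i\<le>d. tcomp i x * tcomp (d - i) y)"
proof (induction x rule: tensor_induct)
  case (wd u a)
  show ?case
  proof (induction y rule: tensor_induct)
    case (wd v b)
    have "(\<Sum>i\<le>d. tcomp i (wd u a) * tcomp (d - i) (wd v b))
      = (\<Sum>i\<le>d. if length u = i then if length u + length v = d then wd (u @ v) (a * b) else 0 else 0)"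
      by (rule sum.cong) (auto simp: wd_mult)
    then show ?case by (auto simp: wd_mult)
  qed (simp add: distrib_left sum.distrib)
qed (simp add: distrib_right sum.distrib)

text \<open>The bound is strict: \<open>tlow d\<close> is filtration step \<open>d - 1\<close>, and
  it is zero for \<open>d = 0\<close>. This fits the convention that the step before the first one
  is zero, without a case distinction.\<close>

definition tlow :: "nat \<Rightarrow> 'n tensor set" where
  "tlow d = {x. \<forall>e\<ge>d. tcomp e x = 0}"

lemma tcomp_eq_0_iff:
  "tcomp d x = 0 \<longleftrightarrow> (\<forall>w\<in>Poly_Mapping.keys x. length (letters w) \<noteq> d)"
  by (auto simp: poly_mapping_eq_iff fun_eq_iff lookup_tcomp in_keys_iff)

lemma tensor_filt_eq: "tensor_filt d = tlow (Suc d)"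
  unfolding tensor_filt_def tlow_def tcomp_eq_0_iff by (auto simp: not_less_eq_eq [symmetric])

lemma tensor_deg_eq: "x \<in> tensor_deg d \<longleftrightarrow> tcomp d x = x"
  by (auto simp: tensor_deg_def poly_mapping_eq_iff fun_eq_iff lookup_tcomp in_keys_iff)

lemma tlow_ex: "\<exists>d. x \<in> tlow d"
proof -
  have "x \<in> tlow (Suc (Max (insert 0 ((length \<circ> letters) ` Poly_Mapping.keys x))))"
    unfolding tlow_def tcomp_eq_0_iff
    by (auto simp: Suc_le_eq)
  then show ?thesis ..
qed

lemma tlow_mono: "x \<in> tlow d \<Longrightarrow> d \<le> e \<Longrightarrow> x \<in> tlow e"
  by (auto simp: tlow_def)

lemma tlow_sum_tcomp: "x \<in> tlow d \<Longrightarrow> (\<Sum>e<d. tcomp e x) = x"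
  by (rule poly_mapping_eqI)
    (auto simp: lookup_sum lookup_tcomp tlow_def tcomp_eq_0_iff not_less simp flip: not_in_keys_iff_lookup_eq_zero)

subsection \<open>The action of signed permutations\<close>

lemma tensor_act_add: "tensor_act g (x + y) = tensor_act g x + tensor_act g y"
  unfolding tensor_act_def by (rule setsum_keys_plus_distrib) (auto simp: cscale_add_left)

lemma tensor_act_zero [simp]: "tensor_act g 0 = 0"
  by (simp add: tensor_act_def)

lemma tensor_act_sum: "tensor_act g (\<Sum>i\<in>S. f i) = (\<Sum>i\<in>S. tensor_act g (f i))"
  by (induction S rule: infinite_finite_induct) (auto simp: tensor_act_add)

lemma vec_tensor_bas: "vec_tensor (bas i) = wd [i] 1"
proof -
  have "vec_tensor (bas i) = (\<Sum>j\<in>UNIV. if j = i then wd [j] 1 else 0)"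
    unfolding vec_tensor_def by (rule sum.cong) (auto simp: axis_def)
  then show ?thesis by simp
qed

lemma GG_bas: "g \<in> GG \<Longrightarrow> g *v bas i = msign g i *s bas (mperm g i)"
  by (auto simp: matrix_vector_mult_def vec_eq_iff GG_nth axis_def
      if_distrib [of "\<lambda>x. _ * x"] cong: if_cong)

lemma vec_tensor_scale: "vec_tensor (c *s v) = cscale c (vec_tensor v)"
  unfolding vec_tensor_def by (simp add: cscale_sum)

lemma vec_tensor_act: "g \<in> GG \<Longrightarrow> vec_tensor (g *v bas i) = wd [mperm g i] (msign g i)"
  by (simp add: GG_bas vec_tensor_scale vec_tensor_bas)

lemma tensor_act_wd:
  assumes g: "g \<in> GG"
  shows "tensor_act g (wd w c) = wd (map (mperm g) w) (c * msigns g w)"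
proof -
  have "prod_list (map (\<lambda>i. vec_tensor (g *v bas i)) w) = wd (map (mperm g) w) (msigns g w)"
    by (induction w) (simp_all add: g one_wd vec_tensor_act wd_mult)
  then show ?thesis
    by (cases "c = 0") (simp_all add: tensor_act_def)
qed

lemma
  assumes g: "g \<in> GG"
  shows tensor_act_mult: "tensor_act g (x * y) = tensor_act g x * tensor_act g y"
    and tensor_act_cscale: "tensor_act g (cscale c x) = cscale c (tensor_act g x)"
    and tcomp_tensor_act: "tcomp d (tensor_act g x) = tensor_act g (tcomp d x)"
    and tensor_act_one [simp]: "tensor_act g 1 = 1"
proof -
  show "tensor_act g (x * y) = tensor_act g x * tensor_act g y"
  proof (induction x rule: tensor_induct)
    case (wd u a)
    show ?case
      by (induction y rule: tensor_induct)
        (simp_all add: wd_mult distrib_left tensor_act_add tensor_act_wd g mult_ac)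
  qed (simp add: distrib_right tensor_act_add)
  show "tensor_act g (cscale c x) = cscale c (tensor_act g x)"
    by (induction x rule: tensor_induct) (simp_all add: tensor_act_add tensor_act_wd g mult_ac)
  show "tcomp d (tensor_act g x) = tensor_act g (tcomp d x)"
    by (induction x rule: tensor_induct) (simp_all add: tensor_act_add tensor_act_wd g)
  show "tensor_act g 1 = 1"
    by (simp add: one_wd tensor_act_wd g)
qed

lemma tensor_act_comp:
  "g \<in> GG \<Longrightarrow> h \<in> GG \<Longrightarrow> tensor_act (g ** h) x = tensor_act g (tensor_act h x)"
  by (induction x rule: tensor_induct)
    (simp_all add: tensor_act_add tensor_act_wd mperm_mult msigns_mult mult.assoc mult.commute)

lemma tensor_act_id [simp]: "tensor_act (mat 1) x = x"
proof (induction x rule: tensor_induct)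
  case (wd w c)
  have "msigns (mat 1 :: complex ^ 'a ^ 'a) w = 1" by (induction w) auto
  then show ?case by (simp add: tensor_act_wd)
qed (simp add: tensor_act_add)

lemma tensor_alg_simps [simp]:
  "carrier tensor_alg = UNIV" "x \<otimes>\<^bsub>tensor_alg\<^esub> y = x * y" "\<one>\<^bsub>tensor_alg\<^esub> = 1"
  "x \<oplus>\<^bsub>tensor_alg\<^esub> y = x + y" "\<zero>\<^bsub>tensor_alg\<^esub> = 0" "c \<odot>\<^bsub>tensor_alg\<^esub> x = cscale c x"
  by (simp_all add: tensor_alg_def)

lemma ring_tensor_alg: "ring (tensor_alg :: (complex, 'n tensor) module)"
proof (rule ringI)
  show "abelian_group (tensor_alg :: (complex, 'n tensor) module)"
  proof (rule abelian_groupI; simp?)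
    fix x :: "'n tensor"
    show "\<exists>y. y + x = 0" by (rule exI [of _ "- x"]) simp
  qed
  show "Group.monoid (tensor_alg :: (complex, 'n tensor) module)"
    by (rule monoidI) (simp_all add: mult.assoc)
qed (simp_all add: algebra_simps)

lemma finsum_tensor_alg:
  fixes f :: "'i \<Rightarrow> 'n tensor"
  shows "finite S \<Longrightarrow> finsum tensor_alg f S = sum f S"
proof -
  interpret ring "tensor_alg :: (complex, 'n tensor) module" by (rule ring_tensor_alg)
  show "finite S \<Longrightarrow> finsum tensor_alg f S = sum f S"
    by (induction S rule: finite_induct) auto
qed

section \<open>The skew group algebra \<open>T(V) \<rtimes> G\<close>\<close>

type_synonym 'n skew = "complex ^ 'n ^ 'n \<Rightarrow> 'n tensor"

abbreviation AA :: "'n::finite skew set" where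
  "AA \<equiv> carrier tensor_skew"

text \<open>The product of \<open>tensor_skew\<close>, summed over all of G instead of the support
  of \<open>a\<close>. The extra terms are zero, and bilinearity becomes immediate.\<close>

definition smul :: "'n::finite skew \<Rightarrow> 'n skew \<Rightarrow> 'n skew" (infixl "\<star>" 70) where
  "a \<star> b = (\<lambda>k. if k \<in> GG then \<Sum>g\<in>GG. a g * tensor_act g (b (ginv g ** k)) else 0)"

definition gmon :: "'n tensor \<Rightarrow> complex ^ 'n ^ 'n \<Rightarrow> 'n skew" where
  "gmon x g = (\<lambda>k. if k = g then x else 0)"

definition fscale :: "complex \<Rightarrow> 'n skew \<Rightarrow> 'n skew" where
  "fscale c a = (\<lambda>g. cscale c (a g))"

lemma AA_iff: "a \<in> AA \<longleftrightarrow> (\<forall>g. g \<notin> GG \<longrightarrow> a g = 0)"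
proof -
  have "finite {g. a g \<noteq> 0}" if "\<forall>g. g \<notin> GG \<longrightarrow> a g = 0"
    by (rule finite_subset [OF _ finite_GG]) (use that in auto)
  then show ?thesis
    by (auto simp: tensor_skew_def skew_group_alg_def)
qed

lemma AA_closed [simp, intro]:
  "0 \<in> AA" "a \<star> b \<in> AA" "a \<in> AA \<Longrightarrow> b \<in> AA \<Longrightarrow> a + b \<in> AA"
  "a \<in> AA \<Longrightarrow> b \<in> AA \<Longrightarrow> a - b \<in> AA" "a \<in> AA \<Longrightarrow> - a \<in> AA" "a \<in> AA \<Longrightarrow> fscale c a \<in> AA"
  "g \<in> GG \<Longrightarrow> gmon x g \<in> AA"
  by (auto simp: AA_iff smul_def fscale_def gmon_def)

lemma AA_sum [simp, intro]: "(\<And>i. i \<in> S \<Longrightarrow> f i \<in> AA) \<Longrightarrow> (\<Sum>i\<in>S. f i) \<in> AA"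
  by (induction S rule: infinite_finite_induct) auto

lemma tensor_skew_simps [simp]:
  "a \<otimes>\<^bsub>tensor_skew\<^esub> b = a \<star> b" "\<one>\<^bsub>tensor_skew\<^esub> = gmon 1 (mat 1)"
  "a \<oplus>\<^bsub>tensor_skew\<^esub> b = a + b" "\<zero>\<^bsub>tensor_skew\<^esub> = 0" "c \<odot>\<^bsub>tensor_skew\<^esub> a = fscale c a"
proof -
  have "(\<Sum>g | g \<in> GG \<and> a g \<noteq> 0. a g * tensor_act g (b (ginv g ** k)))
      = (\<Sum>g\<in>GG. a g * tensor_act g (b (ginv g ** k)))" for k
    by (rule sum.mono_neutral_left) auto
  then show "a \<otimes>\<^bsub>tensor_skew\<^esub> b = a \<star> b"
    by (auto simp: tensor_skew_def skew_group_alg_def smul_def finsum_tensor_alg fun_eq_iff)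
qed (auto simp: tensor_skew_def skew_group_alg_def gmon_def fscale_def fun_eq_iff)

lemma smul_add:
  "(a + b) \<star> c = a \<star> c + b \<star> c" "a \<star> (b + c) = a \<star> b + a \<star> c"
  by (auto simp: smul_def fun_eq_iff distrib_left distrib_right sum.distrib tensor_act_add)

lemma smul_zero [simp]: "0 \<star> c = 0" "a \<star> 0 = 0"
  by (auto simp: smul_def fun_eq_iff)

lemma smul_diff:
  "(a - b) \<star> c = a \<star> c - b \<star> c" "a \<star> (b - c) = a \<star> b - a \<star> c"
proof -
  show "(a - b) \<star> c = a \<star> c - b \<star> c"
    using smul_add(1) [of "a - b" b c] by (simp add: eq_diff_eq)
  show "a \<star> (b - c) = a \<star> b - a \<star> c"
    using smul_add(2) [of a "b - c" c] by (simp add: eq_diff_eq)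
qed

lemma smul_sum:
  "(\<Sum>i\<in>S. f i) \<star> c = (\<Sum>i\<in>S. f i \<star> c)" "a \<star> (\<Sum>i\<in>S. f i) = (\<Sum>i\<in>S. a \<star> f i)"
  by (rule additive_sum [of "\<lambda>x. x \<star> c"]; simp add: smul_add)
    (rule additive_sum [of "\<lambda>x. a \<star> x"]; simp add: smul_add)

lemma smul_fscale: "fscale r a \<star> b = fscale r (a \<star> b)" "a \<star> fscale r b = fscale r (a \<star> b)"
  by (auto simp: smul_def fun_eq_iff fscale_def cscale_sum cscale_mult_left cscale_mult_right
      tensor_act_cscale)

lemma smul_assoc: "(a \<star> b) \<star> c = a \<star> (b \<star> c)"
proof
  fix m :: "complex ^ 'a ^ 'a"
  show "((a \<star> b) \<star> c) m = (a \<star> (b \<star> c)) m"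
  proof (cases "m \<in> GG")
    case m: True
    have "((a \<star> b) \<star> c) m
       = (\<Sum>k\<in>GG. \<Sum>g\<in>GG. a g * tensor_act g (b (ginv g ** k)) * tensor_act k (c (ginv k ** m)))"
      using m by (simp add: smul_def sum_distrib_right)
    also have "\<dots> = (\<Sum>g\<in>GG. \<Sum>k\<in>GG. a g * tensor_act g (b (ginv g ** k)) * tensor_act k (c (ginv k ** m)))"
      by (rule sum.swap)
    also have "\<dots> = (\<Sum>g\<in>GG. a g * tensor_act g ((b \<star> c) (ginv g ** m)))"
    proof (rule sum.cong [OF refl])
      fix g :: "complex ^ 'a ^ 'a" assume g: "g \<in> GG"
      \<comment> \<open>Substitute \<open>k = g h\<close>, so that the action of \<open>k\<close>
        splits into that of \<open>h\<close> followed by that of \<open>g\<close>.\<close>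
      have "(\<Sum>k\<in>GG. a g * tensor_act g (b (ginv g ** k)) * tensor_act k (c (ginv k ** m)))
          = (\<Sum>h\<in>GG. a g * tensor_act g (b (ginv g ** (g ** h)))
              * tensor_act (g ** h) (c (ginv (g ** h) ** m)))"
        by (rule sum_GG_left_mult [OF g, symmetric])
      also have "\<dots> = a g * tensor_act g (\<Sum>h\<in>GG. b h * tensor_act h (c (ginv h ** (ginv g ** m))))"
        unfolding tensor_act_sum sum_distrib_left
      proof (rule sum.cong [OF refl])
        fix h :: "complex ^ 'a ^ 'a" assume h: "h \<in> GG"
        have "ginv (g ** h) = ginv h ** ginv g"
          using G21.inv_mult_group [OF g h] by simp
        then show "a g * tensor_act g (b (ginv g ** (g ** h))) * tensor_act (g ** h) (c (ginv (g ** h) ** m))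
            = a g * tensor_act g (b h * tensor_act h (c (ginv h ** (ginv g ** m))))"
          unfolding ginv_cancel(1) [OF g]
          using g h by (simp add: tensor_act_mult tensor_act_comp mult.assoc matrix_mul_assoc)
      qed
      also have "(\<Sum>h\<in>GG. b h * tensor_act h (c (ginv h ** (ginv g ** m)))) = (b \<star> c) (ginv g ** m)"
        using g m ginv_facts by (simp add: smul_def)
      finally show "(\<Sum>k\<in>GG. a g * tensor_act g (b (ginv g ** k)) * tensor_act k (c (ginv k ** m)))
          = a g * tensor_act g ((b \<star> c) (ginv g ** m))" .
    qed
    also have "\<dots> = (a \<star> (b \<star> c)) m"
      using m by (simp add: smul_def)
    finally show ?thesis .
  qed (simp add: smul_def)
qed

lemma smul_gmon_left:
  assumes "g \<in> GG"
  shows "gmon x g \<star> b = (\<lambda>k. if k \<in> GG then x * tensor_act g (b (ginv g ** k)) else 0)"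
proof -
  have "(\<Sum>h\<in>GG. gmon x g h * tensor_act h (b (ginv h ** k)))
      = (\<Sum>h\<in>GG. if h = g then x * tensor_act g (b (ginv g ** k)) else 0)" for k
    by (rule sum.cong) (auto simp: gmon_def)
  then show ?thesis using assms by (auto simp: smul_def fun_eq_iff)
qed

lemma gmon_mult:
  assumes g: "g \<in> GG" and h: "h \<in> GG"
  shows "gmon x g \<star> gmon y h = gmon (x * tensor_act g y) (g ** h)"
proof
  fix k :: "complex ^ 'a ^ 'a"
  have "ginv g ** k = h \<longleftrightarrow> k = g ** h"
    using ginv_cancel [OF g] by metis
  then show "(gmon x g \<star> gmon y h) k = gmon (x * tensor_act g y) (g ** h) k"
    unfolding smul_gmon_left [OF g] using g h by (auto simp: gmon_def)
qed

lemma gmon_simps [simp]: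
  "gmon (x + y) g = gmon x g + gmon y g" "gmon (x - y) g = gmon x g - gmon y g"
  "gmon 0 g = 0" "gmon (- x) g = - gmon x g" "fscale c (gmon x g) = gmon (cscale c x) g"
  by (auto simp: gmon_def fun_eq_iff fscale_def)

lemma gmon_sum: "gmon (\<Sum>i\<in>S. f i) g = (\<Sum>i\<in>S. gmon (f i) g)"
  by (rule additive_sum [of "\<lambda>x. gmon x g"]) simp_all

lemma AA_sum_gmon: "a \<in> AA \<Longrightarrow> a = (\<Sum>g\<in>GG. gmon (a g) g)"
  by (auto simp: fun_eq_iff sum_fun_apply gmon_def AA_iff if_distrib cong: if_cong)

lemma AA_induct [consumes 1, case_names gmon add]:
  assumes "a \<in> (AA :: 'n::finite skew set)" and "\<And>x g. g \<in> GG \<Longrightarrow> P (gmon x g)"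
    and "\<And>a b. a \<in> AA \<Longrightarrow> b \<in> AA \<Longrightarrow> P a \<Longrightarrow> P b \<Longrightarrow> P (a + b)"
  shows "P a"
proof -
  have 0: "P 0" using assms(2) [of "mat 1" 0] by simp
  have "P (\<Sum>g\<in>S. gmon (f g) g)" if "finite S" "S \<subseteq> GG" for S f
    using that by (induction S rule: finite_induct) (auto simp: 0 intro!: assms(2,3))
  then show ?thesis
    by (subst AA_sum_gmon [OF assms(1)]) auto
qed

lemma smul_one:
  assumes "a \<in> AA"
  shows "gmon 1 (mat 1) \<star> a = a" "a \<star> gmon 1 (mat 1) = a"
  using assms
proof (induction a rule: AA_induct)
  case (add a b)
  {
    case 1
    show ?case using add by (simp only: smul_add)
  next
    case 2
    show ?case using add by (simp only: smul_add)
  }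
qed (simp_all add: gmon_mult)

lemma ring_tensor_skew: "ring (tensor_skew :: (complex, 'n::finite skew) module)"
proof (rule ringI)
  show "abelian_group (tensor_skew :: (complex, 'n skew) module)"
  proof (rule abelian_groupI; simp?)
    fix x :: "'n skew" assume "x \<in> AA"
    then show "\<exists>y\<in>AA. y + x = 0" by (intro bexI [of _ "- x"]) auto
  qed
  show "Group.monoid (tensor_skew :: (complex, 'n skew) module)"
    by (rule monoidI) (simp_all add: smul_assoc smul_one)
qed (simp_all add: smul_add)

section \<open>The grading and the filtration of T(V) \<rtimes> G\<close>

definition scomp :: "nat \<Rightarrow> 'n skew \<Rightarrow> 'n skew" where
  "scomp d a = (\<lambda>g. tcomp d (a g))"

lemma scomp_simps [simp]:
  "scomp d (a + b) = scomp d a + scomp d b" "scomp d 0 = 0"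
  "scomp d (a - b) = scomp d a - scomp d b" "scomp d (- a) = - scomp d a"
  "scomp d (fscale c a) = fscale c (scomp d a)"
  "scomp d (gmon x g) = gmon (tcomp d x) g"
  "scomp d (scomp e a) = (if d = e then scomp d a else 0)"
  by (auto simp: scomp_def fun_eq_iff gmon_def fscale_def)

lemma scomp_AA [simp, intro]: "a \<in> AA \<Longrightarrow> scomp d a \<in> AA"
  by (auto simp: AA_iff scomp_def)

lemma scomp_sum: "scomp d (\<Sum>i\<in>S. f i) = (\<Sum>i\<in>S. scomp d (f i))"
  by (rule additive_sum [of "scomp d"]) simp_all

text \<open>G preserves degrees, so the skew product is graded in the same way as the product of
  T(V).\<close>

lemma scomp_mult: "scomp d (a \<star> b) = (\<Sum>i\<le>d. scomp i a \<star> scomp (d - i) b)"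
proof
  fix k :: "complex ^ 'a ^ 'a"
  show "scomp d (a \<star> b) k = (\<Sum>i\<le>d. scomp i a \<star> scomp (d - i) b) k"
  proof (cases "k \<in> GG")
    case True
    have "scomp d (a \<star> b) k
        = (\<Sum>g\<in>GG. \<Sum>i\<le>d. scomp i a g * tensor_act g (scomp (d - i) b (ginv g ** k)))"
      using True by (simp add: smul_def scomp_def tcomp_sum tcomp_mult tcomp_tensor_act)
    also have "\<dots> = (\<Sum>i\<le>d. \<Sum>g\<in>GG. scomp i a g * tensor_act g (scomp (d - i) b (ginv g ** k)))"
      by (rule sum.swap)
    finally show ?thesis
      using True by (simp add: smul_def sum_fun_apply)
  qed (simp add: smul_def scomp_def sum_fun_apply)
qed

text \<open>As for \<open>tlow\<close>, the bound is strict. Hence the shift in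
  \<open>slow_mult\<close>: degrees of at most \<open>i - 1\<close> and \<open>j - 1\<close> add up
  to less than \<open>i + j - 1\<close>.\<close>

definition slow :: "nat \<Rightarrow> 'n::finite skew set" where
  "slow d = {a \<in> AA. \<forall>e\<ge>d. scomp e a = 0}"

lemma slow_AA: "a \<in> slow d \<Longrightarrow> a \<in> AA"
  by (simp add: slow_def)

lemma slow_0 [simp]: "slow 0 = {0 :: 'n::finite skew}"
proof -
  have "a = 0" if "\<And>e. scomp e a = 0" for a :: "'n skew"
  proof
    fix g
    obtain d where "a g \<in> tlow d" using tlow_ex by blast
    then have "a g = (\<Sum>e<d. tcomp e (a g))" by (simp add: tlow_sum_tcomp)
    also have "\<dots> = 0" using that by (simp add: scomp_def fun_eq_iff)
    finally show "a g = 0 g" by simp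
  qed
  then have "slow 0 \<subseteq> {0 :: 'n skew}"
    by (intro subsetI, unfold slow_def) blast
  moreover have "0 \<in> (slow 0 :: 'n skew set)"
    by (simp add: slow_def)
  ultimately show ?thesis by blast
qed

lemma slow_filt: "tensor_skew_filt d = slow (Suc d)"
  by (auto simp: tensor_skew_filt_def slow_def tensor_filt_eq tlow_def scomp_def fun_eq_iff)

lemma slow_closed [simp, intro]:
  "0 \<in> slow d" "a \<in> slow d \<Longrightarrow> b \<in> slow d \<Longrightarrow> a + b \<in> slow d"
  "a \<in> slow d \<Longrightarrow> b \<in> slow d \<Longrightarrow> a - b \<in> slow d"
  "a \<in> slow d \<Longrightarrow> - a \<in> slow d"
  "a \<in> slow d \<Longrightarrow> fscale c a \<in> slow d"
proof -
  have "fscale c 0 = 0" by (simp add: fscale_def fun_eq_iff)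
  then show "a \<in> slow d \<Longrightarrow> fscale c a \<in> slow d" by (auto simp: slow_def)
qed (auto simp: slow_def)

lemma slow_mono: "a \<in> slow d \<Longrightarrow> d \<le> e \<Longrightarrow> a \<in> slow e"
  by (auto simp: slow_def)

lemma scomp_slow [intro]: "a \<in> AA \<Longrightarrow> d < e \<Longrightarrow> scomp d a \<in> slow e"
  by (auto simp: slow_def)

lemma slow_mult:
  assumes "a \<in> slow i" "b \<in> slow j"
  shows "a \<star> b \<in> slow (i + j - 1)"
proof -
  have "scomp e (a \<star> b) = 0" if "e \<ge> i + j - 1" for e
    unfolding scomp_mult
  proof (rule sum.neutral, rule ballI)
    fix l assume "l \<in> {..e}"
    then have "l \<ge> i \<or> e - l \<ge> j" using that by auto
    then show "scomp l a \<star> scomp (e - l) b = 0"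
      using assms by (auto simp: slow_def)
  qed
  then show ?thesis by (simp add: slow_def)
qed

lemma slow_ex:
  assumes "a \<in> AA"
  obtains d where "a \<in> slow d"
proof -
  have "\<exists>d. \<forall>g. a g \<in> tlow (d g)"
    by (intro choice allI tlow_ex)
  then obtain d where d: "\<And>g. a g \<in> tlow (d g)" by blast
  have "a g \<in> tlow (\<Sum>g\<in>GG. d g)" for g
  proof (cases "g \<in> GG")
    case True
    then show ?thesis
      by (intro tlow_mono [OF d]) (auto intro: member_le_sum)
  qed (use assms in \<open>auto simp: AA_iff tlow_def\<close>)
  then show ?thesis
    using assms by (intro that [of "\<Sum>g\<in>GG. d g"]) (auto simp: slow_def tlow_def scomp_def fun_eq_iff)
qed

lemma slow_sum_scomp: "a \<in> slow d \<Longrightarrow> (\<Sum>e<d. scomp e a) = a"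
  by (auto simp: fun_eq_iff sum_fun_apply scomp_def slow_def intro!: tlow_sum_tcomp simp: tlow_def)

section \<open>Quotients by two-sided ideals\<close>

text \<open>Ties the operations of the record to those of the type class, so that membership in a
  coset becomes \<open>y - x \<in> I\<close>. Closure under scalars is not part of being a ring
  ideal; it makes the scalar multiplication of cosets well defined.\<close>

locale alg_ideal = ideal I R for I :: "'a :: ab_group_add set" and R :: "(complex, 'a) module" (structure) +
  assumes R_add: "x \<oplus>\<^bsub>R\<^esub> y = x + y" and R_zero: "\<zero>\<^bsub>R\<^esub> = 0"
    and smult_diff: "x \<in> carrier R \<Longrightarrow> y \<in> carrier R \<Longrightarrow> c \<odot>\<^bsub>R\<^esub> (x - y) = c \<odot>\<^bsub>R\<^esub> x - c \<odot>\<^bsub>R\<^esub> y"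
    and smult_I: "x \<in> I \<Longrightarrow> c \<odot>\<^bsub>R\<^esub> x \<in> I"
begin

abbreviation Q :: "(complex, 'a set) module" where "Q \<equiv> quot_alg R I"

abbreviation cs :: "'a \<Rightarrow> 'a set" where "cs x \<equiv> I +>\<^bsub>R\<^esub> x"

lemma I_sub: "x \<in> I \<Longrightarrow> x \<in> carrier R"
  using a_subset by blast

lemma minus_eq_uminus: "x \<in> carrier R \<Longrightarrow> \<ominus>\<^bsub>R\<^esub> x = - x"
proof -
  assume x: "x \<in> carrier R"
  have "x + \<ominus>\<^bsub>R\<^esub> x = 0"
    using r_neg [OF x] by (simp add: R_add R_zero)
  then show ?thesis by (simp add: eq_neg_iff_add_eq_0 add.commute)
qed

lemma carrier_closed:
  "0 \<in> carrier R" "x \<in> carrier R \<Longrightarrow> y \<in> carrier R \<Longrightarrow> x + y \<in> carrier R"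
  "x \<in> carrier R \<Longrightarrow> - x \<in> carrier R" "x \<in> carrier R \<Longrightarrow> y \<in> carrier R \<Longrightarrow> x - y \<in> carrier R"
proof -
  show "0 \<in> carrier R" using zero_closed by (simp add: R_zero)
  show *: "x + y \<in> carrier R" if "x \<in> carrier R" "y \<in> carrier R" for x y
    using a_closed [OF that] by (simp add: R_add)
  show m: "- x \<in> carrier R" if "x \<in> carrier R" for x
    using a_inv_closed [OF that] minus_eq_uminus [OF that] by simp
  show "x - y \<in> carrier R" if "x \<in> carrier R" "y \<in> carrier R"
    using * [OF that(1) m [OF that(2)]] by simp
qed

lemma I_closed:
  "0 \<in> I" "x \<in> I \<Longrightarrow> y \<in> I \<Longrightarrow> x + y \<in> I" "x \<in> I \<Longrightarrow> - x \<in> I" "x \<in> I \<Longrightarrow> y \<in> I \<Longrightarrow> x - y \<in> I"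
proof -
  show "0 \<in> I" using additive_subgroup.zero_closed [OF additive_subgroup_axioms] by (simp add: R_zero)
  show *: "x + y \<in> I" if "x \<in> I" "y \<in> I" for x y
    using additive_subgroup.a_closed [OF additive_subgroup_axioms that] by (simp add: R_add)
  show m: "- x \<in> I" if "x \<in> I" for x
    using additive_subgroup.a_inv_closed [OF additive_subgroup_axioms that] minus_eq_uminus [OF I_sub [OF that]]
    by simp
  show "x - y \<in> I" if "x \<in> I" "y \<in> I"
    using * [OF that(1) m [OF that(2)]] by simp
qed

lemma I_sum: "(\<And>i. i \<in> S \<Longrightarrow> f i \<in> I) \<Longrightarrow> (\<Sum>i\<in>S. f i) \<in> I"
  by (induction S rule: infinite_finite_induct) (auto intro: I_closed)

lemma cs_def: "cs x = {i + x | i. i \<in> I}"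
  by (auto simp: a_r_coset_def' R_add)

lemma cs_mem: "y \<in> cs x \<longleftrightarrow> y - x \<in> I"
  unfolding cs_def by (auto intro: exI [of _ "y - x"])

lemma cs_eq: "cs x = cs y \<longleftrightarrow> x - y \<in> I"
proof
  assume "cs x = cs y"
  then have "x \<in> cs y" using cs_mem [of x x] I_closed(1) by simp
  then show "x - y \<in> I" by (simp add: cs_mem)
next
  assume xy: "x - y \<in> I"
  have "z - x \<in> I \<longleftrightarrow> z - y \<in> I" for z
    using I_closed(2) [OF _ xy, of "z - x"] I_closed(4) [OF _ xy, of "z - y"] by auto
  then show "cs x = cs y" by (auto simp: cs_mem)
qed

lemma cs_zero: "cs 0 = I"
  by (auto simp: cs_def)

lemma Q_sel:
  "carrier Q = cs ` carrier R" "\<zero>\<^bsub>Q\<^esub> = I" "\<one>\<^bsub>Q\<^esub> = cs \<one>\<^bsub>R\<^esub>"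
  "X \<otimes>\<^bsub>Q\<^esub> Y = rcoset_mult R I X Y" "X \<oplus>\<^bsub>Q\<^esub> Y = set_add R X Y"
  "c \<odot>\<^bsub>Q\<^esub> X = (\<Union>x\<in>X. cs (c \<odot>\<^bsub>R\<^esub> x))"
  by (auto simp: quot_alg_def FactRing_def ring.defs module.defs A_RCOSETS_def' A_RCOSETS_defs a_r_coset_def)

lemma Q_ops:
  assumes "x \<in> carrier R" "y \<in> carrier R"
  shows "cs x \<otimes>\<^bsub>Q\<^esub> cs y = cs (x \<otimes>\<^bsub>R\<^esub> y)" "cs x \<oplus>\<^bsub>Q\<^esub> cs y = cs (x + y)"
    "c \<odot>\<^bsub>Q\<^esub> cs x = cs (c \<odot>\<^bsub>R\<^esub> x)"
proof -
  show "cs x \<otimes>\<^bsub>Q\<^esub> cs y = cs (x \<otimes>\<^bsub>R\<^esub> y)" "cs x \<oplus>\<^bsub>Q\<^esub> cs y = cs (x + y)"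
    using rcoset_mult_add [OF assms] a_rcos_sum [OF assms] by (simp_all add: Q_sel R_add)
  have "cs (c \<odot>\<^bsub>R\<^esub> z) = cs (c \<odot>\<^bsub>R\<^esub> x)" if "z \<in> cs x" for z
  proof -
    have zx: "z - x \<in> I" using that by (simp add: cs_mem)
    then have "z \<in> carrier R"
      using carrier_closed(2) [OF I_sub assms(1), of "z - x"] by simp
    then have "c \<odot>\<^bsub>R\<^esub> z - c \<odot>\<^bsub>R\<^esub> x \<in> I"
      using smult_I [OF zx] smult_diff assms(1) by metis
    then show ?thesis by (simp add: cs_eq)
  qed
  moreover have "x \<in> cs x" by (simp add: cs_mem I_closed)
  ultimately show "c \<odot>\<^bsub>Q\<^esub> cs x = cs (c \<odot>\<^bsub>R\<^esub> x)"
    unfolding Q_sel by blast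
qed

lemma ring_Q: "ring Q"
proof -
  interpret F: ring "R Quot I" by (rule quotient_is_ring)
  have [simp]: "carrier Q = carrier (R Quot I)" "\<zero>\<^bsub>Q\<^esub> = \<zero>\<^bsub>R Quot I\<^esub>" "\<one>\<^bsub>Q\<^esub> = \<one>\<^bsub>R Quot I\<^esub>"
    "X \<otimes>\<^bsub>Q\<^esub> Y = X \<otimes>\<^bsub>R Quot I\<^esub> Y" "X \<oplus>\<^bsub>Q\<^esub> Y = X \<oplus>\<^bsub>R Quot I\<^esub> Y" for X Y
    by (simp_all add: quot_alg_def ring.defs module.defs FactRing_def)
  show ?thesis
  proof (rule ringI)
    show "abelian_group Q"
      by (rule abelian_groupI; simp)
        ((rule F.a_assoc; assumption) | (rule F.a_comm; assumption) | (blast intro: F.l_neg F.a_inv_closed))+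
    show "Group.monoid Q"
      by (rule monoidI; simp add: F.m_assoc)
  qed (simp_all add: F.l_distr F.r_distr)
qed

lemma finsum_Q:
  assumes "finite S" "\<And>i. i \<in> S \<Longrightarrow> f i \<in> carrier R"
  shows "finsum Q (\<lambda>i. cs (f i)) S = cs (\<Sum>i\<in>S. f i) \<and> (\<Sum>i\<in>S. f i) \<in> carrier R"
proof -
  interpret Q: ring Q by (rule ring_Q)
  show ?thesis
    using assms
  proof (induction S rule: finite_induct)
    case empty
    then show ?case by (simp add: Q_sel cs_zero carrier_closed)
  next
    case (insert i S)
    then have "finsum Q (\<lambda>i. cs (f i)) (insert i S) = cs (f i) \<oplus>\<^bsub>Q\<^esub> finsum Q (\<lambda>i. cs (f i)) S"
      by (intro Q.finsum_insert) (auto simp: Q_sel)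
    then show ?case
      using insert by (simp add: Q_ops carrier_closed)
  qed
qed

end

section \<open>The associated graded algebra of a quotient of \<open>T(V) \<rtimes> G\<close>\<close>

locale skew_ideal = ideal I tensor_skew for I :: "'n::finite skew set"
begin

sublocale alg_ideal I tensor_skew
proof (unfold_locales; simp?)
  fix c and x y :: "'n skew"
  show "fscale c (x - y) = fscale c x - fscale c y"
    by (auto simp: fscale_def fun_eq_iff)
  assume "x \<in> I"
  \<comment> \<open>Scalars act as multiplication by a ring element, so every two-sided ideal is a
    subspace.\<close>
  then have "gmon (cscale c 1) (mat 1) \<star> x \<in> I" "x \<in> AA"
    using I_l_closed [of x "gmon (cscale c 1) (mat 1)"] a_subset by auto
  moreover from this have "gmon (cscale c 1) (mat 1) \<star> x = fscale c x"
    using smul_fscale(1) [of c "gmon 1 (mat 1)" x] smul_one(1) [of x] by simp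
  ultimately show "fscale c x \<in> I" by simp
qed

lemma I_mult: "x \<in> I \<Longrightarrow> a \<in> AA \<Longrightarrow> a \<star> x \<in> I" "x \<in> I \<Longrightarrow> a \<in> AA \<Longrightarrow> x \<star> a \<in> I"
  using I_l_closed [of x a] I_r_closed [of x a] by simp_all

lemma I_fscale: "x \<in> I \<Longrightarrow> fscale c x \<in> I"
  using smult_I [of x c] by simp

text \<open>The sum \<open>slow d + I\<close>, that is, the preimage of filtration step
  \<open>d - 1\<close> of the quotient. Two elements of degree at most \<open>d\<close> have the
  same class in the graded piece of degree \<open>d\<close> exactly if their difference lies
  here.\<close>

definition low :: "nat \<Rightarrow> 'n skew set" where
  "low d = {x. \<exists>l\<in>slow d. x - l \<in> I}"

lemma low_closed:
  "0 \<in> low d" "x \<in> low d \<Longrightarrow> y \<in> low d \<Longrightarrow> x + y \<in> low d" "x \<in> low d \<Longrightarrow> - x \<in> low d"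
  "x \<in> low d \<Longrightarrow> y \<in> low d \<Longrightarrow> x - y \<in> low d" "x \<in> slow d \<Longrightarrow> x \<in> low d" "x \<in> I \<Longrightarrow> x \<in> low d"
proof -
  show "0 \<in> low d" unfolding low_def by (auto intro!: bexI [of _ 0] I_closed)
  show a: "x + y \<in> low d" if xy: "x \<in> low d" "y \<in> low d" for x y
  proof -
    obtain l l' where l: "l \<in> slow d" "x - l \<in> I" "l' \<in> slow d" "y - l' \<in> I"
      using xy unfolding low_def by blast
    have "x + y - (l + l') \<in> I"
      using I_closed(2) [OF l(2) l(4)] by (simp add: algebra_simps)
    then show ?thesis using l unfolding low_def by blast
  qed
  show m: "- x \<in> low d" if x: "x \<in> low d" for x
  proof -
    obtain l where l: "l \<in> slow d" "x - l \<in> I"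
      using x unfolding low_def by blast
    have "- x - (- l) \<in> I"
      using I_closed(3) [OF l(2)] by (simp add: algebra_simps)
    then show ?thesis using l unfolding low_def by blast
  qed
  show "x - y \<in> low d" if "x \<in> low d" "y \<in> low d"
    using a [OF that(1) m [OF that(2)]] by simp
  show "x \<in> low d" if "x \<in> slow d"
    unfolding low_def using that I_closed(1) by force
  show "x \<in> low d" if "x \<in> I"
    unfolding low_def using that by (auto intro!: bexI [of _ 0])
qed

lemma low_sum: "(\<And>i. i \<in> S \<Longrightarrow> f i \<in> low d) \<Longrightarrow> (\<Sum>i\<in>S. f i) \<in> low d"
  by (induction S rule: infinite_finite_induct) (auto intro: low_closed)

lemma low_mult:
  assumes "x \<in> low d" "a \<in> slow (Suc e)"
  shows "x \<star> a \<in> low (d + e)" "a \<star> x \<in> low (e + d)"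
proof -
  obtain l where l: "l \<in> slow d" "x - l \<in> I"
    using assms unfolding low_def by blast
  have a: "a \<in> AA" using assms by (simp add: slow_AA)
  have "x \<star> a - l \<star> a \<in> I" "a \<star> x - a \<star> l \<in> I"
    using I_mult [OF l(2) a] by (simp_all add: smul_diff)
  moreover have "l \<star> a \<in> slow (d + e)" "a \<star> l \<in> slow (e + d)"
    using slow_mult [OF l(1) assms(2)] slow_mult [OF assms(2) l(1)] by simp_all
  ultimately show "x \<star> a \<in> low (d + e)" "a \<star> x \<in> low (e + d)"
    unfolding low_def by blast+
qed

definition HF :: "nat \<Rightarrow> 'n skew set set" where
  "HF d = {cs a | a. a \<in> tensor_skew_filt d}"

abbreviation HL :: "nat \<Rightarrow> 'n skew set set" where
  "HL \<equiv> filt_pred Q HF"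

abbreviation gr :: "(complex, nat \<Rightarrow> 'n skew set set) module" where
  "gr \<equiv> assoc_graded Q HF"

lemma HF_eq: "HF d = cs ` slow (Suc d)"
  by (auto simp: HF_def slow_filt)

lemma HL_eq: "HL d = cs ` slow d"
  by (cases d) (auto simp: filt_pred_def HF_eq Q_sel cs_zero)

definition cl :: "nat \<Rightarrow> 'n skew \<Rightarrow> 'n skew set set" where
  "cl d a = HL d +>\<^bsub>Q\<^esub> cs a"

lemma cl_eq_image:
  assumes "a \<in> AA"
  shows "cl d a = (\<lambda>l. cs (l + a)) ` slow d"
proof -
  have "cl d a = (\<lambda>l. cs l \<oplus>\<^bsub>Q\<^esub> cs a) ` slow d"
    unfolding cl_def a_r_coset_def' HL_eq by blast
  also have "\<dots> = (\<lambda>l. cs (l + a)) ` slow d"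
    using assms by (intro image_cong refl Q_ops) (simp_all add: slow_AA)
  finally show ?thesis .
qed

lemma cl_mem: "a \<in> AA \<Longrightarrow> b \<in> AA \<Longrightarrow> cs b \<in> cl d a \<longleftrightarrow> b - a \<in> low d"
  by (auto simp: cl_eq_image low_def cs_eq image_iff algebra_simps)

lemma cl_mem_ex: "a \<in> AA \<Longrightarrow> X \<in> cl d a \<Longrightarrow> \<exists>b\<in>AA. X = cs b \<and> b - a \<in> low d"
  by (auto simp: cl_eq_image slow_AA low_closed intro!: bexI)

lemma cl_eq:
  assumes "a \<in> AA" "b \<in> AA"
  shows "cl d a = cl d b \<longleftrightarrow> a - b \<in> low d"
proof
  assume "cl d a = cl d b"
  moreover have "cs a \<in> cl d a" using assms by (simp add: cl_mem low_closed)
  ultimately show "a - b \<in> low d" using assms by (simp add: cl_mem)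
next
  assume ab: "a - b \<in> low d"
  have "c - a \<in> low d \<longleftrightarrow> c - b \<in> low d" for c
    using low_closed(2) [OF _ ab, of "c - a"] low_closed(4) [OF _ ab, of "c - b"] by auto
  then have "X \<in> cl d a \<longleftrightarrow> X \<in> cl d b" for X
    using cl_mem_ex [OF assms(1), of X d] cl_mem_ex [OF assms(2), of X d]
      cl_mem [OF assms(1), of _ d] cl_mem [OF assms(2), of _ d] by metis
  then show "cl d a = cl d b" by blast
qed

lemma cl_zero: "cl d 0 = HL d"
  by (simp add: cl_eq_image HL_eq)

text \<open>The canonical homomorphism from T(V) \<rtimes> G onto the associated graded algebra:
  each homogeneous component goes to its class. Its kernel is read off from
  \<open>GR_eq\<close>.\<close>

definition GR :: "'n skew \<Rightarrow> nat \<Rightarrow> 'n skew set set" where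
  "GR a = (\<lambda>d. cl d (scomp d a))"

lemma GR_eq: "a \<in> AA \<Longrightarrow> b \<in> AA \<Longrightarrow> GR a = GR b \<longleftrightarrow> (\<forall>d. scomp d (a - b) \<in> low d)"
  by (auto simp: GR_def fun_eq_iff cl_eq)

lemma carrier_gr: "carrier gr = GR ` AA"
proof (intro equalityI subsetI)
  fix x assume x: "x \<in> carrier gr"
  then have "\<forall>d. \<exists>a\<in>slow (Suc d). x d = cl d a" and fin: "finite {d. x d \<noteq> HL d}"
    by (auto simp: assoc_graded_def HF_eq cl_def)
  then obtain \<alpha> where \<alpha>: "\<And>d. \<alpha> d \<in> slow (Suc d)" "\<And>d. x d = cl d (\<alpha> d)"
    by metis
  then have \<alpha>A: "\<alpha> d \<in> AA" for d using slow_AA by blast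
  \<comment> \<open>A representative may carry terms of lower degree. Keeping only its component of
    degree \<open>d\<close> changes it by an element of \<open>slow d\<close>, and restricting to
    nonzero classes makes the sum finite.\<close>
  define \<xi> where "\<xi> = (\<Sum>d\<in>{d. x d \<noteq> HL d}. scomp d (\<alpha> d))"
  have "scomp d \<xi> = (\<Sum>e\<in>{d. x d \<noteq> HL d}. if d = e then scomp d (\<alpha> d) else 0)" for d
    unfolding \<xi>_def scomp_sum by (rule sum.cong) auto
  then have \<xi>: "scomp d \<xi> = (if x d = HL d then 0 else scomp d (\<alpha> d))" for d
    using fin by simp
  have "scomp d (\<alpha> d) - \<alpha> d \<in> slow d" for d
    using \<alpha>(1) [of d] by (auto simp: slow_def Suc_le_eq)
  then have "cl d (scomp d (\<alpha> d)) = cl d (\<alpha> d)" for d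
    using \<alpha>A by (simp add: cl_eq low_closed)
  then have "x = GR \<xi>"
    using \<alpha>(2) by (auto simp: GR_def fun_eq_iff \<xi> cl_zero)
  moreover have "\<xi> \<in> AA" unfolding \<xi>_def using \<alpha>A by auto
  ultimately show "x \<in> GR ` AA" by blast
next
  fix x assume "x \<in> GR ` AA"
  then obtain \<xi> where x: "x = GR \<xi>" and \<xi>: "\<xi> \<in> AA" by blast
  obtain N where N: "\<xi> \<in> slow N" using slow_ex [OF \<xi>] .
  have "x d = HL d" if "N \<le> d" for d
    using N that by (simp add: x GR_def slow_def cl_zero)
  then have "{d. x d \<noteq> HL d} \<subseteq> {..<N}"
    by (auto intro: leI)
  then have "finite {d. x d \<noteq> HL d}"
    by (rule finite_subset) simp
  then show "x \<in> carrier gr"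
    using \<xi> by (auto simp: assoc_graded_def HF_eq x GR_def cl_def)
qed

lemma GR_add:
  assumes "a \<in> AA" "b \<in> AA"
  shows "GR a \<oplus>\<^bsub>gr\<^esub> GR b = GR (a + b)"
proof -
  have "set_add Q (cl d a) (cl d b) = cl d (a + b)" if AB: "a \<in> AA" "b \<in> AA" for a b d
  proof (intro equalityI subsetI)
    fix X assume "X \<in> set_add Q (cl d a) (cl d b)"
    then obtain Y Z where YZ: "Y \<in> cl d a" "Z \<in> cl d b" "X = Y \<oplus>\<^bsub>Q\<^esub> Z"
      unfolding set_add_def' by blast
    obtain x where x: "x \<in> AA" "Y = cs x" "x - a \<in> low d"
      using cl_mem_ex [OF AB(1) YZ(1)] by metis
    obtain y where y: "y \<in> AA" "Z = cs y" "y - b \<in> low d"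
      using cl_mem_ex [OF AB(2) YZ(2)] by metis
    have X: "X = cs (x + y)" using YZ(3) x y by (simp add: Q_ops)
    have "x + y - (a + b) \<in> low d"
      using low_closed(2) [OF x(3) y(3)] by (simp add: algebra_simps)
    then show "X \<in> cl d (a + b)"
      unfolding X using AB x y by (subst cl_mem) auto
  next
    fix X assume "X \<in> cl d (a + b)"
    then obtain l where l: "l \<in> slow d" "X = cs (l + (a + b))"
      using AB by (auto simp: cl_eq_image)
    have "X = cs (l + a) \<oplus>\<^bsub>Q\<^esub> cs b" "cs (l + a) \<in> cl d a" "cs b \<in> cl d b"
      using AB l slow_AA [OF l(1)] by (simp_all add: Q_ops cl_mem low_closed add.assoc)
    then show "X \<in> set_add Q (cl d a) (cl d b)"
      unfolding set_add_def' by (intro UN_I) auto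
  qed
  then show ?thesis
    using assms by (auto simp: assoc_graded_def GR_def fun_eq_iff)
qed

lemma UN_const_eq: "S \<noteq> {} \<Longrightarrow> (\<And>x. x \<in> S \<Longrightarrow> f x = c) \<Longrightarrow> (\<Union>x\<in>S. f x) = c"
  by auto

lemma GR_scale:
  assumes "a \<in> AA"
  shows "c \<odot>\<^bsub>gr\<^esub> GR a = GR (fscale c a)"
proof -
  have "(\<Union>X\<in>cl d a. HL d +>\<^bsub>Q\<^esub> (c \<odot>\<^bsub>Q\<^esub> X)) = cl d (fscale c a)" if a: "a \<in> AA" for a d
  proof (rule UN_const_eq)
    show "cl d a \<noteq> {}" using a by (auto simp: cl_eq_image)
    fix X assume "X \<in> cl d a"
    then obtain l where l: "l \<in> slow d" "X = cs (l + a)"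
      using a by (auto simp: cl_eq_image)
    have "fscale c (l + a) - fscale c a = fscale c l"
      by (auto simp: fscale_def fun_eq_iff)
    then have "cl d (fscale c (l + a)) = cl d (fscale c a)"
      using a l slow_AA [OF l(1)] by (simp add: cl_eq low_closed)
    then show "HL d +>\<^bsub>Q\<^esub> (c \<odot>\<^bsub>Q\<^esub> X) = cl d (fscale c a)"
      using a l slow_AA [OF l(1)] Q_ops(3) [of "l + a" "l + a" c] by (simp add: cl_def)
  qed
  then show ?thesis
    using assms by (auto simp: assoc_graded_def GR_def fun_eq_iff)
qed

lemma GR_one: "\<one>\<^bsub>gr\<^esub> = GR (gmon 1 (mat 1))"
proof -
  have "tcomp d (1 :: 'n tensor) = (if d = 0 then 1 else 0)" for d
    by (simp add: one_wd)
  then show ?thesis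
    by (auto simp: assoc_graded_def GR_def fun_eq_iff cl_zero Q_sel) (auto simp: cl_def)
qed

text \<open>The product of the graded algebra is a union over all choices of representatives. So a
  choice must exist, and all choices must give one coset: the lower-order corrections
  \<open>l\<close> and \<open>m\<close> change each summand only by an element of
  \<open>low d\<close>.\<close>

lemma GR_mult:
  assumes "a \<in> AA" "b \<in> AA"
  shows "GR a \<otimes>\<^bsub>gr\<^esub> GR b = GR (a \<star> b)"
proof
  fix d
  let ?S = "\<lambda>a. {x. \<forall>i. x i \<in> GR a i}"
  have ne: "?S a \<noteq> {}" if "a \<in> AA" for a
  proof
    assume e: "?S a = {}"
    have "(\<lambda>i. cs (scomp i a)) \<in> ?S a"
      using that by (simp add: GR_def cl_mem low_closed)
    then show False unfolding e by (rule emptyE)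
  qed
  have "HL d +>\<^bsub>Q\<^esub> finsum Q (\<lambda>i. x i \<otimes>\<^bsub>Q\<^esub> y (d - i)) {..d} = GR (a \<star> b) d"
    if x: "x \<in> ?S a" and y: "y \<in> ?S b" for x y
  proof -
    have ex: "\<exists>l. \<forall>i. l i \<in> slow i \<and> x i = cs (l i + scomp i a)" if "x \<in> ?S a" "a \<in> AA" for x a
      using that by (auto simp: GR_def cl_eq_image image_iff intro!: choice)
    obtain l where l: "\<And>i. l i \<in> slow i" "\<And>i. x i = cs (l i + scomp i a)"
      using ex [OF x assms(1)] by blast
    obtain m where m: "\<And>i. m i \<in> slow i" "\<And>i. y i = cs (m i + scomp i b)"
      using ex [OF y assms(2)] by blast
    let ?f = "\<lambda>i. (l i + scomp i a) \<star> (m (d - i) + scomp (d - i) b)"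
    have lA: "l i \<in> AA" "m i \<in> AA" for i
      using l(1) m(1) slow_AA by blast+
    have eq: "finsum Q (\<lambda>i. x i \<otimes>\<^bsub>Q\<^esub> y (d - i)) {..d} = cs (\<Sum>i\<le>d. ?f i)"
    proof -
      have "(\<lambda>i. x i \<otimes>\<^bsub>Q\<^esub> y (d - i)) = (\<lambda>i. cs (?f i))"
        using assms lA by (simp add: l m Q_ops)
      then show ?thesis using finsum_Q [of "{..d}" ?f] by simp
    qed
    have "?f i - scomp i a \<star> scomp (d - i) b \<in> low d" if "i \<le> d" for i
    proof -
      have "l i \<star> (m (d - i) + scomp (d - i) b) \<in> slow (i + Suc (d - i) - 1)"
        by (rule slow_mult) (use l(1) slow_mono [OF m(1)] assms in auto)
      moreover have "scomp i a \<star> m (d - i) \<in> slow (Suc i + (d - i) - 1)"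
        by (rule slow_mult) (use m(1) assms in auto)
      moreover have "?f i - scomp i a \<star> scomp (d - i) b
          = l i \<star> (m (d - i) + scomp (d - i) b) + scomp i a \<star> m (d - i)"
        by (simp only: smul_add) (simp add: algebra_simps)
      ultimately show ?thesis using that by (simp add: low_closed)
    qed
    then have "(\<Sum>i\<le>d. ?f i - scomp i a \<star> scomp (d - i) b) \<in> low d"
      by (intro low_sum) auto
    then have "(\<Sum>i\<le>d. ?f i) - scomp d (a \<star> b) \<in> low d"
      by (simp add: sum_subtractf scomp_mult)
    then show ?thesis
      unfolding eq GR_def cl_def [symmetric] by (subst cl_eq) auto
  qed
  then have "(\<Union>x\<in>?S a. \<Union>y\<in>?S b. HL d +>\<^bsub>Q\<^esub> finsum Q (\<lambda>i. x i \<otimes>\<^bsub>Q\<^esub> y (d - i)) {..d}) = GR (a \<star> b) d"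
    by (intro UN_const_eq ne assms) auto
  then show "(GR a \<otimes>\<^bsub>gr\<^esub> GR b) d = GR (a \<star> b) d"
    by (simp add: assoc_graded_def)
qed

lemma gr_deg: "assoc_graded_deg Q HF d = GR ` {a \<in> AA. scomp d a = a}"
proof (intro equalityI subsetI)
  fix x assume "x \<in> assoc_graded_deg Q HF d"
  then obtain a where a: "a \<in> AA" "x = GR a" and x: "\<And>e. e \<noteq> d \<Longrightarrow> x e = HL e"
    by (auto simp: assoc_graded_deg_def carrier_gr)
  have "GR a = GR (scomp d a)"
    using a x by (auto simp: GR_def fun_eq_iff cl_zero)
  then show "x \<in> GR ` {a \<in> AA. scomp d a = a}"
    using a by auto
next
  fix x assume "x \<in> GR ` {a \<in> AA. scomp d a = a}"
  then obtain a where a: "a \<in> AA" "scomp d a = a" "x = GR a" by blast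
  have "scomp e a = 0" if "e \<noteq> d" for e
    using that a(2) scomp_simps(7) [of e d a] by simp
  then show "x \<in> assoc_graded_deg Q HF d"
    using a by (auto simp: assoc_graded_deg_def carrier_gr GR_def cl_zero)
qed

end

section \<open>The algebras \<open>S\<^sub>q(V)\<close> and \<open>S\<^sub>q(V) \<rtimes> G\<close>\<close>

definition qs :: "'n \<Rightarrow> 'n \<Rightarrow> complex" where
  "qs i j = (if i = j then 1 else - 1)"

lemma qcomm_qs: "qcomm qs i j = (if i = j then 0 else wd [i, j] 1 + wd [j, i] 1)"
  by (simp add: qcomm_def vec_tensor_bas wd_mult qs_def single_uminus)

lemma (in ring) ideal_if_closed:
  assumes "K \<subseteq> carrier R" "\<zero> \<in> K" "\<And>x y. x \<in> K \<Longrightarrow> y \<in> K \<Longrightarrow> x \<oplus> y \<in> K"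
    and "\<And>x. x \<in> K \<Longrightarrow> \<ominus> x \<in> K"
    and "\<And>a x. x \<in> K \<Longrightarrow> a \<in> carrier R \<Longrightarrow> a \<otimes> x \<in> K"
    and "\<And>a x. x \<in> K \<Longrightarrow> a \<in> carrier R \<Longrightarrow> x \<otimes> a \<in> K"
  shows "ideal K R"
proof (rule idealI [OF ring_axioms])
  show "subgroup K (add_monoid R)"
    by (rule add.subgroupI) (use assms in auto)
qed (use assms in auto)

lemma tensor_ideal:
  assumes "0 \<in> K" "\<And>x y. x \<in> K \<Longrightarrow> y \<in> K \<Longrightarrow> x + y \<in> K"
    and l: "\<And>a x. x \<in> K \<Longrightarrow> a * x \<in> K" and "\<And>a x. x \<in> K \<Longrightarrow> x * a \<in> K"
  shows "ideal K (tensor_alg :: (complex, 'n tensor) module)"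
proof -
  interpret ring "tensor_alg :: (complex, 'n tensor) module" by (rule ring_tensor_alg)
  have "\<ominus>\<^bsub>tensor_alg\<^esub> x = - x" for x :: "'n tensor"
    using minus_equality [of "- x" x] by simp
  moreover have "- x \<in> K" if "x \<in> K" for x
    using l [OF that, of "- 1"] by simp
  ultimately show ?thesis
    by (intro ideal_if_closed) (use assms in auto)
qed

lemma skew_ideal_if_closed:
  assumes "K \<subseteq> AA" "0 \<in> K" "\<And>x y. x \<in> K \<Longrightarrow> y \<in> K \<Longrightarrow> x + y \<in> K"
    and l: "\<And>a x. x \<in> K \<Longrightarrow> a \<in> AA \<Longrightarrow> a \<star> x \<in> K"
    and "\<And>a x. x \<in> K \<Longrightarrow> a \<in> AA \<Longrightarrow> x \<star> a \<in> K"
  shows "ideal K (tensor_skew :: (complex, 'n::finite skew) module)"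
proof -
  interpret ring "tensor_skew :: (complex, 'n skew) module" by (rule ring_tensor_skew)
  have "\<ominus>\<^bsub>tensor_skew\<^esub> x = - x" if "x \<in> AA" for x :: "'n skew"
    using minus_equality [of "- x" x] that by simp
  moreover have "- x \<in> K" if "x \<in> K" for x
  proof -
    have "x \<in> AA" using that assms(1) by blast
    then have "gmon (cscale (- 1) 1) (mat 1) \<star> x = fscale (- 1) x"
      by (simp only: gmon_simps(5) [symmetric] smul_fscale smul_one)
    also have "\<dots> = - x"
      by (simp add: fscale_def fun_eq_iff)
    finally show ?thesis using l [OF that, of "gmon (cscale (- 1) 1) (mat 1)"] by (simp only:) simp
  qed
  ultimately show ?thesis
    by (intro ideal_if_closed) (use assms in auto)
qed

lemma ideal_Sq: "ideal (Sq_ideal q) tensor_alg"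
  unfolding Sq_ideal_def by (rule ring.genideal_ideal [OF ring_tensor_alg]) simp

lemma alg_ideal_Sq: "alg_ideal (Sq_ideal qs) (tensor_alg :: (complex, 'n::finite tensor) module)"
proof -
  interpret ideal "Sq_ideal qs" "tensor_alg :: (complex, 'n tensor) module" by (rule ideal_Sq)
  show ?thesis
  proof (unfold_locales; simp?)
    fix c and x :: "'n tensor" assume "x \<in> Sq_ideal qs"
    then show "cscale c x \<in> Sq_ideal qs"
      using I_l_closed [of x "cscale c 1"] by (simp add: cscale_mult_left)
  qed
qed

abbreviation Sq_cs :: "'n::finite tensor \<Rightarrow> 'n tensor set" where
  "Sq_cs x \<equiv> Sq_ideal qs +>\<^bsub>tensor_alg\<^esub> x"

lemmas Sq_I_closed = alg_ideal.I_closed [OF alg_ideal_Sq]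
lemmas Sq_I_sum = alg_ideal.I_sum [OF alg_ideal_Sq]
lemmas Sq_smult_I = alg_ideal.smult_I [OF alg_ideal_Sq, unfolded tensor_alg_simps]
lemmas Sq_cs_eq = alg_ideal.cs_eq [OF alg_ideal_Sq]
lemmas Sq_cs_def = alg_ideal.cs_def [OF alg_ideal_Sq]
lemmas Sq_cs_zero = alg_ideal.cs_zero [OF alg_ideal_Sq]
lemmas Sq_Q_sel = alg_ideal.Q_sel [OF alg_ideal_Sq, folded Sq_def, unfolded tensor_alg_simps]
lemmas Sq_Q_ops = alg_ideal.Q_ops [OF alg_ideal_Sq, folded Sq_def, unfolded tensor_alg_simps, OF UNIV_I UNIV_I]
lemmas ring_Sq = alg_ideal.ring_Q [OF alg_ideal_Sq, folded Sq_def]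
lemmas finsum_Sq = alg_ideal.finsum_Q [OF alg_ideal_Sq, folded Sq_def, unfolded tensor_alg_simps, OF _ UNIV_I]

lemma Sq_mult: "x \<in> Sq_ideal qs \<Longrightarrow> a * x \<in> Sq_ideal qs" "x \<in> Sq_ideal qs \<Longrightarrow> x * a \<in> Sq_ideal qs"
  using ideal.I_l_closed [OF ideal_Sq, of x qs a] ideal.I_r_closed [OF ideal_Sq, of x qs a] by simp_all

lemma qcomm_Sq: "qcomm qs i j \<in> Sq_ideal qs"
  unfolding Sq_ideal_def by (rule subsetD [OF ring.genideal_self [OF ring_tensor_alg]]) auto

lemma Sq_ideal_induct [consumes 1, case_names zero add left right gen]:
  assumes "x \<in> Sq_ideal qs" "P 0" "\<And>x y. P x \<Longrightarrow> P y \<Longrightarrow> P (x + y)"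
    and "\<And>a x. P x \<Longrightarrow> P (a * x)" "\<And>a x. P x \<Longrightarrow> P (x * a)" "\<And>i j. P (qcomm qs i j)"
  shows "P x"
proof -
  have "ideal {x. P x} tensor_alg"
    by (rule tensor_ideal) (use assms in auto)
  then have "Sq_ideal qs \<subseteq> {x. P x}"
    unfolding Sq_ideal_def by (rule ring.genideal_minimal [OF ring_tensor_alg]) (use assms in auto)
  then show ?thesis using assms(1) by blast
qed

lemma tcomp_qcomm: "tcomp d (qcomm qs i j) = (if d = 2 then qcomm qs i j else 0)"
  by (simp add: qcomm_def vec_tensor_bas wd_mult)

text \<open>The generators have degree 2, and multiplication cannot lower the degree. Consequently
  S_q(V) agrees with T(V) in degrees 0 and 1, the degrees on which necessity rests.\<close>

lemma Sq_tcomp_low: "x \<in> Sq_ideal qs \<Longrightarrow> d \<le> 1 \<Longrightarrow> tcomp d x = 0"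
proof (induction x arbitrary: d rule: Sq_ideal_induct)
  case (left a x)
  then have "tcomp (d - i) x = 0" for i by simp
  then show ?case by (simp add: tcomp_mult)
next
  case (right a x)
  then have "tcomp i x = 0" if "i \<le> d" for i using that by simp
  then show ?case by (simp add: tcomp_mult)
qed (auto simp: tcomp_qcomm)

lemma Sq_act_ideal:
  assumes g: "g \<in> GG"
  shows "x \<in> Sq_ideal qs \<Longrightarrow> tensor_act g x \<in> Sq_ideal qs"
proof (induction x rule: Sq_ideal_induct)
  case (gen i j)
  have "tensor_act g (qcomm qs i j)
      = cscale (msign g i * msign g j) (qcomm qs (mperm g i) (mperm g j))"
    using g by (simp add: qcomm_qs tensor_act_add tensor_act_wd mperm_inj mult_ac)
  then show ?case
    using Sq_smult_I [OF qcomm_Sq] by simp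
qed (auto simp: Sq_I_closed Sq_mult tensor_act_add tensor_act_mult g)

lemma tensor_act_ginv:
  assumes "g \<in> GG"
  shows "tensor_act g (tensor_act (ginv g) x) = x"
  using ginv_facts [OF assms] assms by (simp flip: tensor_act_comp)

text \<open>\<open>Sq_act\<close> is an elementwise image, so the image of a coset is a full coset
  only if \<open>g\<close> maps the ideal onto itself; the inverse of \<open>g\<close> provides
  surjectivity.\<close>

lemma Sq_act_cs:
  assumes g: "g \<in> GG"
  shows "Sq_act g (Sq_cs x) = Sq_cs (tensor_act g x)"
proof -
  have "tensor_act g ` Sq_ideal qs = Sq_ideal qs"
  proof (intro equalityI subsetI)
    fix y :: "'a tensor" assume y: "y \<in> Sq_ideal qs"
    then have "tensor_act (ginv g) y \<in> Sq_ideal qs"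
      using ginv_facts [OF g] Sq_act_ideal by blast
    then show "y \<in> tensor_act g ` Sq_ideal qs"
      using tensor_act_ginv [OF g, of y] by (metis imageI)
  qed (use Sq_act_ideal g in blast)
  then have *: "tensor_act g ` {i + x | i. i \<in> Sq_ideal qs} = {i + tensor_act g x | i. i \<in> Sq_ideal qs}"
    by (force simp: tensor_act_add image_iff)
  then show ?thesis
    unfolding Sq_act_def Sq_cs_def .
qed

abbreviation SQ :: "(complex, complex ^ 'n::finite ^ 'n \<Rightarrow> 'n tensor set) module" where
  "SQ \<equiv> Sq_skew qs"

text \<open>The canonical homomorphism from T(V) \<rtimes> G onto S_q(V) \<rtimes> G, the
  counterpart of \<open>GR\<close>.\<close>

definition SK :: "'n::finite skew \<Rightarrow> complex ^ 'n ^ 'n \<Rightarrow> 'n tensor set" where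
  "SK a = (\<lambda>g. Sq_cs (a g))"

lemma SK_eq: "SK a = SK b \<longleftrightarrow> (\<forall>g. (a - b) g \<in> Sq_ideal qs)"
  by (simp add: SK_def fun_eq_iff Sq_cs_eq)

lemma Sq_sel: "\<zero>\<^bsub>Sq qs\<^esub> = Sq_ideal qs" "carrier (Sq qs) = range (Sq_cs)" "\<one>\<^bsub>Sq qs\<^esub> = Sq_cs 1"
  by (simp_all add: Sq_Q_sel)

lemma carrier_SQ: "carrier SQ = SK ` AA"
proof (intro equalityI subsetI)
  fix x assume "x \<in> carrier SQ"
  then have x: "\<forall>g\<in>GG. \<exists>y. x g = Sq_cs y" "\<forall>g. g \<notin> GG \<longrightarrow> x g = Sq_ideal qs"
    by (auto simp: Sq_skew_def skew_group_alg_def Sq_sel image_iff)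
  then obtain y where y: "\<And>g. g \<in> GG \<Longrightarrow> x g = Sq_cs (y g)" by metis
  define a where "a g = (if g \<in> GG then y g else 0)" for g
  have "x = SK a" "a \<in> AA"
    using x(2) y by (auto simp: a_def SK_def fun_eq_iff Sq_cs_zero AA_iff)
  then show "x \<in> SK ` AA" by blast
next
  fix x assume "x \<in> SK ` AA"
  then obtain a where a: "x = SK a" "a \<in> AA" by blast
  have "\<forall>g. g \<notin> GG \<longrightarrow> x g = Sq_ideal qs"
    using a by (simp add: AA_iff SK_def Sq_cs_zero)
  moreover from this have "finite {g. x g \<noteq> Sq_ideal qs}"
    by (intro finite_subset [OF _ finite_GG]) auto
  ultimately show "x \<in> carrier SQ"
    using a by (auto simp: Sq_skew_def skew_group_alg_def Sq_sel SK_def)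
qed

lemma SK_add: "SK a \<oplus>\<^bsub>SQ\<^esub> SK b = SK (a + b)"
  by (simp add: Sq_skew_def skew_group_alg_def SK_def Sq_Q_ops)

lemma SK_scale: "c \<odot>\<^bsub>SQ\<^esub> SK a = SK (fscale c a)"
  by (simp add: Sq_skew_def skew_group_alg_def SK_def Sq_Q_ops fscale_def)

lemma SK_one: "\<one>\<^bsub>SQ\<^esub> = SK (gmon 1 (mat 1))"
  by (auto simp: Sq_skew_def skew_group_alg_def SK_def Sq_sel gmon_def fun_eq_iff Sq_cs_zero)

lemma SK_mult: "SK a \<otimes>\<^bsub>SQ\<^esub> SK b = SK (a \<star> b)"
proof
  fix k :: "complex ^ 'a ^ 'a"
  show "(SK a \<otimes>\<^bsub>SQ\<^esub> SK b) k = SK (a \<star> b) k"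
  proof (cases "k \<in> GG")
    case True
    let ?f = "\<lambda>g. a g * tensor_act g (b (ginv g ** k))"
    let ?S = "{g \<in> GG. SK a g \<noteq> Sq_ideal qs}"
    interpret Q: ring "(Sq qs) :: (complex, 'a tensor set) module" by (rule ring_Sq)
    have "(SK a \<otimes>\<^bsub>SQ\<^esub> SK b) k =
        finsum (Sq qs) (\<lambda>g. SK a g \<otimes>\<^bsub>Sq qs\<^esub> Sq_act g (SK b (ginv g ** k))) ?S"
      using True by (simp add: Sq_skew_def skew_group_alg_def Sq_sel )
    also have "\<dots> = finsum (Sq qs) (\<lambda>g. Sq_cs (?f g)) ?S"
    proof (rule Q.finsum_cong' [OF refl])
      show "(\<lambda>g. Sq_cs (?f g)) \<in> ?S \<rightarrow> carrier (Sq qs)"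
        by (simp add: Sq_sel)
      fix g assume "g \<in> ?S"
      then show "SK a g \<otimes>\<^bsub>Sq qs\<^esub> Sq_act g (SK b (ginv g ** k)) = Sq_cs (?f g)"
        by (simp only: SK_def Sq_act_cs Sq_Q_ops mem_Collect_eq)
    qed
    also have "\<dots> = Sq_cs (\<Sum>g\<in>?S. ?f g)"
      using finsum_Sq [of ?S ?f] by simp
    \<comment> \<open>The product in \<open>Sq_skew\<close> runs only over those \<open>g\<close>
      whose coefficient is nonzero modulo the ideal. The remaining terms have a left factor in the
      ideal.\<close>
    also have "\<dots> = Sq_cs (\<Sum>g\<in>GG. ?f g)"
    proof -
      have "(\<Sum>g\<in>GG. ?f g) = (\<Sum>g\<in>?S. ?f g) + (\<Sum>g\<in>GG - ?S. ?f g)"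
        by (rule sum.subset_diff [of ?S GG, simplified add.commute]) auto
      moreover have "(\<Sum>g\<in>GG - ?S. ?f g) \<in> Sq_ideal qs"
      proof (rule Sq_I_sum)
        fix g assume "g \<in> GG - ?S"
        then have "Sq_cs (a g) = Sq_cs 0" by (simp add: SK_def Sq_cs_zero)
        then have "a g \<in> Sq_ideal qs" by (simp add: Sq_cs_eq)
        then show "?f g \<in> Sq_ideal qs" by (rule Sq_mult)
      qed
      ultimately have "(\<Sum>g\<in>GG. ?f g) - (\<Sum>g\<in>?S. ?f g) \<in> Sq_ideal qs"
        by simp
      then show ?thesis by (simp only: Sq_cs_eq [symmetric])
    qed
    finally show ?thesis
      using True by (simp add: SK_def smul_def)
  qed (simp add: Sq_skew_def skew_group_alg_def SK_def smul_def Sq_sel Sq_cs_zero)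
qed

lemma SQ_deg: "Sq_skew_deg qs d = SK ` {a \<in> AA. scomp d a = a}"
proof (intro equalityI subsetI)
  fix x assume x: "x \<in> Sq_skew_deg qs d"
  have "x \<in> carrier SQ"
    using x unfolding Sq_skew_deg_def by blast
  then obtain a where a: "a \<in> AA" "x = SK a"
    unfolding carrier_SQ by blast
  have "\<forall>g\<in>GG. \<exists>y. tcomp d y = y \<and> x g = Sq_cs y"
    using x unfolding Sq_skew_deg_def Bex_def tensor_deg_eq by simp
  then obtain y where y: "\<And>g. g \<in> GG \<Longrightarrow> tcomp d (y g) = y g \<and> x g = Sq_cs (y g)"
    by metis
  define b where "b g = (if g \<in> GG then y g else 0)" for g
  have "x = SK b" "b \<in> AA" "scomp d b = b"
    using a y by (auto simp: b_def SK_def fun_eq_iff AA_iff scomp_def)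
  then show "x \<in> SK ` {a \<in> AA. scomp d a = a}" by blast
next
  fix x assume "x \<in> SK ` {a \<in> AA. scomp d a = a}"
  then obtain a where a: "a \<in> AA" "scomp d a = a" "x = SK a" by blast
  then have "tcomp d (a g) = a g" for g by (metis scomp_def)
  then show "x \<in> Sq_skew_deg qs d"
    using a unfolding Sq_skew_deg_def carrier_SQ Bex_def tensor_deg_eq SK_def by blast
qed

text \<open>Both algebras are images of T(V) \<rtimes> G. If \<open>GR\<close> and \<open>SK\<close>
  identify the same elements, then sending \<open>GR a\<close> to \<open>SK a\<close> is well
  defined and injective, and it inherits everything else.\<close>

lemma (in skew_ideal) graded_isoI:
  assumes key: "\<And>a b. a \<in> AA \<Longrightarrow> b \<in> AA \<Longrightarrow> GR a = GR b \<longleftrightarrow> SK a = SK b"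
  shows "graded_alg_isomorphic gr (assoc_graded_deg Q HF)
    (SQ :: (complex, complex ^ 'n ^ 'n \<Rightarrow> 'n tensor set) module) (Sq_skew_deg qs)"
proof -
  define h where "h x = SK (SOME a. a \<in> AA \<and> x = GR a)" for x
  have h: "h (GR a) = SK a" if "a \<in> AA" for a
  proof -
    let ?b = "SOME b. b \<in> AA \<and> GR a = GR b"
    have b: "?b \<in> AA \<and> GR a = GR ?b"
      by (rule someI [of _ a]) (use that in simp)
    have "SK a = SK ?b"
      using key [OF that conjunct1 [OF b]] conjunct2 [OF b] by (rule iffD1)
    then show ?thesis unfolding h_def by (rule sym)
  qed
  have "h \<in> ring_hom gr SQ"
    by (rule ring_hom_memI) (auto simp: carrier_gr carrier_SQ h GR_mult GR_add GR_one SK_mult SK_add SK_one)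
  moreover have "bij_betw h (carrier gr) (carrier SQ)"
    unfolding bij_betw_def inj_on_def carrier_gr carrier_SQ
    by (auto simp: h key image_iff)
  ultimately have iso: "h \<in> ring_iso gr SQ"
    by (simp add: ring_iso_def)
  have scale: "h (c \<odot>\<^bsub>gr\<^esub> x) = c \<odot>\<^bsub>SQ\<^esub> h x" if "x \<in> carrier gr" for c x
    using that by (auto simp: carrier_gr GR_scale SK_scale h)
  have deg: "h ` assoc_graded_deg Q HF d = Sq_skew_deg qs d" for d
    unfolding gr_deg SQ_deg image_image by (rule image_cong) (auto simp: h)
  show ?thesis
    unfolding graded_alg_isomorphic_def by (intro bexI [OF _ iso] conjI allI ballI scale deg)
qed

section \<open>The Poincare-Birkhoff-Witt property\<close>

definition lin :: "('n list \<Rightarrow> complex) \<Rightarrow> 'n tensor \<Rightarrow> complex" where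
  "lin f x = (\<Sum>w\<in>Poly_Mapping.keys x. Poly_Mapping.lookup x w * f (letters w))"

lemma lin_add: "lin f (x + y) = lin f x + lin f y"
  unfolding lin_def by (rule setsum_keys_plus_distrib) (auto simp: algebra_simps)

lemma lin_zero [simp]: "lin f 0 = 0"
  by (simp add: lin_def)

lemma lin_diff: "lin f (x - y) = lin f x - lin f y"
  using lin_add [of f "x - y" y] by simp

lemma lin_wd [simp]: "lin f (wd w c) = c * f w"
  by (simp add: lin_def)

lemma lin_cong: "(\<And>w. w \<in> Poly_Mapping.keys x \<Longrightarrow> f (letters w) = f' (letters w)) \<Longrightarrow> lin f x = lin f' x"
  unfolding lin_def by (rule sum.cong) auto

lemma lin_const_zero [simp]: "lin (\<lambda>w. 0) x = 0"
  by (simp add: lin_def)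

text \<open>The linear functional on T(V) \<rtimes> G with value \<open>F w g\<close> on the basis
  element \<open>w g\<close>.\<close>

definition ev :: "('n list \<Rightarrow> complex ^ 'n ^ 'n \<Rightarrow> complex) \<Rightarrow> 'n::finite skew \<Rightarrow> complex" where
  "ev F a = (\<Sum>g\<in>GG. lin (\<lambda>w. F w g) (a g))"

lemma ev_add: "ev F (a + b) = ev F a + ev F b"
  by (simp add: ev_def lin_add sum.distrib)

lemma ev_zero [simp]: "ev F 0 = 0"
  by (simp add: ev_def)

lemma ev_diff: "ev F (a - b) = ev F a - ev F b"
  by (simp add: ev_def lin_diff sum_subtractf)

lemma ev_sum: "ev F (\<Sum>i\<in>S. f i) = (\<Sum>i\<in>S. ev F (f i))"
  by (rule additive_sum [of "ev F"]) (simp_all add: ev_add)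

lemma ev_gmon:
  assumes "g \<in> GG"
  shows "ev F (gmon (wd w c) g) = c * F w g"
proof -
  have "ev F (gmon (wd w c) g) = (\<Sum>h\<in>GG. if h = g then c * F w g else 0)"
    unfolding ev_def by (rule sum.cong) (auto simp: gmon_def)
  then show ?thesis using assms by simp
qed

lemma AA_wd_induct [consumes 1, case_names gmon add]:
  assumes a: "a \<in> (AA :: 'n::finite skew set)" and m: "\<And>w c g. g \<in> GG \<Longrightarrow> P (gmon (wd w c) g)"
    and p: "\<And>a b. a \<in> AA \<Longrightarrow> b \<in> AA \<Longrightarrow> P a \<Longrightarrow> P b \<Longrightarrow> P (a + b)"
  shows "P a"
  using a
proof (induction a rule: AA_induct)
  case (gmon x g)
  then show ?case
    by (induction x rule: tensor_induct) (simp_all add: m p)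
qed (rule p)

definition kcoef :: "'n::finite kmap \<Rightarrow> 'n \<Rightarrow> 'n \<Rightarrow> complex ^ 'n ^ 'n \<Rightarrow> complex" where
  "kcoef \<kappa> i j g = Poly_Mapping.lookup (\<kappa> (bas i) (bas j)) g"

text \<open>A basis of the ideal stays independent when \<open>x\<close> is added, so the values 0
  on the basis and 1 at \<open>x\<close> can be prescribed.\<close>

lemma linear_functional_separating:
  assumes x: "x \<notin> Sq_ideal qs"
  obtains f :: "'n::finite tensor \<Rightarrow> complex"
  where "\<And>y z. f (y + z) = f y + f z" "\<And>c y. f (cscale c y) = c * f y"
    "\<And>y. y \<in> Sq_ideal qs \<Longrightarrow> f y = 0" "f x = 1"
proof -
  interpret V: vector_space_pair "cscale :: complex \<Rightarrow> 'n tensor \<Rightarrow> _" "(*) :: complex \<Rightarrow> complex \<Rightarrow> complex"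
    by unfold_locales (auto simp: cscale_add_left algebra_simps)
  have J: "V.vs1.subspace (Sq_ideal qs :: 'n tensor set)"
    unfolding V.vs1.subspace_def by (auto simp: Sq_I_closed Sq_smult_I)
  obtain B where B: "B \<subseteq> Sq_ideal qs" "V.vs1.independent B" "Sq_ideal qs \<subseteq> V.vs1.span B"
    using V.vs1.basis_exists [of "Sq_ideal qs :: 'n tensor set"] by metis
  have "V.vs1.span B = Sq_ideal qs"
    using B(3) V.vs1.span_minimal [OF B(1) J] by blast
  then have "V.vs1.independent (insert x B)"
    using B(2) x by (intro V.vs1.independent_insertI) auto
  from V.linear_independent_extend [OF this, of "\<lambda>y. if y = x then 1 else 0"]
  obtain f where f: "Vector_Spaces.linear cscale (*) f" "\<And>y. y \<in> insert x B \<Longrightarrow> f y = (if y = x then 1 else 0)"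
    by metis
  interpret f: Vector_Spaces.linear cscale "(*)" f by (rule f(1))
  have "f y = 0" if "y \<in> B" for y
    using f(2) [of y] that x B(1) by auto
  then have "f y = 0" if "y \<in> V.vs1.span B" for y
    using V.linear_eq_0_on_span [OF f(1)] that by blast
  then show ?thesis
    using that [of f] f(2) [of x] B(3) f.add f.scale by auto
qed

lemma smul_gmon_right:
  assumes "a \<in> AA" "h \<in> GG"
  shows "a \<star> gmon y h = (\<lambda>k. a (k ** ginv h) * tensor_act (k ** ginv h) y)"
  using assms(1)
proof (induction a rule: AA_induct)
  case (gmon x g)
  have "k ** ginv h = g \<longleftrightarrow> k = g ** h" for k
    using ginv_cancel [OF assms(2)] by metis
  then show ?case
    using gmon assms(2) by (auto simp: gmon_mult fun_eq_iff) (auto simp: gmon_def ginv_cancel)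
next
  case (add a b)
  show ?case
    by (simp only: smul_add add.IH) (auto simp: fun_eq_iff distrib_right)
qed

locale dha =
  fixes \<kappa> :: "'n::finite kmap"
  assumes adm: "admissible qs \<kappa>"
begin

abbreviation k :: "'n \<Rightarrow> 'n \<Rightarrow> complex ^ 'n ^ 'n \<Rightarrow> complex" where
  "k \<equiv> kcoef \<kappa>"

lemma k_outside: "g \<notin> GG \<Longrightarrow> k i j g = 0"
  using adm unfolding admissible_def kcoef_def by (meson in_keys_iff subsetD)

lemma k_swap: "k i j g = - qs i j * k j i g"
proof -
  have "\<kappa> (bas i) (bas j) = cscale (- qs i j) (\<kappa> (bas j) (bas i))"
    using adm unfolding admissible_def by blast
  then show ?thesis
    unfolding kcoef_def by (metis lookup_cscale)
qed

lemma k_diag [simp]: "k i i g = 0"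
  using k_swap [of i i g] by (simp add: qs_def)

lemma k_sym: "k i j g = k j i g"
  using k_swap [of i j g] by (cases "i = j") (auto simp: qs_def)

definition kel :: "'n \<Rightarrow> 'n \<Rightarrow> 'n skew" where
  "kel i j = (\<lambda>g. wd [] (k i j g))"

definition rel :: "'n \<Rightarrow> 'n \<Rightarrow> 'n skew" where
  "rel i j = gmon (qcomm qs i j) (mat 1) - kel i j"

lemma kel_AA [simp, intro]: "kel i j \<in> AA"
  by (simp add: AA_iff kel_def k_outside)

lemma rel_AA [simp, intro]: "rel i j \<in> AA"
  by (auto simp: rel_def)

lemma kel_diag: "kel i i = 0"
  by (auto simp: kel_def)

lemma rel_diag: "rel i i = 0"
  by (simp add: rel_def qcomm_qs kel_diag)

lemma kel_sum: "kel i j = (\<Sum>g\<in>GG. gmon (wd [] (k i j g)) g)"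
  using AA_sum_gmon [OF kel_AA] by (simp add: kel_def)

lemma H_ideal_rel: "H_ideal qs \<kappa> = Idl\<^bsub>tensor_skew\<^esub> {rel i j | i j. True}"
proof -
  have "tensor_emb (qcomm qs i j) - gralg_emb (\<kappa> (bas i) (bas j)) = rel i j" for i j
    by (simp add: rel_def tensor_emb_def gralg_emb_def gmon_def kel_def kcoef_def one_wd fun_eq_iff)
  then show ?thesis unfolding H_ideal_def by simp
qed

sublocale skew_ideal "H_ideal qs \<kappa>"
proof -
  interpret ideal "H_ideal qs \<kappa>" tensor_skew
    unfolding H_ideal_rel by (rule ring.genideal_ideal [OF ring_tensor_skew]) auto
  show "skew_ideal (H_ideal qs \<kappa>)"
    by (rule skew_ideal.intro) (rule ideal_axioms)
qed

abbreviation I :: "'n skew set" where "I \<equiv> H_ideal qs \<kappa>"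

lemma rel_I: "rel i j \<in> I"
  unfolding H_ideal_rel
  by (rule subsetD [OF ring.genideal_self [OF ring_tensor_skew]]) auto

lemma I_induct [consumes 1, case_names zero add left right gen]:
  assumes x: "x \<in> I" and P: "P 0" "\<And>x y. x \<in> AA \<Longrightarrow> y \<in> AA \<Longrightarrow> P x \<Longrightarrow> P y \<Longrightarrow> P (x + y)"
    "\<And>a x. a \<in> AA \<Longrightarrow> x \<in> AA \<Longrightarrow> P x \<Longrightarrow> P (a \<star> x)" "\<And>a x. a \<in> AA \<Longrightarrow> x \<in> AA \<Longrightarrow> P x \<Longrightarrow> P (x \<star> a)"
    "\<And>i j. P (rel i j)"
  shows "P x"
proof -
  have "ideal {x \<in> AA. P x} tensor_skew"
    by (rule skew_ideal_if_closed) (use P in auto)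
  then have "I \<subseteq> {x \<in> AA. P x}"
    unfolding H_ideal_rel by (rule ring.genideal_minimal [OF ring_tensor_skew]) (use P in auto)
  then show ?thesis using x by blast
qed

lemma is_quantum_DH_iff:
  "is_quantum_DH qs \<kappa> \<longleftrightarrow> graded_alg_isomorphic gr (assoc_graded_deg Q HF)
    (SQ :: (complex, complex ^ 'n ^ 'n \<Rightarrow> 'n tensor set) module) (Sq_skew_deg qs)"
proof -
  have "H_filt qs \<kappa> = HF"
    by (rule ext) (simp add: H_filt_def HF_def)
  then show ?thesis
    unfolding is_quantum_DH_def H_alg_def by simp
qed

subsection \<open>Sufficiency\<close>

text \<open>By linearity \<open>b\<close> and \<open>c\<close> are multiples of \<open>u g\<close>
  and \<open>z h\<close>. Moving \<open>g\<close> through the relation for \<open>i\<close>,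
  \<open>j\<close> turns its quadratic part, up to sign, into that for the images of
  \<open>i\<close> and \<open>j\<close>; invariance says that the group algebra part
  follows.\<close>

lemma ev_rel_vanish:
  assumes F: "\<And>u i j z g. i \<noteq> j \<Longrightarrow> F (u @ i # j # z) g + F (u @ j # i # z) g = contr k F i j u z g"
    and inv: "invariant k" and b: "b \<in> AA" and c: "c \<in> AA"
  shows "ev F (b \<star> rel i j \<star> c) = 0"
  using b
proof (induction b rule: AA_wd_induct)
  case (gmon u \<beta> g)
  note g = gmon
  show ?case
    using c
  proof (induction c rule: AA_wd_induct)
    case (gmon z \<gamma> h)
    note h = gmon
    show ?case
    proof (cases "i = j")
      case True
      then show ?thesis by (simp add: rel_diag flip: zero_fun_def)
    next
      case ij: False
      define C where "C = \<beta> * \<gamma> * msign g i * msign g j * msigns g z"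
      let ?p = "mperm g"
      have quad: "ev F (gmon (wd u \<beta>) g \<star> gmon (qcomm qs i j) (mat 1) \<star> gmon (wd z \<gamma>) h)
          = C * contr k F (?p i) (?p j) u (map ?p z) (g ** h)"
      proof -
        have "gmon (wd u \<beta>) g \<star> gmon (qcomm qs i j) (mat 1) \<star> gmon (wd z \<gamma>) h
            = gmon (wd (u @ ?p i # ?p j # map ?p z) C) (g ** h) + gmon (wd (u @ ?p j # ?p i # map ?p z) C) (g ** h)"
          using g h ij by (simp add: smul_add gmon_mult qcomm_qs tensor_act_add tensor_act_wd wd_mult
              distrib_left distrib_right C_def mult_ac)
        then have "ev F (gmon (wd u \<beta>) g \<star> gmon (qcomm qs i j) (mat 1) \<star> gmon (wd z \<gamma>) h)
          = C * (F (u @ ?p i # ?p j # map ?p z) (g ** h) + F (u @ ?p j # ?p i # map ?p z) (g ** h))"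
          using g h by (simp only: ev_add ev_gmon GG_mult distrib_left)
        then show ?thesis using F [of "?p i" "?p j"] g ij by (simp add: mperm_inj)
      qed
      have "ev F (gmon (wd u \<beta>) g \<star> kel i j \<star> gmon (wd z \<gamma>) h)
          = (\<Sum>l\<in>GG. \<beta> * k i j l * \<gamma> * msigns (g ** l) z * F (u @ map (mperm (g ** l)) z) (g ** l ** h))"
        unfolding kel_sum smul_sum ev_sum
        by (rule sum.cong) (use g h in \<open>simp_all add: gmon_mult tensor_act_wd wd_mult ev_gmon\<close>)
      also have "\<dots> = C * contr k F (?p i) (?p j) u (map ?p z) (g ** h)"
      proof -
        \<comment> \<open>Reindexing by conjugation with \<open>g\<close> matches \<open>g l\<close>
          on the left with \<open>(g l g^-1) g\<close> on the right.\<close>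
        have "contr k F (?p i) (?p j) u (map ?p z) (g ** h)
          = (\<Sum>l\<in>GG. k (?p i) (?p j) (g ** l ** ginv g) * msigns (g ** l ** ginv g) (map ?p z)
            * F (u @ map (mperm (g ** l ** ginv g)) (map ?p z)) (g ** l ** ginv g ** (g ** h)))"
          unfolding contr_def by (rule sum_GG_conj [OF g, symmetric])
        then have "C * contr k F (?p i) (?p j) u (map ?p z) (g ** h)
          = (\<Sum>l\<in>GG. C * (k (?p i) (?p j) (g ** l ** ginv g) * msigns (g ** l ** ginv g) (map ?p z)
            * F (u @ map (mperm (g ** l ** ginv g)) (map ?p z)) (g ** l ** ginv g ** (g ** h))))"
          by (simp only: sum_distrib_left)
        also have "\<dots> = (\<Sum>l\<in>GG. \<beta> * k i j l * \<gamma> * msigns (g ** l) z * F (u @ map (mperm (g ** l)) z) (g ** l ** h))"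
        proof (rule sum.cong [OF refl])
          fix l :: "complex ^ 'n ^ 'n" assume l: "l \<in> GG"
          let ?c = "g ** l ** ginv g"
          have c: "?c \<in> GG" "?c ** g = g ** l"
            using g l ginv_facts ginv_cancel by auto
          have 1: "?c ** (g ** h) = g ** l ** h"
            by (simp add: c(2) matrix_mul_assoc)
          have 2: "map (mperm ?c) (map ?p z) = map (mperm (g ** l)) z"
            using mperm_mult [OF c(1) g] c(2) by simp
          have 3: "msigns ?c (map ?p z) * msigns g z = msigns (g ** l) z"
            using msigns_mult [OF c(1) g, of z] c(2) by simp
          have 4: "k (?p i) (?p j) ?c = msign g i * msign g j * k i j l"
            using inv g l ij unfolding invariant_def by blast
          have 5: "msign g i * msign g i = 1" "msign g j * msign g j = 1"
            using g by (simp_all add: msign_sq)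
          have "C * (k (?p i) (?p j) ?c * msigns ?c (map ?p z) * X)
            = \<beta> * k i j l * \<gamma> * (msign g i * msign g i) * (msign g j * msign g j)
              * (msigns ?c (map ?p z) * msigns g z) * X" for X
            unfolding 4 C_def by simp
          then show "C * (k (?p i) (?p j) ?c * msigns ?c (map ?p z)
              * F (u @ map (mperm ?c) (map ?p z)) (?c ** (g ** h)))
            = \<beta> * k i j l * \<gamma> * msigns (g ** l) z * F (u @ map (mperm (g ** l)) z) (g ** l ** h)"
            unfolding 5 3 2 1 by simp
        qed
        finally show ?thesis by simp
      qed
      finally show ?thesis
        by (simp only: rel_def smul_diff ev_diff quad) simp
    qed
  next
    case (add a b)
    then show ?case by (simp only: smul_add ev_add) simp
  qed
next
  case (add a b)
  then show ?case by (simp only: smul_add ev_add) simp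
qed

text \<open>Vanishing at \<open>x\<close> is not inherited by multiples of \<open>x\<close>, so the
  induction carries all products \<open>b \<star> x \<star> c\<close>; the unit gives the
  claim.\<close>

lemma ev_vanish:
  assumes F: "\<And>u i j z g. i \<noteq> j \<Longrightarrow> F (u @ i # j # z) g + F (u @ j # i # z) g = contr k F i j u z g"
    and inv: "invariant k" and x: "x \<in> I"
  shows "ev F x = 0"
proof -
  have "x \<in> AA \<and> (\<forall>b\<in>AA. \<forall>c\<in>AA. ev F (b \<star> x \<star> c) = 0)"
    using x
  proof (induction x rule: I_induct)
    case (left a x)
    have "b \<star> (a \<star> x) = (b \<star> a) \<star> x" for b by (simp only: smul_assoc)
    then show ?case using left by simp
  next
    case (right a x)
    have "b \<star> (x \<star> a) \<star> c = b \<star> x \<star> (a \<star> c)" for b c by (simp only: smul_assoc)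
    then show ?case using right by simp
  next
    case (gen i j)
    show ?case using ev_rel_vanish [OF F inv] by blast
  next
    case (add x y)
    then show ?case by (auto simp only: smul_add ev_add) auto
  next
    case zero
    show ?case by (simp flip: zero_fun_def)
  qed
  then have "ev F (gmon 1 (mat 1) \<star> x \<star> gmon 1 (mat 1)) = 0" and "x \<in> AA"
    by auto
  then show ?thesis by (simp add: smul_one)
qed

text \<open>Replacing a quadratic relation by the corresponding generator of \<open>I\<close> costs
  only terms of lower degree, whatever \<kappa> is. So the kernel of \<open>SK\<close> always lies
  in that of \<open>GR\<close>, and the conditions on \<kappa> enter only in the reverse
  inclusion.\<close>

lemma Sq_low:
  assumes "x \<in> Sq_ideal qs"
  shows "g \<in> GG \<Longrightarrow> gmon (tcomp d x) g \<in> low d"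
  using assms
proof (induction x arbitrary: g d rule: Sq_ideal_induct)
  case zero
  then show ?case by (simp add: low_closed flip: zero_fun_def)
next
  case (add x y)
  then show ?case unfolding tcomp_simps(1) gmon_simps(1) by (intro low_closed(2) add.IH)
next
  case (left a x)
  have "gmon (tcomp i a * tcomp (d - i) x) g \<in> low d" if "i \<le> d" for i
  proof -
    have "gmon (tcomp i a) (mat 1) \<in> slow (Suc i)" by (simp add: slow_def)
    from low_mult(2) [OF left.IH [OF left.prems, of "d - i"] this]
    show ?thesis using left.prems that by (simp add: gmon_mult)
  qed
  then show ?case
    unfolding tcomp_mult gmon_sum by (intro low_sum) auto
next
  case (right a x)
  have "gmon (tcomp i x * tcomp (d - i) a) g \<in> low d" if "i \<le> d" for i
  proof -
    have "gmon (tcomp (d - i) a) g \<in> slow (Suc (d - i))" using right.prems by (simp add: slow_def)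
    from low_mult(1) [OF right.IH [OF GG_one, of i] this]
    show ?thesis using right.prems that by (simp add: gmon_mult)
  qed
  then show ?case
    unfolding tcomp_mult gmon_sum by (intro low_sum) auto
next
  case (gen i j)
  have "gmon (qcomm qs i j) g \<in> low 2"
  proof -
    have "rel i j \<star> gmon 1 g \<in> low 2"
      using rel_I gen by (intro low_closed(6) I_mult) auto
    moreover have "kel i j \<star> gmon 1 g \<in> low 2"
    proof (rule low_closed(5))
      have "kel i j \<in> slow (Suc 0)" "gmon 1 g \<in> slow (Suc 0)"
        using gen kel_AA [of i j]
        by (simp_all add: slow_def one_wd) (simp add: kel_def scomp_def fun_eq_iff)
      then have "kel i j \<star> gmon 1 g \<in> slow (Suc 0 + Suc 0 - 1)"
        by (rule slow_mult)
      then show "kel i j \<star> gmon 1 g \<in> slow 2"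
        by (rule slow_mono) simp
    qed
    moreover have "gmon (qcomm qs i j) g = rel i j \<star> gmon 1 g + kel i j \<star> gmon 1 g"
      using gen by (simp add: rel_def smul_diff gmon_mult)
    ultimately show ?thesis by (simp only: low_closed)
  qed
  then show ?case by (simp add: tcomp_qcomm low_closed flip: zero_fun_def)
qed

text \<open>A component of degree \<open>d\<close> outside the ideal is detected by a functional
  \<open>f\<close>. Placed at the single group element \<open>g\<close> and extended by
  \<open>pbw_functional\<close>, it kills \<open>I\<close> and all lower degrees, hence
  \<open>low d\<close>, and yet takes the value 1 on \<open>scomp d a\<close>.\<close>

lemma GR_imp_SK:
  assumes inv: "invariant k" and jac: "jacobi k" and a: "a \<in> AA" "\<And>d. scomp d a \<in> low d"
  shows "a g \<in> Sq_ideal qs"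
proof (cases "g \<in> GG")
  case False
  then show ?thesis using a by (simp add: AA_iff Sq_I_closed)
next
  case g: True
  have "tcomp d (a g) \<in> Sq_ideal qs" for d
  proof (rule ccontr)
    assume "tcomp d (a g) \<notin> Sq_ideal qs"
    then obtain f where f: "\<And>y z. f (y + z) = f y + f z" "\<And>c y. f (cscale c y) = c * f y"
      "\<And>y. y \<in> Sq_ideal qs \<Longrightarrow> f y = 0" "f (tcomp d (a g)) = (1 :: complex)"
      by (rule linear_functional_separating) blast
    define f' where "f' w h = (if h = g then f (wd w 1) else 0)" for w and h :: "complex ^ 'n ^ 'n"
    have f': "f' (u @ i # j # z) h + f' (u @ j # i # z) h = 0" if "i \<noteq> j" for u i j z h
    proof -
      have "wd (u @ i # j # z) 1 + wd (u @ j # i # z) 1 = wd u 1 * qcomm qs i j * wd z 1"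
        using that by (simp add: qcomm_qs wd_mult distrib_left distrib_right)
      then have "f (wd (u @ i # j # z) 1) + f (wd (u @ j # i # z) 1) = 0"
        using f(3) [of "wd u 1 * qcomm qs i j * wd z 1"] f(1)
        by (metis Sq_mult qcomm_Sq)
      then show ?thesis by (simp add: f'_def)
    qed
    obtain F where F:
      "\<And>u i j z g. i \<noteq> j \<Longrightarrow> F (u @ i # j # z) g + F (u @ j # i # z) g = contr k F i j u z g"
      "\<And>w g. length w < d \<Longrightarrow> F w g = 0" "\<And>w g. length w = d \<Longrightarrow> F w g = f' w g"
    proof (rule pbw_functional [of k f' d, OF ext [OF k_sym] inv jac f'])
      fix F
      assume F: "\<And>u i j z g. i \<noteq> j \<Longrightarrow> F (u @ i # j # z) g + F (u @ j # i # z) g = contr k F i j u z g"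
        "\<And>w g. length w < d \<Longrightarrow> F w g = 0" "\<And>w g. length w = d \<Longrightarrow> F w g = f' w g"
      show thesis by (rule that [OF F])
    qed
    obtain l where l: "l \<in> slow d" "scomp d a - l \<in> I"
      using a(2) [of d] unfolding low_def by blast
    have "ev F l = 0"
      unfolding ev_def
    proof (rule sum.neutral, rule ballI)
      fix h :: "complex ^ 'n ^ 'n"
      have "tcomp e (l h) = 0" if "e \<ge> d" for e
        using l(1) that by (simp add: slow_def scomp_def fun_eq_iff)
      then have "length (letters w) < d" if "w \<in> Poly_Mapping.keys (l h)" for w
        using that by (metis tcomp_eq_0_iff not_le)
      then have "lin (\<lambda>w. F w h) (l h) = lin (\<lambda>w. 0) (l h)"
        by (intro lin_cong) (simp add: F)
      then show "lin (\<lambda>w. F w h) (l h) = 0" by simp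
    qed
    then have "ev F (scomp d a) = 0"
      using ev_vanish [OF F(1) inv l(2)] by (simp add: ev_diff)
    moreover have "ev F (scomp d a) = (\<Sum>h\<in>GG. if h = g then lin (\<lambda>w. f (wd w 1)) (tcomp d (a g)) else 0)"
      unfolding ev_def
    proof (rule sum.cong [OF refl])
      fix h :: "complex ^ 'n ^ 'n"
      have "length (letters w) = d" if "w \<in> Poly_Mapping.keys (tcomp d (a h))" for w
        using that by (auto simp: in_keys_iff lookup_tcomp split: if_splits)
      then have "lin (\<lambda>w. F w h) (tcomp d (a h)) = lin (\<lambda>w. f' w h) (tcomp d (a h))"
        by (intro lin_cong) (simp add: F)
      then show "lin (\<lambda>w. F w h) (scomp d a h) = (if h = g then lin (\<lambda>w. f (wd w 1)) (tcomp d (a g)) else 0)"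
        by (auto simp: f'_def scomp_def)
    qed
    moreover have "lin (\<lambda>w. f (wd w 1)) x = f x" for x
    proof (induction x rule: tensor_induct)
      case (wd w c)
      show ?case using f(2) [of c "wd w 1"] by simp
    qed (simp add: lin_add f(1))
    ultimately show False using g f(4) by simp
  qed
  moreover obtain N where "a g \<in> tlow N" using tlow_ex by blast
  ultimately show ?thesis
    using tlow_sum_tcomp [of "a g" N] Sq_I_sum [of "{..<N}" "\<lambda>d. tcomp d (a g)"] by simp
qed

theorem sufficient:
  assumes "invariant k" "jacobi k"
  shows "is_quantum_DH qs \<kappa>"
  unfolding is_quantum_DH_iff
proof (rule graded_isoI)
  fix a b :: "'n skew" assume a: "a \<in> AA" and b: "b \<in> AA"
  show "GR a = GR b \<longleftrightarrow> SK a = SK b"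
  proof
    assume "GR a = GR b"
    then have "scomp d (a - b) \<in> low d" for d
      using GR_eq [OF a b] by blast
    then show "SK a = SK b"
      using GR_imp_SK [OF assms, of "a - b"] a b unfolding SK_eq by blast
  next
    assume "SK a = SK b"
    then have J: "(a - b) g \<in> Sq_ideal qs" for g
      unfolding SK_eq by blast
    have "scomp d (a - b) \<in> low d" for d
    proof -
      have "scomp d (a - b) = (\<Sum>g\<in>GG. gmon (tcomp d ((a - b) g)) g)"
        using AA_sum_gmon [OF scomp_AA [OF AA_closed(4) [OF a b]], of d] by (simp only: scomp_def)
      also have "\<dots> \<in> low d"
        by (intro low_sum Sq_low J)
      finally show ?thesis .
    qed
    then show "GR a = GR b"
      using GR_eq [OF a b] by blast
  qed
qed

end

subsection \<open>Necessity\<close>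

text \<open>Extend a nonzero kernel vector \<open>x\<close> to a basis \<open>B\<close>. By
  surjectivity \<open>V\<close> is spanned by the images of \<open>B - {x}\<close>, which are too
  few.\<close>

lemma (in vector_space) linear_surj_imp_inj_on_finite_dim:
  assumes V: "subspace V" "finite T" "V \<subseteq> span T"
    and f: "\<And>x y. x \<in> V \<Longrightarrow> y \<in> V \<Longrightarrow> f (x + y) = f x + f y" "\<And>c x. x \<in> V \<Longrightarrow> f (scale c x) = scale c (f x)"
    and surj: "V \<subseteq> f ` V" and x: "x \<in> V" "f x = 0"
  shows "x = 0"
proof (rule ccontr)
  assume "x \<noteq> 0"
  then have "independent {x}" by simp
  then obtain B where B: "{x} \<subseteq> B" "B \<subseteq> V" "independent B" "V \<subseteq> span B"
    using maximal_independent_subset_extend [of "{x}" V] x(1) by auto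
  have fin: "finite B"
    using independent_span_bound [OF V(2) B(3)] B(2) V(3) by blast
  have "v \<in> V \<and> f v \<in> span (f ` (B - {x}))" if "v \<in> span B" for v
    using that
  proof (induction v rule: span_induct)
    case base
    have "f 0 = 0" using f(2) [OF x(1), of 0] by simp
    then have "subspace {v. v \<in> V \<and> f v \<in> span (f ` (B - {x}))}"
      using V(1) f unfolding subspace_def
      by (auto intro: span_zero span_add span_scale)
    then show ?case by simp
  next
    case (step b)
    then show ?case
      using B(2) x(2) by (cases "b = x") (auto intro: span_base span_zero)
  qed
  then have "V \<subseteq> span (f ` (B - {x}))"
    using surj B(4) by blast
  then have "card B \<le> card (f ` (B - {x}))"
    using independent_span_bound [OF _ B(3), of "f ` (B - {x})"] B(2) fin by blast
  also have "\<dots> \<le> card (B - {x})"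
    using fin by (intro card_image_le) simp
  also have "\<dots> < card B"
    using B(1) fin by (intro psubset_card_mono) auto
  finally show False by simp
qed

lemma vector_space_fscale: "vector_space (fscale :: complex \<Rightarrow> 'n skew \<Rightarrow> 'n skew)"
  by unfold_locales (auto simp: fscale_def fun_eq_iff cscale_add_left)

definition VV :: "nat \<Rightarrow> 'n::finite skew set" where
  "VV d = {a \<in> AA. scomp d a = a}"

lemma VV_closed:
  "0 \<in> VV d" "a \<in> VV d \<Longrightarrow> b \<in> VV d \<Longrightarrow> a + b \<in> VV d" "a \<in> VV d \<Longrightarrow> b \<in> VV d \<Longrightarrow> a - b \<in> VV d"
  "a \<in> VV d \<Longrightarrow> fscale c a \<in> VV d"
  by (auto simp: VV_def)

lemma VV_span:
  defines "T \<equiv> \<lambda>d. (\<lambda>(w, g). gmon (wd w 1) g) ` ({w :: 'n::finite list. length w = d} \<times> GG)"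
  shows "finite (T d)" "VV d \<subseteq> module.span fscale (T d)"
proof -
  interpret vector_space "fscale :: complex \<Rightarrow> 'n skew \<Rightarrow> 'n skew" by (rule vector_space_fscale)
  have "finite {w :: 'n list. length w = d}"
    using finite_lists_length_eq [of "UNIV :: 'n set" d] by simp
  then show "finite (T d)" unfolding T_def by simp
  show "VV d \<subseteq> span (T d)"
  proof
    fix a :: "'n skew" assume "a \<in> VV d"
    then have a: "a \<in> AA" "\<And>g. tcomp d (a g) = a g"
      by (auto simp: VV_def scomp_def fun_eq_iff)
    have "gmon (a g) g \<in> span (T d)" if g: "g \<in> GG" for g
    proof -
      have "gmon (a g) g = gmon (\<Sum>w\<in>Poly_Mapping.keys (a g). wd (letters w) (Poly_Mapping.lookup (a g) w)) g"
        by (rule arg_cong [OF tensor_sum_wd])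
      also have "\<dots> = (\<Sum>w\<in>Poly_Mapping.keys (a g).
          fscale (Poly_Mapping.lookup (a g) w) (gmon (wd (letters w) 1) g))"
        unfolding gmon_sum by (rule sum.cong) (simp_all add: cscale_single)
      also have "\<dots> \<in> span (T d)"
      proof (intro span_sum span_scale span_base)
        fix w assume "w \<in> Poly_Mapping.keys (a g)"
        then have "length (letters w) = d"
          using a(2) [of g] lookup_tcomp [of d "a g" w] by (metis in_keys_iff)
        then show "gmon (wd (letters w) 1) g \<in> T d"
          unfolding T_def using g by (auto intro!: image_eqI [of _ _ "(letters w, g)"])
      qed
      finally show ?thesis .
    qed
    then have "(\<Sum>g\<in>GG. gmon (a g) g) \<in> span (T d)"
      by (intro span_sum)
    then show "a \<in> span (T d)"
      using AA_sum_gmon [OF a(1)] by simp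
  qed
qed

lemma SK_inj_VV:
  assumes "a \<in> VV d" "b \<in> VV d" "d \<le> 1" "SK a = SK b"
  shows "a = b"
proof -
  have "(a - b) g = 0" for g
  proof -
    have "(a - b) g \<in> Sq_ideal qs" using assms(4) unfolding SK_eq by blast
    then have "tcomp d ((a - b) g) = 0" using assms(3) by (rule Sq_tcomp_low)
    moreover have "tcomp d ((a - b) g) = (a - b) g"
      using VV_closed(3) [OF assms(1,2)] by (auto simp: VV_def scomp_def fun_eq_iff)
    ultimately show ?thesis by simp
  qed
  then show ?thesis by (auto simp: fun_eq_iff)
qed

context dha
begin

text \<open>\<open>SK\<close> is injective in degrees 0 and 1, so any graded isomorphism
  \<open>h\<close> induces a linear map \<open>f\<close> on \<open>VV d\<close> with
  \<open>SK (f a) = h (GR a)\<close>. It is surjective because \<open>h\<close> maps onto the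
  component of degree \<open>d\<close>; hence it is injective, and so is \<open>GR\<close>
  there.\<close>

lemma GR_inj_VV:
  assumes DH: "is_quantum_DH qs \<kappa>" and d: "d \<le> 1" and a: "a \<in> VV d" "GR a = GR 0"
  shows "a = 0"
proof -
  obtain h where h: "h \<in> ring_iso gr (SQ :: (complex, complex ^ 'n ^ 'n \<Rightarrow> 'n tensor set) module)"
    and hs: "\<forall>c. \<forall>x\<in>carrier gr. h (c \<odot>\<^bsub>gr\<^esub> x) = c \<odot>\<^bsub>SQ\<^esub> h x"
    and hd: "\<forall>d. h ` assoc_graded_deg Q HF d = Sq_skew_deg qs d"
    using DH unfolding is_quantum_DH_iff graded_alg_isomorphic_def by blast
  have hd': "h ` GR ` VV d = SK ` VV d"
    using hd unfolding gr_deg SQ_deg VV_def by blast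
  have hom: "h \<in> ring_hom gr SQ" using h by (simp add: ring_iso_def)
  have GRc: "GR a \<in> carrier gr" if "a \<in> AA" for a using that by (simp add: carrier_gr)
  have h_add: "h (GR (a + b)) = h (GR a) \<oplus>\<^bsub>SQ\<^esub> h (GR b)" if "a \<in> AA" "b \<in> AA" for a b
    using ring_hom_add [OF hom GRc [OF that(1)] GRc [OF that(2)]] GR_add [OF that] by simp
  have h_scale: "h (GR (fscale c a)) = c \<odot>\<^bsub>SQ\<^esub> h (GR a)" if "a \<in> AA" for a c
    using hs GRc [OF that] GR_scale [OF that] by metis
  define f where "f a = (SOME b. b \<in> VV d \<and> SK b = h (GR a))" for a
  have f: "f a \<in> VV d" "SK (f a) = h (GR a)" if "a \<in> VV d" for a
  proof -
    have "h (GR a) \<in> SK ` VV d" using that hd' by blast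
    then have "\<exists>b. b \<in> VV d \<and> SK b = h (GR a)" by force
    then have "f a \<in> VV d \<and> SK (f a) = h (GR a)"
      unfolding f_def by (rule someI_ex)
    then show "f a \<in> VV d" "SK (f a) = h (GR a)" by auto
  qed
  have f_eq: "f a = b" if "a \<in> VV d" "b \<in> VV d" "SK b = h (GR a)" for a b
    using SK_inj_VV [OF f(1) [OF that(1)] that(2) d] f(2) [OF that(1)] that(3) by simp
  have VA: "a \<in> AA" if "a \<in> VV d" for a using that by (simp add: VV_def)
  interpret vector_space "fscale :: complex \<Rightarrow> 'n skew \<Rightarrow> 'n skew" by (rule vector_space_fscale)
  show ?thesis
  proof (rule linear_surj_imp_inj_on_finite_dim [OF _ VV_span])
    show "subspace (VV d)"
      unfolding subspace_def by (auto intro: VV_closed)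
    show "f (a + b) = f a + f b" if "a \<in> VV d" "b \<in> VV d" for a b
      by (rule f_eq) (use that in \<open>auto intro!: VV_closed f simp: h_add VA f(2) [symmetric] SK_add\<close>)
    show "f (fscale c a) = fscale c (f a)" if "a \<in> VV d" for a c
      by (rule f_eq) (use that in \<open>auto intro!: VV_closed f simp: h_scale VA f(2) [symmetric] SK_scale\<close>)
    show "VV d \<subseteq> f ` VV d"
    proof
      fix b :: "'n skew" assume b: "b \<in> VV d"
      then have "SK b \<in> h ` GR ` VV d" using hd' by blast
      then obtain a where "a \<in> VV d" "SK b = h (GR a)" by blast
      then show "b \<in> f ` VV d" using f_eq b by blast
    qed
    show "a \<in> VV d" by (rule a)
    show "f a = 0"
    proof (rule f_eq [OF a(1) VV_closed(1)])
      have "h (GR 0) \<in> carrier (SQ :: (complex, complex ^ 'n ^ 'n \<Rightarrow> 'n tensor set) module)"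
        using ring_hom_closed [OF hom GRc [of 0]] by simp
      then obtain c :: "'n skew" where c: "h (GR 0) = SK c" unfolding carrier_SQ by blast
      \<comment> \<open>\<open>h\<close> maps zero to zero because it commutes with multiplication
        by the scalar 0.\<close>
      have z: "fscale 0 b = 0" for b :: "'n skew" by (auto simp: fscale_def)
      have "h (GR 0) = 0 \<odot>\<^bsub>SQ\<^esub> h (GR 0)"
        using h_scale [of 0 0] z [of 0] by simp
      also have "\<dots> = SK 0"
        unfolding c SK_scale z ..
      finally show "SK 0 = h (GR a)" using a(2) by simp
    qed
  qed
qed

text \<open>Modulo terms of degree 0 an element of \<open>I\<close> of degree at most 1 is its
  linear component, whose class is therefore zero; \<open>GR_inj_VV\<close> removes it. The same
  argument then removes the constant component.\<close>

lemma I_slow_2: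
  assumes DH: "is_quantum_DH qs \<kappa>" and x: "x \<in> I" "x \<in> slow 2"
  shows "x = 0"
proof -
  have xA: "x \<in> AA" using x by (simp add: slow_AA)
  have dec: "x = scomp 0 x + scomp 1 x"
    using slow_sum_scomp [OF x(2)] by (simp add: numeral_2_eq_2)
  have "scomp 1 x \<in> low 1"
  proof -
    have "x - scomp 0 x \<in> low 1"
      using xA x(1) by (intro low_closed) auto
    moreover have "x - scomp 0 x = scomp 1 x"
      using dec by (metis add_diff_cancel_left')
    ultimately show ?thesis by simp
  qed
  then have "GR (scomp 1 x) = GR 0"
    using xA by (subst GR_eq) (auto simp: low_closed)
  then have 1: "scomp 1 x = 0"
    using xA by (intro GR_inj_VV [OF DH, of 1]) (auto simp: VV_def)
  then have 0: "x = scomp 0 x" using dec by simp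
  have "scomp 0 x \<in> low 0" using 0 x(1) low_closed(6) by metis
  then have "GR (scomp 0 x) = GR 0"
    using xA by (subst GR_eq) (auto simp: low_closed)
  then have "scomp 0 x = 0"
    using xA by (intro GR_inj_VV [OF DH, of 0]) (auto simp: VV_def)
  then show ?thesis using 0 by metis
qed

lemma kel_slow: "kel i j \<in> slow 1"
  using kel_AA [of i j] by (simp add: slow_def) (simp add: kel_def scomp_def fun_eq_iff)

text \<open>Conjugating the relation for \<open>i\<close>, \<open>j\<close> by \<open>h\<close>
  gives, up to sign, the quadratic part of the relation for their images. The quadratic parts cancel
  in a difference that lies in \<open>I\<close>, and \<open>I_slow_2\<close> kills what remains in
  the group algebra.\<close>

lemma necessary_invariant:
  assumes DH: "is_quantum_DH qs \<kappa>"
  shows "invariant k"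
  unfolding invariant_def
proof (intro ballI allI impI)
  fix h g :: "complex ^ 'n ^ 'n" and i j :: 'n
  assume h: "h \<in> GG" and g: "g \<in> GG" and ij: "i \<noteq> j"
  let ?p = "mperm h" and ?c = "msign h i * msign h j"
  let ?X = "gmon 1 h \<star> kel i j \<star> gmon 1 (ginv h)"
  have h': "ginv h \<in> GG" "h ** ginv h = mat 1" using ginv_facts [OF h] by auto
  have act: "tensor_act h (qcomm qs i j) = cscale ?c (qcomm qs (?p i) (?p j))"
    using h by (simp add: qcomm_qs tensor_act_add tensor_act_wd mperm_inj mult_ac)
  have one: "gmon 1 h \<in> slow 1" "gmon 1 (ginv h) \<in> slow 1"
    using h h' by (auto simp: slow_def one_wd)
  have "?X \<in> slow (1 + 1 - 1 + 1 - 1)"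
    by (intro slow_mult one kel_slow)
  then have X2: "?X \<in> slow 2"
    by (rule slow_mono) simp
  have K2: "fscale ?c (kel (?p i) (?p j)) \<in> slow 2"
    by (intro slow_closed slow_mono [OF kel_slow]) simp
  have eq: "fscale ?c (kel (?p i) (?p j)) - ?X
      = gmon 1 h \<star> rel i j \<star> gmon 1 (ginv h) - fscale ?c (rel (?p i) (?p j))"
  proof -
    have "gmon 1 h \<star> rel i j \<star> gmon 1 (ginv h) = gmon (cscale ?c (qcomm qs (?p i) (?p j))) (mat 1) - ?X"
      unfolding rel_def smul_diff using h h' by (simp add: gmon_mult act del: gmon_simps)
    moreover have "fscale ?c (rel (?p i) (?p j))
        = gmon (cscale ?c (qcomm qs (?p i) (?p j))) (mat 1) - fscale ?c (kel (?p i) (?p j))"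
      by (auto simp: rel_def fscale_def fun_eq_iff gmon_def)
    ultimately show ?thesis by simp
  qed
  have "gmon 1 h \<star> rel i j \<star> gmon 1 (ginv h) - fscale ?c (rel (?p i) (?p j)) \<in> I"
    using h h' by (intro I_closed I_mult I_fscale rel_I) auto
  then have "fscale ?c (kel (?p i) (?p j)) - ?X = 0"
    by (intro I_slow_2 [OF DH _ slow_closed(3) [OF K2 X2]]) (unfold eq)
  then have "fscale ?c (kel (?p i) (?p j)) (h ** g ** ginv h) = ?X (h ** g ** ginv h)"
    by simp
  also have "?X (h ** g ** ginv h) = kel i j g"
  proof -
    have e: "h ** g ** ginv h ** ginv (ginv h) = h ** g" using ginv_cancel [OF h'(1)] by simp
    have "?X (h ** g ** ginv h) = (gmon 1 h \<star> kel i j) (h ** g) * tensor_act (h ** g) 1"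
      unfolding smul_gmon_right [OF AA_closed(2) h'(1)] e ..
    also have "\<dots> = kel i j g"
      using h g ginv_cancel [OF h] by (simp add: smul_gmon_left) (simp add: kel_def tensor_act_wd)
    finally show ?thesis .
  qed
  finally have "?c * k (?p i) (?p j) (h ** g ** ginv h) = k i j g"
    unfolding kel_def fscale_def cscale_single by (metis lookup_single_eq)
  then have "?c * k i j g = (msign h i * msign h i) * (msign h j * msign h j) * k (?p i) (?p j) (h ** g ** ginv h)"
    by (metis mult.assoc mult.commute)
  then show "k (?p i) (?p j) (h ** g ** ginv h) = ?c * k i j g"
    using msign_sq [OF h] by simp
qed

text \<open>\<open>C\<close>, \<open>D\<close> and \<open>E\<close> are the commutators of
  \<open>v x\<close> with \<kappa>(v_i, v_j), with the relation, and with the anticommutator of v_i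
  and v_j. The cyclic sum of \<open>E\<close> is zero already in T(V), so the cyclic sum of
  \<open>C\<close> lies in \<open>I\<close>; being of degree 1, it vanishes.\<close>

lemma necessary_jacobi:
  assumes DH: "is_quantum_DH qs \<kappa>"
  shows "jacobi k"
  unfolding jacobi_def
proof (intro ballI allI impI)
  fix g :: "complex ^ 'n ^ 'n" and a b c :: 'n and f :: "'n \<Rightarrow> complex"
  assume g: "g \<in> GG" and ne: "a \<noteq> b" "b \<noteq> c" "a \<noteq> c"
  define v where "v i = gmon (wd [i] 1) (mat 1)" for i :: 'n
  have v: "v i \<in> slow 2" "v i \<in> AA" for i by (auto simp: slow_def v_def)
  define C where "C x i j = v x \<star> kel i j - kel i j \<star> v x" for x i j
  have C: "C x i j \<in> slow 2" for x i j
    unfolding C_def using slow_mult [OF v(1) kel_slow] slow_mult [OF kel_slow v(1)]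
    by (intro slow_closed) (simp_all add: numeral_2_eq_2)
  define D where "D x i j = v x \<star> rel i j - rel i j \<star> v x" for x i j
  have D: "D x i j \<in> I" for x i j
    unfolding D_def by (intro I_closed I_mult rel_I v)
  define E where "E x i j = gmon (wd [x] 1 * qcomm qs i j - qcomm qs i j * wd [x] 1) (mat 1)" for x i j :: 'n
  have CDE: "C x i j = E x i j - D x i j" for x i j
  proof -
    have "v x \<star> gmon (qcomm qs i j) (mat 1) - gmon (qcomm qs i j) (mat 1) \<star> v x = E x i j"
      by (simp add: v_def gmon_mult E_def)
    then show ?thesis
      by (simp only: C_def D_def rel_def smul_diff) (simp add: algebra_simps)
  qed
  have "E a b c + E c a b + E b c a = 0"
  proof -
    have "(wd [a] 1 * qcomm qs b c - qcomm qs b c * wd [a] 1) + (wd [c] 1 * qcomm qs a b - qcomm qs a b * wd [c] 1)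
      + (wd [b] 1 * qcomm qs c a - qcomm qs c a * wd [b] 1) = 0"
      using ne by (simp add: qcomm_qs distrib_left distrib_right wd_mult)
    then show ?thesis
      unfolding E_def gmon_simps(1) [symmetric] by simp
  qed
  then have "C a b c + C c a b + C b c a = - (D a b c + D c a b + D b c a)"
    unfolding CDE by (simp add: algebra_simps)
  moreover have "- (D a b c + D c a b + D b c a) \<in> I"
    by (intro I_closed D)
  moreover have "C a b c + C c a b + C b c a \<in> slow 2"
    by (intro slow_closed C)
  ultimately have "C a b c + C c a b + C b c a = 0"
    by (intro I_slow_2 [OF DH]) simp_all
  then have "C a b c g + C c a b g + C b c a g = 0"
    by (metis plus_fun_apply zero_fun_apply)
  \<comment> \<open>Only one-letter words occur in \<open>C\<close>, so \<open>f \<circ> hd\<close>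
    acts as the functional \<open>f\<close> on V.\<close>
  then have "lin (f \<circ> hd) (C a b c g) + lin (f \<circ> hd) (C c a b g) + lin (f \<circ> hd) (C b c a g) = 0"
    by (metis lin_add lin_zero)
  moreover have "C x i j g = wd [x] (k i j g) - wd [mperm g x] (k i j g * msign g x)" for x i j
  proof -
    have "(v x \<star> kel i j) g = wd [x] (k i j g)"
      using g by (simp add: v_def smul_gmon_left) (simp add: kel_def wd_mult)
    moreover have "(kel i j \<star> v x) g = wd [mperm g x] (k i j g * msign g x)"
      using g by (simp add: v_def smul_gmon_right) (simp add: kel_def wd_mult tensor_act_wd)
    ultimately show ?thesis by (simp add: C_def)
  qed
  ultimately show "k b c g * (msign g a * f (mperm g a) - f a)
     + k c a g * (msign g b * f (mperm g b) - f b)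
     + k a b g * (msign g c * f (mperm g c) - f c) = 0"
    by (simp add: lin_diff algebra_simps)
qed

theorem quantum_DH_iff: "is_quantum_DH qs \<kappa> \<longleftrightarrow> invariant k \<and> jacobi k"
  using sufficient necessary_invariant necessary_jacobi by blast

end

section \<open>Invariant solutions of the Jacobi identity\<close>

definition moved :: "complex ^ 'n ^ 'n \<Rightarrow> 'n::finite set" where
  "moved g = {b. mperm g b \<noteq> b}"

text \<open>For \<open>m = 2, 3\<close> these are the conjugacy classes of the transpositions and of the \<open>3\<close>-cycles
  in \<open>G(2,1,n)\<close>.\<close>
definition cyc_class :: "nat \<Rightarrow> complex ^ 'n::finite ^ 'n \<Rightarrow> bool" where
  "cyc_class m g \<longleftrightarrow> g \<in> GG \<and> card (moved g) = m \<and> (\<forall>b. mperm g b = b \<longrightarrow> msign g b = 1)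
     \<and> (\<Prod>b\<in>UNIV. msign g b) = 1"

definition kk1 :: "'n::finite \<Rightarrow> 'n \<Rightarrow> complex ^ 'n ^ 'n \<Rightarrow> complex" where
  "kk1 i j g = (if i \<noteq> j \<and> cyc_class 2 g then g $ i $ j else 0)"

definition kk2 :: "'n::finite \<Rightarrow> 'n \<Rightarrow> complex ^ 'n ^ 'n \<Rightarrow> complex" where
  "kk2 i j g = (if i \<noteq> j \<and> cyc_class 3 g then g $ i $ j + g $ j $ i else 0)"

lemma prod_msign_moved:
  assumes "\<forall>b. mperm g b = b \<longrightarrow> msign g b = 1"
  shows "(\<Prod>b\<in>UNIV. msign g b) = (\<Prod>b\<in>moved g. msign g b)"
  by (rule prod.mono_neutral_right) (use assms in \<open>auto simp: moved_def\<close>)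

lemma moved_mperm: "g \<in> GG \<Longrightarrow> b \<in> moved g \<Longrightarrow> mperm g b \<in> moved g"
  by (auto simp: moved_def mperm_inj)

lemma cyc_class_2:
  assumes "cyc_class 2 g" "mperm g j = i" "i \<noteq> j"
  shows "moved g = {i, j}" "mperm g i = j" "msign g i * msign g j = 1"
proof -
  have g: "g \<in> GG" and c: "card (moved g) = 2" and f: "\<forall>b. mperm g b = b \<longrightarrow> msign g b = 1"
    and p: "(\<Prod>b\<in>UNIV. msign g b) = 1"
    using assms by (auto simp: cyc_class_def)
  have "j \<in> moved g" using assms by (auto simp: moved_def)
  moreover from this have "i \<in> moved g" using moved_mperm [OF g] assms by blast
  ultimately have "{i, j} \<subseteq> moved g" by blast
  moreover have "finite (moved g)" by simp
  ultimately show m: "moved g = {i, j}"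
    using c assms by (intro card_subset_eq [symmetric]) auto
  then show "mperm g i = j"
    using moved_mperm [OF g, of i] by (auto simp: moved_def)
  show "msign g i * msign g j = 1"
    using p assms unfolding prod_msign_moved [OF f] m by simp
qed

lemma cyc_class_3:
  assumes "cyc_class 3 g" "mperm g i = j" "i \<noteq> j"
  obtains t where "t \<noteq> i" "t \<noteq> j" "moved g = {i, j, t}" "mperm g j = t" "mperm g t = i"
    "msign g i * msign g j * msign g t = 1"
proof -
  have g: "g \<in> GG" and c: "card (moved g) = 3" and f: "\<forall>b. mperm g b = b \<longrightarrow> msign g b = 1"
    and p: "(\<Prod>b\<in>UNIV. msign g b) = 1"
    using assms by (auto simp: cyc_class_def)
  have i: "i \<in> moved g" using assms by (auto simp: moved_def)
  then have j: "j \<in> moved g" using moved_mperm [OF g] assms by blast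
  have "card (moved g - {i, j}) = 1"
    using i j c assms by (subst card_Diff_subset) auto
  then obtain t where "moved g - {i, j} = {t}" by (rule card_1_singletonE)
  then have t: "t \<noteq> i" "t \<noteq> j" and m: "moved g = {i, j, t}" using i j by auto
  have jt: "mperm g j \<noteq> j" "mperm g j \<in> {i, j, t}" "mperm g t \<noteq> t" "mperm g t \<in> {i, j, t}"
    using moved_mperm [OF g] m by (auto simp: moved_def)
  have "mperm g t \<noteq> j" "mperm g j \<noteq> mperm g t"
    using assms t mperm_inj [OF g] by metis+
  then have "mperm g t = i" "mperm g j = t" using jt by auto
  moreover have "msign g i * msign g j * msign g t = 1"
    using p assms t unfolding prod_msign_moved [OF f] m by (simp add: mult.assoc)
  ultimately show ?thesis using that t m by blast
qed

text \<open>The signs at \<open>i\<close> and \<open>j\<close> have product 1, so they are equal and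
  the two matrix entries agree.\<close>

lemma kk1_sym: "kk1 i j g = kk1 j i g"
proof -
  have "g $ i $ j = g $ j $ i" if "i \<noteq> j" "cyc_class 2 g" for i j
  proof -
    have g: "g \<in> GG" using that by (simp add: cyc_class_def)
    show ?thesis
    proof (cases "mperm g j = i")
      case True
      from cyc_class_2(2,3) [OF that(2) True that(1)] show ?thesis
        using msign_cases [OF g, of i] msign_cases [OF g, of j] True by (auto simp: GG_nth [OF g])
    next
      case False
      then have "mperm g i \<noteq> j"
        using cyc_class_2(2) [OF that(2), of i j] that(1) by metis
      with False show ?thesis by (auto simp: GG_nth [OF g])
    qed
  qed
  then show ?thesis by (simp add: kk1_def)
qed

lemma kk2_sym: "kk2 i j g = kk2 j i g"
  by (auto simp: kk2_def)

lemma conj_facts: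
  assumes h: "h \<in> GG" and g: "g \<in> GG"
  shows "mperm (h ** g ** ginv h) (mperm h b) = mperm h (mperm g b)"
    and "msign (h ** g ** ginv h) (mperm h b) = msign h (mperm g b) * msign g b * msign h b"
proof -
  let ?c = "h ** g ** ginv h"
  have c: "?c \<in> GG" "?c ** h = h ** g"
    using h g ginv_facts ginv_cancel by auto
  show "mperm ?c (mperm h b) = mperm h (mperm g b)"
    using mperm_mult [OF c(1) h] mperm_mult [OF h g] c(2) by (metis comp_apply)
  have "msign ?c (mperm h b) * msign h b = msign h (mperm g b) * msign g b"
    using msign_mult [OF c(1) h] msign_mult [OF h g] c(2) by metis
  then have "msign ?c (mperm h b) * (msign h b * msign h b) = msign h (mperm g b) * msign g b * msign h b"
    by (metis mult.assoc)
  then show "msign ?c (mperm h b) = msign h (mperm g b) * msign g b * msign h b"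
    using msign_sq [OF h] by simp
qed

lemma cyc_class_conj:
  assumes h: "h \<in> GG" and g: "g \<in> GG"
  shows "cyc_class m (h ** g ** ginv h) \<longleftrightarrow> cyc_class m g"
proof -
  let ?c = "h ** g ** ginv h"
  have c: "?c \<in> GG" using h g ginv_facts by auto
  have b: "bij (mperm h)" using bij_mperm [OF h] .
  have sur: "(\<forall>b. P b) \<longleftrightarrow> (\<forall>b. P (mperm h b))" for P
    using b by (metis bij_pointE)
  have "b \<in> moved ?c \<longleftrightarrow> b \<in> mperm h ` moved g" for b
  proof -
    obtain b' where "b = mperm h b'" using b by (metis bij_pointE)
    then show ?thesis
      using conj_facts [OF h g] mperm_inj [OF h] by (auto simp: moved_def)
  qed
  then have "moved ?c = mperm h ` moved g" by blast
  then have 1: "card (moved ?c) = card (moved g)"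
    using b by (metis bij_is_inj card_image inj_on_subset top_greatest)
  have 2: "(\<forall>b. mperm ?c b = b \<longrightarrow> msign ?c b = 1) \<longleftrightarrow> (\<forall>b. mperm g b = b \<longrightarrow> msign g b = 1)"
    unfolding sur [of "\<lambda>b. mperm ?c b = b \<longrightarrow> msign ?c b = 1"] conj_facts [OF h g]
    using msign_sq [OF h] by (auto simp: mperm_inj [OF h] mult_ac)
  \<comment> \<open>Every sign of \<open>h\<close> occurs twice, because \<open>g\<close> permutes
    the letters, and the squares are 1.\<close>
  have "(\<Prod>b\<in>UNIV. msign ?c b) = (\<Prod>b\<in>UNIV. msign ?c (mperm h b))"
    by (rule prod.reindex_bij_betw [OF b, symmetric])
  also have "\<dots> = (\<Prod>b\<in>UNIV. msign h (mperm g b)) * (\<Prod>b\<in>UNIV. msign g b) * (\<Prod>b\<in>UNIV. msign h b)"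
    unfolding conj_facts(2) [OF h g] by (simp add: prod.distrib)
  also have "(\<Prod>b\<in>UNIV. msign h (mperm g b)) = (\<Prod>b\<in>UNIV. msign h b)"
    by (rule prod.reindex_bij_betw [OF bij_mperm [OF g]])
  also have "(\<Prod>b\<in>UNIV. msign h b) * (\<Prod>b\<in>UNIV. msign g b) * (\<Prod>b\<in>UNIV. msign h b)
      = (\<Prod>b\<in>UNIV. msign h b * msign h b) * (\<Prod>b\<in>UNIV. msign g b)"
    by (simp add: prod.distrib)
  finally have 3: "(\<Prod>b\<in>UNIV. msign ?c b) = (\<Prod>b\<in>UNIV. msign g b)"
    by (simp add: msign_sq [OF h])
  show ?thesis unfolding cyc_class_def using 1 2 3 c g by simp
qed

lemma conj_nth:
  assumes h: "h \<in> GG" and g: "g \<in> GG"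
  shows "(h ** g ** ginv h) $ mperm h i $ mperm h j = msign h i * msign h j * g $ i $ j"
proof -
  have c: "h ** g ** ginv h \<in> GG" using h g ginv_facts by auto
  show ?thesis
    unfolding GG_nth [OF c] GG_nth [OF g] conj_facts [OF h g] by (auto simp: mperm_inj [OF h])
qed

section \<open>The two basic solutions\<close>

lemma invariant_kk1: "invariant kk1"
  unfolding invariant_def kk1_def by (simp add: cyc_class_conj conj_nth mperm_inj)

lemma invariant_kk2: "invariant kk2"
  unfolding invariant_def kk2_def
  by (simp add: cyc_class_conj conj_nth mperm_inj distrib_left mult_ac)

text \<open>Each summand vanishes by itself: if \<open>g\<close> swaps two of the letters, it fixes
  the third one with sign 1.\<close>

lemma jacobi_kk1: "jacobi (kk1 :: 'n::finite \<Rightarrow> _)"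
  unfolding jacobi_def
proof (intro ballI allI impI)
  fix g :: "complex ^ 'n ^ 'n" and a b c :: 'n and f :: "'n \<Rightarrow> complex"
  assume g: "g \<in> GG" and ne: "a \<noteq> b" "b \<noteq> c" "a \<noteq> c"
  have *: "kk1 i j g * (msign g t * f (mperm g t) - f t) = 0"
    if "i \<noteq> j" "t \<noteq> i" "t \<noteq> j" for i j t
  proof (cases "cyc_class 2 g \<and> mperm g j = i")
    case True
    then have "t \<notin> moved g" using cyc_class_2(1) [of g j i] that by blast
    then have "mperm g t = t" "msign g t = 1"
      using True by (auto simp: moved_def cyc_class_def)
    then show ?thesis by simp
  next
    case False
    then show ?thesis by (auto simp: kk1_def GG_nth [OF g])
  qed
  show "kk1 b c g * (msign g a * f (mperm g a) - f a) + kk1 c a g * (msign g b * f (mperm g b) - f b)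
     + kk1 a b g * (msign g c * f (mperm g c) - f c) = 0"
    by (simp only: * [OF ne(2) ne(1) ne(3)] * [OF ne(3) [symmetric] ne(2) ne(1) [symmetric]]
        * [OF ne(1) ne(3) [symmetric] ne(2) [symmetric]] add_0)
qed

text \<open>The Jacobi sum is symmetric in the three letters, so an arrow of \<open>g\<close>
  between two of them may be taken to be from \<open>a\<close> to \<open>b\<close>. If
  \<open>c\<close> completes the cycle, \<open>f b\<close> has the coefficient
  \<open>s_a s_b - s_c\<close>, with \<open>s\<close> for the signs, which is zero since
  \<open>s_a s_b s_c = 1\<close>; likewise for the others. Otherwise \<open>c\<close> is fixed with
  sign 1, and the remaining coefficients vanish.\<close>

lemma jacobi_kk2: "jacobi (kk2 :: 'n::finite \<Rightarrow> _)"
  unfolding jacobi_def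
proof (intro ballI allI impI)
  fix g :: "complex ^ 'n ^ 'n" and a b c :: 'n and f :: "'n \<Rightarrow> complex"
  assume g: "g \<in> GG" and ne: "a \<noteq> b" "b \<noteq> c" "a \<noteq> c"
  define J where "J a b c = kk2 b c g * (msign g a * f (mperm g a) - f a)
     + kk2 c a g * (msign g b * f (mperm g b) - f b)
     + kk2 a b g * (msign g c * f (mperm g c) - f c)" for a b c
  have rot: "J b c a = J a b c" "J b a c = J a b c" for a b c
    by (simp_all add: J_def kk2_sym [of c b] kk2_sym [of b a] kk2_sym [of a c])
  have cycle: "J a b c = 0" if C: "cyc_class 3 g" and ab: "mperm g a = b" and ne: "a \<noteq> b" "b \<noteq> c" "a \<noteq> c" for a b c
  proof -
    obtain t where t: "t \<noteq> a" "t \<noteq> b" "moved g = {a, b, t}" "mperm g b = t" "mperm g t = a"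
      "msign g a * msign g b * msign g t = 1"
      using cyc_class_3 [OF C ab ne(1)] .
    show ?thesis
    proof (cases "c = t")
      case True
      have k: "kk2 b c g = msign g b" "kk2 c a g = msign g c" "kk2 a b g = msign g a"
        using C ne t ab True by (auto simp: kk2_def GG_nth [OF g])
      have s: "msign g a * msign g b * msign g c = 1" using t True by simp
      show ?thesis
        unfolding J_def k ab t(4) t(5) True [symmetric]
        using s msign_cases [OF g, of a] msign_cases [OF g, of b] msign_cases [OF g, of c] t(4,5) True
        by auto
    next
      case False
      then have "c \<notin> moved g" using t ne by auto
      then have c: "mperm g c = c" "msign g c = 1"
        using C by (auto simp: moved_def cyc_class_def)
      then have "kk2 b c g = 0" "kk2 c a g = 0"
        using ne mperm_inj [OF g, of c a] mperm_inj [OF g, of c b] by (auto simp: kk2_def GG_nth [OF g])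
      then show ?thesis using c by (simp add: J_def)
    qed
  qed
  have "J a b c = 0"
  proof (cases "cyc_class 3 g")
    case False
    then show ?thesis by (simp add: J_def kk2_def)
  next
    case C: True
    consider "mperm g a = b" | "mperm g b = a" | "mperm g b = c" | "mperm g c = b" | "mperm g c = a" | "mperm g a = c"
      | "mperm g a \<noteq> b \<and> mperm g b \<noteq> a \<and> mperm g b \<noteq> c \<and> mperm g c \<noteq> b \<and> mperm g c \<noteq> a \<and> mperm g a \<noteq> c"
      by blast
    then show ?thesis
    proof cases
      case 1 then show ?thesis using cycle [OF C] ne by blast
    next
      case 2 then show ?thesis using cycle [OF C, of b a c] ne rot by metis
    next
      case 3 then show ?thesis using cycle [OF C, of b c a] ne rot by metis
    next
      case 4 then show ?thesis using cycle [OF C, of c b a] ne rot by metis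
    next
      case 5 then show ?thesis using cycle [OF C, of c a b] ne rot by metis
    next
      case 6 then show ?thesis using cycle [OF C, of a c b] ne rot by metis
    next
      case 7
      then have "kk2 b c g = 0" "kk2 c a g = 0" "kk2 a b g = 0"
        unfolding kk2_def GG_nth [OF g] by auto
      then show ?thesis by (simp add: J_def)
    qed
  qed
  then show "kk2 b c g * (msign g a * f (mperm g a) - f a) + kk2 c a g * (msign g b * f (mperm g b) - f b)
     + kk2 a b g * (msign g c * f (mperm g c) - f c) = 0"
    by (simp add: J_def)
qed

lemma invariant_comb:
  "invariant k \<Longrightarrow> invariant k' \<Longrightarrow> invariant (\<lambda>i j g. c * k i j g + c' * k' i j g)"
  unfolding invariant_def by (simp add: algebra_simps)

lemma jacobi_comb:
  assumes "jacobi k" "jacobi k'"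
  shows "jacobi (\<lambda>i j g. x * k i j g + y * k' i j g)"
  unfolding jacobi_def
proof (intro ballI allI impI)
  fix g :: "complex ^ 'a ^ 'a" and a b c :: 'a and f :: "'a \<Rightarrow> complex"
  assume g: "g \<in> GG" and ne: "a \<noteq> b" "b \<noteq> c" "a \<noteq> c"
  define A B C where "A = msign g a * f (mperm g a) - f a" and "B = msign g b * f (mperm g b) - f b"
    and "C = msign g c * f (mperm g c) - f c"
  have "k b c g * A + k c a g * B + k a b g * C = 0" "k' b c g * A + k' c a g * B + k' a b g * C = 0"
    using assms g ne unfolding jacobi_def A_def B_def C_def by blast+
  moreover have "(x * k b c g + y * k' b c g) * A + (x * k c a g + y * k' c a g) * B + (x * k a b g + y * k' a b g) * C
    = x * (k b c g * A + k c a g * B + k a b g * C) + y * (k' b c g * A + k' c a g * B + k' a b g * C)"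
    by (simp add: algebra_simps)
  ultimately show "(x * k b c g + y * k' b c g) * (msign g a * f (mperm g a) - f a)
     + (x * k c a g + y * k' c a g) * (msign g b * f (mperm g b) - f b)
     + (x * k a b g + y * k' a b g) * (msign g c * f (mperm g c) - f c) = 0"
    unfolding A_def [symmetric] B_def [symmetric] C_def [symmetric] by simp
qed

subsection \<open>Support\<close>

locale solution =
  fixes k :: "'n::finite \<Rightarrow> 'n \<Rightarrow> complex ^ 'n ^ 'n \<Rightarrow> complex"
  assumes inv: "invariant k" and jac: "jacobi k" and sym: "k i j g = k j i g"
begin

text \<open>Conjugate by the diagonal matrix with \<open>-1\<close> in the positions in \<open>D\<close>, which commutes with \<open>g\<close>.\<close>
lemma separated:
  assumes g: "g \<in> GG" and D: "\<And>b. mperm g b \<in> D \<longleftrightarrow> b \<in> D" and ij: "i \<in> D" "j \<notin> D"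
  shows "k i j g = 0"
proof -
  let ?s = "\<lambda>b. if b \<in> D then - 1 else 1 :: complex"
  let ?h = "smat id ?s :: complex ^ 'n ^ 'n"
  have h: "?h \<in> GG" by (rule smat_in_GG) auto
  have p: "mperm ?h = id" by (rule mperm_smat') auto
  have "?h ** g = g ** ?h"
    by (rule GG_eqI) (use g h D in \<open>auto simp: mperm_mult msign_mult p\<close>)
  then have "?h ** g ** ginv ?h = g"
    using ginv_cancel [OF h] by simp
  moreover have "i \<noteq> j" using ij by blast
  then have "k (mperm ?h i) (mperm ?h j) (?h ** g ** ginv ?h) = msign ?h i * msign ?h j * k i j g"
    using inv h g unfolding invariant_def by blast
  ultimately show ?thesis using ij by (simp add: p)
qed

text \<open>The coefficient of the basis vector with index \<open>x\<close> in the Jacobi identity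
  for the letters \<open>t\<close>, \<open>i\<close>, \<open>j\<close>.\<close>

lemma jac_delta:
  assumes "g \<in> GG" "t \<noteq> i" "t \<noteq> j" "i \<noteq> j"
  shows "k i j g * (msign g t * of_bool (mperm g t = x) - of_bool (t = x))
    + k j t g * (msign g i * of_bool (mperm g i = x) - of_bool (i = x))
    + k t i g * (msign g j * of_bool (mperm g j = x) - of_bool (j = x)) = 0"
  using jac [unfolded jacobi_def, rule_format, OF assms(1,2,4,3), of "\<lambda>y. of_bool (y = x)"] .

text \<open>If \<open>g\<close> fixes \<open>i\<close> up to sign, the stable set \<open>{i}\<close>
  separates \<open>i\<close> from \<open>j\<close>.\<close>

lemma nonzero_moved:
  assumes g: "g \<in> GG" and "i \<noteq> j" "k i j g \<noteq> 0"
  shows "mperm g i \<noteq> i" "mperm g j \<noteq> j"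
proof -
  have "k i j g = 0" if "i \<noteq> j" "mperm g i = i" for i j
  proof (rule separated [OF g, of "{i}"])
    show "mperm g b \<in> {i} \<longleftrightarrow> b \<in> {i}" for b
      using that mperm_inj [OF g] by (metis singleton_iff)
  qed (use that in auto)
  then show "mperm g i \<noteq> i" "mperm g j \<noteq> j"
    using assms sym by metis+
qed

text \<open>Use \<open>jac_delta\<close> with \<open>x = t\<close> for the first and third claims
  and with \<open>x = mperm g t\<close> for the second. In each case every term without the factor
  \<open>k i j g\<close> drops out.\<close>

lemma nonzero_third:
  assumes g: "g \<in> GG" and ij: "i \<noteq> j" "k i j g \<noteq> 0" and t: "t \<noteq> i" "t \<noteq> j"
  shows "mperm g t = t \<Longrightarrow> msign g t = 1"
    and "mperm g t \<noteq> t \<Longrightarrow> mperm g t = i \<or> mperm g t = j"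
    and "mperm g t \<noteq> t \<Longrightarrow> mperm g i = t \<or> mperm g j = t"
proof -
  assume "mperm g t = t"
  moreover from this have "k j t g = 0" "k t i g = 0"
    using nonzero_moved [OF g] t by metis+
  ultimately have "k i j g * (msign g t - 1) = 0"
    using jac_delta [OF g t ij(1), of t] by simp
  then show "msign g t = 1" using ij by simp
next
  assume mt: "mperm g t \<noteq> t"
  show "mperm g t = i \<or> mperm g t = j"
  proof (rule ccontr)
    assume "\<not> ?thesis"
    then have "k i j g * msign g t = 0"
      using jac_delta [OF g t ij(1), of "mperm g t"] mt t by (auto simp: mperm_inj [OF g])
    then show False using ij msign_nz [OF g] by simp
  qed
  show "mperm g i = t \<or> mperm g j = t"
  proof (rule ccontr)
    assume "\<not> ?thesis"
    then have "k i j g = 0"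
      using jac_delta [OF g t ij(1), of t] mt t by auto
    then show False using ij by simp
  qed
qed

text \<open>A \<open>4\<close>-cycle is excluded by applying the previous lemma to a second pair.\<close>
lemma nonzero_cycle:
  assumes g: "g \<in> GG" and ij: "i \<noteq> j" "k i j g \<noteq> 0" and it: "mperm g i = t" "t \<noteq> j"
  shows "mperm g t = j" "mperm g j = i" "moved g = {i, j, t}" "msign g i * msign g j * msign g t = 1"
proof -
  note mv = nonzero_moved [OF g ij]
  have t: "t \<noteq> i" "t \<noteq> j" using it mv by auto
  have tt: "mperm g t \<noteq> t" using it t mperm_inj [OF g] by metis
  have "mperm g t \<noteq> i"
  proof
    assume "mperm g t = i"
    then have "mperm g b \<in> {i, t} \<longleftrightarrow> b \<in> {i, t}" for b
      using it mperm_inj [OF g] by (metis insert_iff singletonD)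
    then have "k i j g = 0"
      by (intro separated [OF g, of "{i, t}"]) (use ij t in auto)
    then show False using ij by simp
  qed
  then show tj: "mperm g t = j"
    using nonzero_third(2) [OF g ij t tt] by blast
  \<comment> \<open>In the coefficient of index \<open>t\<close>, only \<open>t\<close> itself and
    the image of \<open>i\<close> contribute.\<close>
  have eq: "k i j g = msign g i * k j t g"
    using jac_delta [OF g t ij(1), of t] tt t it tj mperm_inj [OF g, of i j] ij by (auto simp: mult.commute)
  then have jt: "k j t g \<noteq> 0" using ij by auto
  \<comment> \<open>The moved letter \<open>i\<close> is third for the pair \<open>j\<close>,
    \<open>t\<close>, so it is the image of one of them, and \<open>t\<close> goes to
    \<open>j\<close>.\<close>
  show ji: "mperm g j = i"
  proof (rule ccontr)
    assume "mperm g j \<noteq> i"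
    then have "mperm g i = i"
      using nonzero_third(3) [OF g _ jt, of i] t ij tj by metis
    then show False using mv by simp
  qed
  show "moved g = {i, j, t}"
  proof (intro equalityI subsetI)
    fix b assume b: "b \<in> moved g"
    show "b \<in> {i, j, t}"
    proof (rule ccontr)
      assume "b \<notin> {i, j, t}"
      then have "mperm g i = b \<or> mperm g j = b"
        using nonzero_third(3) [OF g ij, of b] b by (auto simp: moved_def)
      then show False using it ji \<open>b \<notin> {i, j, t}\<close> by auto
    qed
  qed (use mv tt in \<open>auto simp: moved_def\<close>)
  \<comment> \<open>Conjugation by \<open>g\<close> fixes \<open>g\<close> and carries a pair of
    letters along the cycle; two such steps lead from \<open>i\<close>, \<open>j\<close> to
    \<open>t\<close>, \<open>j\<close> and back to the equation \<open>eq\<close>.\<close>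
  have rot: "k (mperm g a) (mperm g b) g = msign g a * msign g b * k a b g" if "a \<noteq> b" for a b
  proof -
    have "g ** g ** ginv g = g" using ginv_cancel [OF g] by simp
    then show ?thesis using inv g that unfolding invariant_def by metis
  qed
  have "k j t g = msign g t * msign g i * (msign g i * msign g j * k i j g)"
    using rot [of t i] rot [of i j] t ij it tj ji by simp
  then have "k i j g = (msign g i * msign g i) * (msign g i * msign g j * msign g t) * k i j g"
    using eq by (metis mult.assoc mult.commute)
  then have "(msign g i * msign g j * msign g t) * k i j g = 1 * k i j g"
    using msign_sq [OF g] by simp
  then show "msign g i * msign g j * msign g t = 1"
    using ij(2) by (simp only: mult_cancel_right) simp
qed

text \<open>By \<open>nonzero_third\<close> any other moved letter would be the image of
  \<open>i\<close> or \<open>j\<close>. The sign comes from conjugating by \<open>g\<close> itself,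
  which swaps \<open>i\<close> and \<open>j\<close> and leaves \<open>g\<close> unchanged.\<close>

lemma nonzero_swap:
  assumes g: "g \<in> GG" and ij: "i \<noteq> j" "k i j g \<noteq> 0" and it: "mperm g i = j" "mperm g j = i"
  shows "moved g = {i, j}" "msign g i * msign g j = 1"
proof -
  show "moved g = {i, j}"
  proof (intro equalityI subsetI)
    fix b assume b: "b \<in> moved g"
    show "b \<in> {i, j}"
    proof (rule ccontr)
      assume "b \<notin> {i, j}"
      then have "mperm g i = b \<or> mperm g j = b"
        using nonzero_third(3) [OF g ij, of b] b by (auto simp: moved_def)
      then show False using it \<open>b \<notin> {i, j}\<close> by auto
    qed
  qed (use it ij in \<open>auto simp: moved_def\<close>)
  have "g ** g ** ginv g = g" using ginv_cancel [OF g] by simp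
  then have "k j i g = msign g i * msign g j * k i j g"
    using inv g ij it unfolding invariant_def by metis
  then show "msign g i * msign g j = 1"
    using ij sym [of i j g] by simp
qed

text \<open>The assumptions \<open>p\<close> and \<open>e\<close> say, column by column, that
  \<open>h = smat \<pi> s\<close> satisfies \<open>h g0 = g h\<close>. So \<open>g\<close> is a
  conjugate of \<open>g0\<close>, and invariance transfers the zero.\<close>

lemma zero_by_conj:
  assumes g: "g \<in> GG" and g0: "g0 \<in> GG" and \<pi>: "bij \<pi>" and s: "\<And>b. s b = 1 \<or> s b = (- 1 :: complex)"
    and p: "\<And>b. \<pi> (mperm g0 b) = mperm g (\<pi> b)"
    and e: "\<And>b. s (mperm g0 b) * msign g0 b = msign g (\<pi> b) * s b"
    and "x \<noteq> y" "k x y g0 = 0"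
  shows "k (\<pi> x) (\<pi> y) g = 0"
proof -
  let ?h = "smat \<pi> s"
  have h: "?h \<in> GG" by (rule smat_in_GG) (use \<pi> s in auto)
  have ph: "mperm ?h = \<pi>" by (rule mperm_smat') (use s in auto)
  have "?h ** g0 = g ** ?h"
    by (rule GG_eqI) (use h g g0 p e in \<open>auto simp: mperm_mult msign_mult ph fun_eq_iff\<close>)
  then have "?h ** g0 ** ginv ?h = g"
    using ginv_cancel [OF h] by simp
  moreover have "k (mperm ?h x) (mperm ?h y) (?h ** g0 ** ginv ?h) = msign ?h x * msign ?h y * k x y g0"
    using inv h g0 \<open>x \<noteq> y\<close> unfolding invariant_def by blast
  ultimately show ?thesis using assms by (simp add: ph)
qed

end

section \<open>Reduction to one transposition and one 3-cycle\<close>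

lemma extend_bij:
  assumes "bij_betw f A B"
  obtains \<pi> :: "'n::finite \<Rightarrow> 'n" where "bij \<pi>" "\<And>a. a \<in> A \<Longrightarrow> \<pi> a = f a"
proof -
  have "card (UNIV - A) = card (UNIV - B)"
    using bij_betw_same_card [OF assms] by (simp add: card_Diff_subset)
  then obtain h where h: "bij_betw h (UNIV - A) (UNIV - B)"
    using finite_same_card_bij [of "UNIV - A" "UNIV - B"] by auto
  let ?p = "\<lambda>a. if a \<in> A then f a else h a"
  have "bij_betw ?p (A \<union> (UNIV - A)) (B \<union> (UNIV - B))"
  proof (rule bij_betw_combine)
    show "bij_betw ?p A B" using assms by (simp cong: bij_betw_cong)
    show "bij_betw ?p (UNIV - A) (UNIV - B)"
      using h by (subst bij_betw_cong [of _ _ h]) auto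
  qed auto
  then show ?thesis by (intro that [of ?p]) auto
qed

lemma perm_mat_smat: "perm_mat \<sigma> = smat \<sigma> (\<lambda>_. 1)"
  by (simp add: perm_mat_def smat_def)

lemma bij_cycle: "bij (cycle_of_list l)"
  using cycle_permutes [of l] permutes_bij by blast

lemma
  shows perm_mat_cyc [simp, intro]: "cyc l \<in> GG"
    and mperm_cyc [simp]: "mperm (cyc l) = cycle_of_list l"
    and msign_cyc [simp]: "msign (cyc l) = (\<lambda>_. 1)"
  unfolding perm_mat_smat by (auto intro!: smat_in_GG bij_cycle mperm_smat')

lemma cycle_2:
  "i \<noteq> j \<Longrightarrow> cycle_of_list [i, j] b = (if b = i then j else if b = j then i else b)"
  by (simp add: transpose_def)

lemma cycle_3:
  "i \<noteq> j \<Longrightarrow> j \<noteq> k \<Longrightarrow> i \<noteq> k \<Longrightarrow>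
    cycle_of_list [i, j, k] b = (if b = i then j else if b = j then k else if b = k then i else b)"
  by (simp add: transpose_def)

declare cycle_of_list.simps [simp del]

context solution
begin

lemma no_swap:
  assumes xy: "x \<noteq> y" "k x y (cyc [x, y]) = 0"
    and g: "g \<in> GG" and ij: "i \<noteq> j" and sw: "mperm g i = j" "mperm g j = i"
  shows "k i j g = 0"
proof (rule ccontr)
  assume nz: "k i j g \<noteq> 0"
  note sw' = nonzero_swap [OF g ij nz sw]
  have "bij_betw (\<lambda>b. if b = x then i else j) {x, y} {i, j}"
    using xy ij by (auto simp: bij_betw_def inj_on_def)
  then obtain \<pi> where \<pi>: "bij \<pi>" "\<And>a. a \<in> {x, y} \<Longrightarrow> \<pi> a = (if a = x then i else j)"
    by (rule extend_bij) blast
  then have \<pi>v: "\<pi> x = i" "\<pi> y = j" using xy by auto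
  have fixed: "mperm g (\<pi> b) = \<pi> b" "msign g (\<pi> b) = 1" if "b \<noteq> x" "b \<noteq> y" for b
  proof -
    have ne: "\<pi> b \<noteq> i" "\<pi> b \<noteq> j"
      using that \<pi>v bij_is_inj [OF \<pi>(1)] by (metis injD)+
    then show f: "mperm g (\<pi> b) = \<pi> b"
      using sw'(1) by (auto simp: moved_def)
    show "msign g (\<pi> b) = 1"
      by (rule nonzero_third(1) [OF g ij nz ne f])
  qed
  \<comment> \<open>The sign of the conjugating matrix is 1 at \<open>x\<close>; the step from
    \<open>x\<close> to \<open>y\<close> forces \<open>msign g i\<close> at \<open>y\<close>, and
    the step back is consistent because the two signs of \<open>g\<close> have product 1.\<close>
  have "k (\<pi> x) (\<pi> y) g = 0"
  proof (rule zero_by_conj [OF g perm_mat_cyc [of "[x, y]"] \<pi>(1), where s = "\<lambda>b. if b = y then msign g i else 1"])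
    show "(if b = y then msign g i else 1) = 1 \<or> (if b = y then msign g i else 1) = (- 1 :: complex)" for b
      using msign_cases [OF g, of i] by simp
    show "\<pi> (mperm (cyc [x, y]) b) = mperm g (\<pi> b)" for b
      using \<pi>v sw fixed by (auto simp: cycle_2 [OF xy(1)])
    show "(if mperm (cyc [x, y]) b = y then msign g i else 1) * msign (cyc [x, y]) b
        = msign g (\<pi> b) * (if b = y then msign g i else 1)" for b
      using \<pi>v fixed sw'(2) xy by (auto simp: cycle_2 [OF xy(1)] mult.commute)
  qed (use xy in auto)
  then show False using nz \<pi>v by simp
qed

lemma no_cycle:
  assumes xyz: "x \<noteq> y" "y \<noteq> z" "x \<noteq> z" "k x y (cyc [x, y, z]) = 0"
    and g: "g \<in> GG" and ij: "i \<noteq> j" and ne: "mperm g i \<noteq> j"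
  shows "k i j g = 0"
proof (rule ccontr)
  assume nz: "k i j g \<noteq> 0"
  define t where "t = mperm g i"
  have it: "mperm g i = t" "t \<noteq> j" using ne by (auto simp: t_def)
  note cy = nonzero_cycle [OF g ij nz it]
  have t: "t \<noteq> i" "t \<noteq> j" using nonzero_moved [OF g ij nz] it by auto
  \<comment> \<open>The cycle of \<open>g\<close> runs from \<open>j\<close> to \<open>i\<close> to
    \<open>t\<close>, so \<open>x\<close> corresponds to \<open>j\<close> and \<open>y\<close> to
    \<open>i\<close>. The resulting pair is reversed, which symmetry of \<open>k\<close> repairs at
    the end.\<close>
  have "bij_betw (\<lambda>b. if b = x then j else if b = y then i else t) {x, y, z} {i, j, t}"
    using xyz ij t by (auto simp: bij_betw_def inj_on_def)
  then obtain \<pi> where \<pi>: "bij \<pi>" "\<And>a. a \<in> {x, y, z} \<Longrightarrow> \<pi> a = (if a = x then j else if a = y then i else t)"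
    by (rule extend_bij) blast
  then have \<pi>v: "\<pi> x = j" "\<pi> y = i" "\<pi> z = t" using xyz by auto
  have fixed: "mperm g (\<pi> b) = \<pi> b" "msign g (\<pi> b) = 1" if "b \<noteq> x" "b \<noteq> y" "b \<noteq> z" for b
  proof -
    have ne: "\<pi> b \<noteq> i" "\<pi> b \<noteq> j" "\<pi> b \<noteq> t"
      using that \<pi>v bij_is_inj [OF \<pi>(1)] by (metis injD)+
    then show f: "mperm g (\<pi> b) = \<pi> b"
      using cy(3) by (auto simp: moved_def)
    show "msign g (\<pi> b) = 1"
      by (rule nonzero_third(1) [OF g ij nz ne(1,2) f])
  qed
  \<comment> \<open>Starting with 1 at \<open>x\<close>, each step along the cycle multiplies by the
    sign of \<open>g\<close>; the cycle closes since all three signs have product 1.\<close>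
  let ?s = "\<lambda>b. if b = y then msign g j else if b = z then msign g j * msign g i else 1"
  have "k (\<pi> x) (\<pi> y) g = 0"
  proof (rule zero_by_conj [OF g perm_mat_cyc [of "[x, y, z]"] \<pi>(1), where s = ?s])
    show "?s b = 1 \<or> ?s b = (- 1 :: complex)" for b
      using msign_cases [OF g, of i] msign_cases [OF g, of j] by auto
    show "\<pi> (mperm (cyc [x, y, z]) b) = mperm g (\<pi> b)" for b
      using \<pi>v it cy fixed by (auto simp: cycle_3 [OF xyz(1-3)])
    show "?s (mperm (cyc [x, y, z]) b) * msign (cyc [x, y, z]) b = msign g (\<pi> b) * ?s b" for b
      using \<pi>v fixed cy(4) xyz by (auto simp: cycle_3 [OF xyz(1-3)] mult_ac)
  qed (use xyz in auto)
  then show False using nz \<pi>v sym by simp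
qed

text \<open>Unless \<open>g\<close> swaps \<open>i\<close> and \<open>j\<close>, one of the ordered
  pairs \<open>i, j\<close> and \<open>j, i\<close> is not an arrow of \<open>g\<close>, and
  \<open>no_cycle\<close> applies to it.\<close>

lemma vanish:
  assumes "x \<noteq> y" "y \<noteq> z" "x \<noteq> z" "k x y (cyc [x, y]) = 0" "k x y (cyc [x, y, z]) = 0"
    and "g \<in> GG" "i \<noteq> j"
  shows "k i j g = 0"
proof (cases "mperm g i = j \<and> mperm g j = i")
  case True
  then show ?thesis using no_swap assms by blast
next
  case False
  then show ?thesis
    using no_cycle [OF assms(1,2,3,5,6), of i j] no_cycle [OF assms(1,2,3,5,6), of j i] assms(7) sym
    by metis
qed

end

text \<open>The coefficients at (x y) and (x y z) are coordinates dual to \<open>kk1\<close> and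
  \<open>kk2\<close>. They give both the scalars in the classification and the linear
  independence.\<close>

lemma kk_values:
  fixes x y z :: "'n::finite"
  assumes "x \<noteq> y" "y \<noteq> z" "x \<noteq> z"
  shows "kk1 x y (cyc [x, y]) = 1" "kk2 x y (cyc [x, y]) = 0"
    and "kk1 x y (cyc [x, y, z]) = 0" "kk2 x y (cyc [x, y, z]) = 1"
proof -
  have m2: "moved (cyc [x, y]) = {x, y}"
    using assms by (auto simp: moved_def cycle_2)
  have m3: "moved (cyc [x, y, z]) = {x, y, z}"
    using assms by (auto simp: moved_def cycle_3)
  have c: "cyc_class 2 (cyc [x, y])" "\<not> cyc_class 3 (cyc [x, y])"
    "cyc_class 3 (cyc [x, y, z])" "\<not> cyc_class 2 (cyc [x, y, z])"
    unfolding cyc_class_def m2 m3 using assms by simp_all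
  show "kk1 x y (cyc [x, y]) = 1" "kk2 x y (cyc [x, y]) = 0"
    "kk1 x y (cyc [x, y, z]) = 0" "kk2 x y (cyc [x, y, z]) = 1"
    using c assms by (simp_all add: kk1_def kk2_def GG_nth [OF perm_mat_cyc] cycle_2 cycle_3)
qed

lemma (in solution) classification:
  assumes xyz: "x \<noteq> y" "y \<noteq> z" "x \<noteq> z" and g: "g \<in> GG" and ij: "i \<noteq> j"
  shows "k i j g = k x y (cyc [x, y]) * kk1 i j g + k x y (cyc [x, y, z]) * kk2 i j g"
proof -
  let ?c1 = "k x y (cyc [x, y])" and ?c2 = "k x y (cyc [x, y, z])"
  \<comment> \<open>The difference from the candidate is a solution with both test coefficients
    zero. The factors 1 and -1 bring it into the shape of \<open>invariant_comb\<close> and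
    \<open>jacobi_comb\<close>.\<close>
  let ?d = "\<lambda>i j g. 1 * k i j g + (- 1) * (?c1 * kk1 i j g + ?c2 * kk2 i j g)"
  interpret d: solution ?d
  proof
    show "invariant ?d"
      by (intro invariant_comb inv invariant_kk1 invariant_kk2)
    show "jacobi ?d"
      by (intro jacobi_comb jac jacobi_kk1 jacobi_kk2)
    show "?d i j g = ?d j i g" for i j g
      by (simp add: sym [of i j] kk1_sym [of i j] kk2_sym [of i j])
  qed
  have "?d i j g = 0"
    by (rule d.vanish [OF xyz _ _ g ij]) (simp_all add: kk_values [OF xyz])
  then show ?thesis
    by (simp only: mult_1 mult_minus1 add_uminus_conv_diff right_minus_eq)
qed

section \<open>The maps \<open>\<kappa>\<^sub>1\<close> and \<open>\<kappa>\<^sub>2\<close>\<close>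

lemma bas_nth: "bas i $ a = of_bool (a = i)"
  by (simp add: axis_def)

lemma kmap_of_bas: "kmap_of f (bas i) (bas j) = (if i = j then 0 else f i j)"
proof -
  have inner: "(\<Sum>b\<in>UNIV - {a}. cscale (bas i $ a * bas j $ b) (f a b))
      = (if a = i then if i = j then 0 else f i j else 0)" for a
  proof -
    have "(\<Sum>b\<in>UNIV - {a}. cscale (bas i $ a * bas j $ b) (f a b))
        = (\<Sum>b\<in>UNIV - {a}. if b = j then if a = i then f i j else 0 else 0)"
      by (rule sum.cong) (auto simp: bas_nth)
    then show ?thesis by auto
  qed
  show ?thesis unfolding kmap_of_def inner by simp
qed

text \<open>The sign matrix acts after the cycle, so the sign in column \<open>b\<close> is decided
  by the image of \<open>b\<close>.\<close>

lemma zeta_zeta_cyc: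
  "i \<noteq> j \<Longrightarrow> zeta i ** zeta j ** cyc l
    = smat (cycle_of_list l) (\<lambda>b. if cycle_of_list l b \<in> {i, j} then - 1 else 1)"
proof -
  assume "i \<noteq> j"
  then have "zeta i ** zeta j = sign_mat {i, j}"
    using sign_mat_insert [of i "{j}"] sign_mat_insert [of j "{}"] by (simp add: sign_mat_empty)
  then show ?thesis using sign_perm_smat [OF bij_cycle] by metis
qed

section \<open>Coefficients of the two given maps\<close>

lemma lookup_gel: "Poly_Mapping.lookup (gel a) g = of_bool (a = g)"
  by (simp add: lookup_single when_def)

text \<open>Exactly two elements of the class swap \<open>i\<close> and \<open>j\<close>: their
  signs on \<open>{i, j}\<close> are both 1 or both -1. These are the two terms, and the entry
  \<open>g $ i $ j = msign g j\<close> is the coefficient of each.\<close>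

lemma kcoef_kappa1:
  assumes ij: "i \<noteq> j"
  shows "Poly_Mapping.lookup (gel (cyc [i, j]) - gel (zeta i ** zeta j ** cyc [i, j])) g = kk1 i j g"
proof -
  let ?\<sigma> = "cycle_of_list [i, j]" and ?s = "\<lambda>b. if cycle_of_list [i, j] b \<in> {i, j} then - 1 else 1 :: complex"
  let ?A = "cyc [i, j]"
  define B where "B = smat ?\<sigma> ?s"
  have s: "?s b = 1 \<or> ?s b = -1" for b by simp
  have B: "B \<in> GG" "mperm B = ?\<sigma>" "msign B = ?s"
    unfolding B_def using smat_in_GG [OF bij_cycle s] mperm_smat' [OF s] by simp_all
  have mA: "moved ?A = {i, j}" "moved B = {i, j}"
    using ij by (auto simp: moved_def B(2) cycle_2 [OF ij])
  have "Poly_Mapping.lookup (gel ?A - gel (zeta i ** zeta j ** cyc [i, j])) g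
      = of_bool (?A = g) - of_bool (B = g)"
    unfolding zeta_zeta_cyc [OF ij] lookup_minus lookup_gel B_def ..
  also have "\<dots> = kk1 i j g"
  proof (cases "cyc_class 2 g \<and> mperm g j = i")
    case True
    then have g: "g \<in> GG" by (simp add: cyc_class_def)
    from True have st: "moved g = {i, j}" "mperm g i = j" "mperm g j = i" "msign g i * msign g j = 1"
      using cyc_class_2 [OF _ _ ij] by auto
    have f: "mperm g b = b" "msign g b = 1" if "b \<noteq> i" "b \<noteq> j" for b
      using st(1) that True by (auto simp: moved_def cyc_class_def)
    have p: "mperm g = ?\<sigma>"
      by (rule ext) (use st f in \<open>auto simp: cycle_2 [OF ij]\<close>)
    have A: "?A = g \<longleftrightarrow> msign g j = 1"
    proof
      assume "msign g j = 1"
      then have "msign g b = 1" for b using st(4) f by (cases "b = i"; cases "b = j") auto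
      then show "?A = g" by (intro GG_eqI g) (auto simp: p)
    qed (use msign_cyc in metis)
    have "B = g \<longleftrightarrow> msign g j = - 1"
    proof
      assume m: "msign g j = - 1"
      then have "msign g i = - 1" using st(4) msign_cases [OF g, of i] by auto
      then have "msign g b = ?s b" for b
        using m f by (simp add: cycle_2 [OF ij])
      then show "B = g" by (intro GG_eqI g B) (auto simp: p B)
    next
      assume "B = g"
      then have "msign g j = ?s j" using B(3) by metis
      then show "msign g j = - 1" by (simp add: cycle_2 [OF ij])
    qed
    then show ?thesis
      using A msign_cases [OF g, of j] True ij by (auto simp: kk1_def GG_nth [OF g])
  next
    case False
    have "cyc_class 2 ?A"
      unfolding cyc_class_def mA using ij by simp
    moreover have "cyc_class 2 B"
    proof -
      have f: "\<forall>b. mperm B b = b \<longrightarrow> msign B b = 1"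
        using ij by (simp add: B(2,3) cycle_2 [OF ij])
      have "(\<Prod>b\<in>UNIV. msign B b) = 1"
        unfolding prod_msign_moved [OF f] mA(2) using ij by (simp add: B(3) cycle_2 [OF ij])
      then show ?thesis unfolding cyc_class_def mA using f B ij by simp
    qed
    moreover have "mperm ?A j = i" "mperm B j = i"
      using ij by (simp_all add: B(2) cycle_2 [OF ij])
    ultimately have "?A \<noteq> g" "B \<noteq> g" using False by auto
    moreover have "kk1 i j g = 0"
    proof (cases "cyc_class 2 g")
      case True
      then have "g \<in> GG" by (simp add: cyc_class_def)
      then show ?thesis using False True by (auto simp: kk1_def GG_nth)
    qed (simp add: kk1_def)
    ultimately show ?thesis by simp
  qed
  finally show ?thesis .
qed

text \<open>The sets \<open>L\<close> are the even subsets of \<open>{i, j, k}\<close>, as required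
  by a product of signs equal to 1. With the two orientations they give all eight elements of the
  class that move exactly these letters. A letter takes the sign of its image, hence the shifted
  letters in the conditions.\<close>

lemma signed_3_cycle:
  fixes i j k :: "'n::finite"
  assumes ne: "i \<noteq> j" "j \<noteq> k" "i \<noteq> k"
  defines "\<sigma> \<equiv> cycle_of_list [i, j, k]"
  assumes L: "L \<in> {{}, {i, j}, {j, k}, {i, k}}"
  defines "E \<equiv> smat \<sigma> (\<lambda>b. if \<sigma> b \<in> L then - 1 else 1)"
  shows "cyc_class 3 E \<and> moved E = {i, j, k}"
    and "cyc_class 3 g \<Longrightarrow> moved g = {i, j, k} \<Longrightarrow>
      E = g \<longleftrightarrow> mperm g i = j \<and> msign g i = (if j \<in> L then - 1 else 1)
        \<and> msign g j = (if k \<in> L then - 1 else 1) \<and> msign g k = (if i \<in> L then - 1 else 1)"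
proof -
  let ?s = "\<lambda>b. if \<sigma> b \<in> L then - 1 else 1 :: complex"
  have s: "?s b = 1 \<or> ?s b = -1" for b by simp
  have E: "E \<in> GG" "mperm E = \<sigma>" "msign E = ?s"
    unfolding E_def using smat_in_GG [OF bij_cycle s] mperm_smat' [OF s] by (simp_all add: \<sigma>_def)
  have \<sigma>: "\<sigma> b = (if b = i then j else if b = j then k else if b = k then i else b)" for b
    unfolding \<sigma>_def by (rule cycle_3 [OF ne])
  have m: "moved E = {i, j, k}"
    unfolding moved_def E \<sigma> using ne by auto
  have f: "\<forall>b. mperm E b = b \<longrightarrow> msign E b = 1"
    unfolding E \<sigma> using ne L by auto
  have "(\<Prod>b\<in>UNIV. msign E b) = 1"
    unfolding prod_msign_moved [OF f] m unfolding E(3) \<sigma> using ne L by auto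
  then show "cyc_class 3 E \<and> moved E = {i, j, k}"
    unfolding cyc_class_def m using f E ne by simp
  assume C: "cyc_class 3 g" and mg: "moved g = {i, j, k}"
  then have g: "g \<in> GG" by (simp add: cyc_class_def)
  show "E = g \<longleftrightarrow> mperm g i = j \<and> msign g i = (if j \<in> L then - 1 else 1)
        \<and> msign g j = (if k \<in> L then - 1 else 1) \<and> msign g k = (if i \<in> L then - 1 else 1)" (is "_ \<longleftrightarrow> ?R")
  proof
    assume "E = g"
    then have "mperm g = \<sigma>" "msign g = ?s" using E by auto
    then show ?R using ne by (simp add: \<sigma>)
  next
    assume R: ?R
    obtain t where t: "t \<noteq> i" "t \<noteq> j" "moved g = {i, j, t}" "mperm g j = t" "mperm g t = i"
      by (rule cyc_class_3 [OF C, of i j]) (use R ne in auto)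
    then have tk: "t = k" using mg by auto
    have "mperm g b = \<sigma> b \<and> msign g b = ?s b" for b
    proof (cases "b \<in> {i, j, k}")
      case True
      then show ?thesis using R t tk ne by (auto simp: \<sigma>)
    next
      case False
      then have "mperm g b = b" "msign g b = 1"
        using C mg by (auto simp: moved_def cyc_class_def)
      then show ?thesis using False L by (auto simp: \<sigma>)
    qed
    then show "E = g"
      by (intro GG_eqI E g ext) (simp_all add: E)
  qed
qed

definition k2_term :: "'n::finite \<Rightarrow> 'n \<Rightarrow> 'n \<Rightarrow> 'n gralg" where
  "k2_term i j k =
       gel (cyc [i, j, k])
     - gel (zeta i ** zeta j ** cyc [i, j, k])
     - gel (zeta j ** zeta k ** cyc [i, j, k])
     + gel (zeta i ** zeta k ** cyc [i, j, k])
     + gel (cyc [i, k, j])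
     - gel (zeta i ** zeta j ** cyc [i, k, j])
     + gel (zeta j ** zeta k ** cyc [i, k, j])
     - gel (zeta i ** zeta k ** cyc [i, k, j])"

text \<open>This explains the signs in the second map. If \<open>i\<close> goes to \<open>j\<close>,
  the coefficient is the sign at \<open>i\<close>, negative exactly if \<open>j \<in> L\<close>. If
  \<open>i\<close> goes to \<open>k\<close>, it is the sign at \<open>j\<close>, negative exactly if
  \<open>i \<in> L\<close>. In either case it is the nonzero one of \<open>g $ j $ i\<close> and
  \<open>g $ i $ j\<close>.\<close>

lemma kcoef_k2_term:
  assumes ne: "i \<noteq> j" "j \<noteq> k" "i \<noteq> k"
  shows "Poly_Mapping.lookup (k2_term i j k) g = (if moved g = {i, j, k} then kk2 i j g else 0)"
proof -
  define E where "E L = smat (cycle_of_list [i, j, k]) (\<lambda>b. if cycle_of_list [i, j, k] b \<in> L then - 1 else 1)" for L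
  define E' where "E' L = smat (cycle_of_list [i, k, j]) (\<lambda>b. if cycle_of_list [i, k, j] b \<in> L then - 1 else 1)" for L
  let ?Ls = "{{}, {i, j}, {j, k}, {i, k}}"
  have ne': "i \<noteq> k" "k \<noteq> j" "i \<noteq> j" using ne by auto
  have [simp]: "j \<noteq> i" "k \<noteq> j" "k \<noteq> i" "i \<noteq> j" "j \<noteq> k" "i \<noteq> k" using ne by auto
  have E: "cyc [i, j, k] = E {}" "zeta i ** zeta j ** cyc [i, j, k] = E {i, j}"
    "zeta j ** zeta k ** cyc [i, j, k] = E {j, k}" "zeta i ** zeta k ** cyc [i, j, k] = E {i, k}"
    unfolding E_def by (simp add: perm_mat_smat) (rule zeta_zeta_cyc; fact)+
  have E': "cyc [i, k, j] = E' {}" "zeta i ** zeta j ** cyc [i, k, j] = E' {i, j}"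
    "zeta j ** zeta k ** cyc [i, k, j] = E' {j, k}" "zeta i ** zeta k ** cyc [i, k, j] = E' {i, k}"
    unfolding E'_def by (simp add: perm_mat_smat) (rule zeta_zeta_cyc; fact)+
  have Ls: "L \<in> ?Ls \<Longrightarrow> L \<in> {{}, {i, k}, {k, j}, {i, j}}" for L by auto
  have L: "{} \<in> ?Ls" "{i, j} \<in> ?Ls" "{j, k} \<in> ?Ls" "{i, k} \<in> ?Ls" by simp_all
  have lk: "Poly_Mapping.lookup (k2_term i j k) g =
      of_bool (E {} = g) - of_bool (E {i, j} = g) - of_bool (E {j, k} = g) + of_bool (E {i, k} = g)
    + of_bool (E' {} = g) - of_bool (E' {i, j} = g) + of_bool (E' {j, k} = g) - of_bool (E' {i, k} = g)"
    unfolding k2_term_def E(2) E(3) E(4) E'(2) E'(3) E'(4)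
    unfolding E(1) E'(1) lookup_minus lookup_add lookup_gel ..
  show ?thesis
  proof (cases "cyc_class 3 g \<and> moved g = {i, j, k}")
    case False
    have "E L \<noteq> g" if "L \<in> ?Ls" for L
      using signed_3_cycle(1) [OF ne that] False unfolding E_def by metis
    moreover have "E' L \<noteq> g" if "L \<in> ?Ls" for L
      using signed_3_cycle(1) [OF ne' Ls [OF that]] False unfolding E'_def
      by (metis insert_commute)
    ultimately have "Poly_Mapping.lookup (k2_term i j k) g = 0"
      unfolding lk using L by simp
    then show ?thesis using False by (auto simp: kk2_def)
  next
    case True
    then have C: "cyc_class 3 g" and m: "moved g = {i, j, k}" and m': "moved g = {i, k, j}" by auto
    have g: "g \<in> GG" using C by (simp add: cyc_class_def)
    have e: "E L = g \<longleftrightarrow> mperm g i = j \<and> msign g i = (if j \<in> L then - 1 else 1)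
        \<and> msign g j = (if k \<in> L then - 1 else 1) \<and> msign g k = (if i \<in> L then - 1 else 1)"
      if "L \<in> ?Ls" for L
      using signed_3_cycle(2) [OF ne that C m] unfolding E_def .
    have e': "E' L = g \<longleftrightarrow> mperm g i = k \<and> msign g i = (if k \<in> L then - 1 else 1)
        \<and> msign g k = (if j \<in> L then - 1 else 1) \<and> msign g j = (if i \<in> L then - 1 else 1)"
      if "L \<in> ?Ls" for L
      using signed_3_cycle(2) [OF ne' Ls [OF that] C m'] unfolding E'_def .
    note lk' = lk [unfolded e [OF L(1)] e [OF L(2)] e [OF L(3)] e [OF L(4)]
        e' [OF L(1)] e' [OF L(2)] e' [OF L(3)] e' [OF L(4)]]
    have "mperm g i \<in> {i, j, k}" "mperm g i \<noteq> i"
      using moved_mperm [OF g, of i] m by (auto simp: moved_def)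
    then consider "mperm g i = j" | "mperm g i = k" by auto
    then have "Poly_Mapping.lookup (k2_term i j k) g = kk2 i j g"
    proof cases
      case 1
      obtain t where "t \<noteq> i" "t \<noteq> j" "moved g = {i, j, t}" "mperm g j = t" "mperm g t = i"
        and s: "msign g i * msign g j * msign g t = 1"
        using cyc_class_3 [OF C 1 ne(1)] .
      then have t: "t = k" "mperm g j = k" using m by auto
      have "kk2 i j g = msign g i"
        using C 1 t by (simp add: kk2_def GG_nth [OF g])
      then show ?thesis
        unfolding lk' using 1 s [unfolded t(1)] msign_cases [OF g, of i] msign_cases [OF g, of j] msign_cases [OF g, of k]
        by auto
    next
      case 2
      obtain t where "t \<noteq> i" "t \<noteq> k" "moved g = {i, k, t}" "mperm g k = t" "mperm g t = i"
        and s: "msign g i * msign g k * msign g t = 1"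
        using cyc_class_3 [OF C 2 ne(3)] .
      then have t: "t = j" "mperm g j = i" using m by auto
      have "kk2 i j g = msign g j"
        using C 2 t by (simp add: kk2_def GG_nth [OF g])
      then show ?thesis
        unfolding lk' using 2 s [unfolded t(1)] msign_cases [OF g, of i] msign_cases [OF g, of j] msign_cases [OF g, of k]
        by auto
    qed
    then show ?thesis using m by simp
  qed
qed

text \<open>For a given \<open>g\<close> at most one \<open>k\<close> satisfies
  \<open>moved g = {i, j, k}\<close>, and it exists if \<open>kk2 i j g\<close> is nonzero, so the
  sum has a single term.\<close>

lemma kcoef_kappa2:
  assumes ij: "i \<noteq> j"
  shows "Poly_Mapping.lookup (\<Sum>k\<in>UNIV - {i, j}. k2_term i j k) g = kk2 i j g"
proof -
  have "Poly_Mapping.lookup (\<Sum>k\<in>UNIV - {i, j}. k2_term i j k) g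
      = (\<Sum>k\<in>UNIV - {i, j}. if moved g = {i, j, k} then kk2 i j g else 0)"
    unfolding lookup_sum
  proof (rule sum.cong [OF refl])
    fix k assume "k \<in> UNIV - {i, j}"
    then have "j \<noteq> k" "i \<noteq> k" by auto
    then show "Poly_Mapping.lookup (k2_term i j k) g = (if moved g = {i, j, k} then kk2 i j g else 0)"
      by (rule kcoef_k2_term [OF ij])
  qed
  also have "\<dots> = kk2 i j g"
  proof (cases "kk2 i j g = 0")
    case False
    then have C: "cyc_class 3 g" by (auto simp: kk2_def split: if_splits)
    then have g: "g \<in> GG" by (simp add: cyc_class_def)
    have "mperm g i = j \<or> mperm g j = i"
      using False by (auto simp: kk2_def GG_nth [OF g] split: if_splits)
    then obtain t where t: "t \<noteq> i" "t \<noteq> j" "moved g = {i, j, t}"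
      using cyc_class_3 [OF C, of i j] cyc_class_3 [OF C, of j i] ij by (metis insert_commute)
    have "(\<Sum>k\<in>UNIV - {i, j}. if moved g = {i, j, k} then kk2 i j g else 0)
        = (\<Sum>k\<in>UNIV - {i, j}. if k = t then kk2 i j g else 0)"
      by (rule sum.cong) (use t in auto)
    then show ?thesis using t by simp
  qed (simp cong: if_cong)
  finally show ?thesis .
qed

lemma kappa2_eq: "kappa2 = kmap_of (\<lambda>i j. \<Sum>k\<in>UNIV - {i, j}. k2_term i j k)"
  unfolding kappa2_def k2_term_def ..

lemma kcoef_kappa:
  "kcoef kappa1 i j g = kk1 i j g" "kcoef kappa2 i j g = kk2 i j g"
proof -
  show "kcoef kappa1 i j g = kk1 i j g"
    by (cases "i = j") (simp_all add: kcoef_def kappa1_def kmap_of_bas kcoef_kappa1 kk1_def del: lookup_minus)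
  show "kcoef kappa2 i j g = kk2 i j g"
    by (cases "i = j") (simp_all add: kcoef_def kappa2_eq kmap_of_bas kcoef_kappa2 kk2_def)
qed

section \<open>From coefficients back to bilinear maps\<close>

lemma kcoef_comb:
  "kcoef (kscale c \<kappa> + kscale c' \<kappa>') i j g = c * kcoef \<kappa> i j g + c' * kcoef \<kappa>' i j g"
  by (simp add: kcoef_def kscale_def lookup_add)

lemma linear_vec_gralgI:
  fixes F :: "complex ^ 'n::finite \<Rightarrow> 'n gralg"
  assumes "\<And>v w. F (v + w) = F v + F w" "\<And>c v. F (c *s v) = cscale c (F v)"
  shows "Vector_Spaces.linear (*s) cscale F"
  by unfold_locales (auto simp: assms cscale_add_left algebra_simps vec_eq_iff)

lemma kmap_of_linear:
  "Vector_Spaces.linear (*s) cscale (kmap_of f v)" "Vector_Spaces.linear (*s) cscale (\<lambda>v. kmap_of f v w)"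
  by (rule linear_vec_gralgI;
      simp add: kmap_of_def cscale_add_left distrib_left distrib_right sum.distrib cscale_sum mult_ac)+

lemma kmap_of_comb:
  "kscale c (kmap_of f) + kscale c' (kmap_of f') = kmap_of (\<lambda>i j. cscale c (f i j) + cscale c' (f' i j))"
  by (rule ext)+ (simp add: kscale_def kmap_of_def cscale_sum sum.distrib mult_ac)

text \<open>Bilinearity gives a sum over all pairs, while \<open>kmap_of\<close> omits the diagonal;
  there admissibility makes each value its own negative, hence zero.\<close>

lemma kmap_of_expand:
  assumes "admissible qs \<kappa>"
  shows "\<kappa> = kmap_of (\<lambda>i j. \<kappa> (bas i) (bas j))"
proof (intro ext)
  fix v w :: "complex ^ 'a"
  have l1: "Vector_Spaces.linear (*s) cscale (\<kappa> v)" for v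
    using assms unfolding admissible_def by blast
  have l2: "Vector_Spaces.linear (*s) cscale (\<lambda>v. \<kappa> v w)" for w
    using assms unfolding admissible_def by blast+
  interpret dha \<kappa> by unfold_locales (rule assms)
  have diag: "\<kappa> (bas i) (bas i) = 0" for i
    by (rule poly_mapping_eqI) (use k_diag [of i] in \<open>simp add: kcoef_def\<close>)
  have R: "\<kappa> v w = (\<Sum>j\<in>UNIV. cscale (w $ j) (\<kappa> v (bas j)))" for v w
  proof -
    interpret f: Vector_Spaces.linear "(*s)" cscale "\<kappa> v" by (rule l1)
    have "\<kappa> v w = \<kappa> v (\<Sum>j\<in>UNIV. w $ j *s bas j)" by (simp only: basis_expansion)
    then show ?thesis by (simp only: f.sum f.scale)
  qed
  have L: "\<kappa> v w = (\<Sum>i\<in>UNIV. cscale (v $ i) (\<kappa> (bas i) w))" for v w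
  proof -
    interpret f: Vector_Spaces.linear "(*s)" cscale "\<lambda>v. \<kappa> v w" by (rule l2)
    have "\<kappa> v w = \<kappa> (\<Sum>i\<in>UNIV. v $ i *s bas i) w" by (simp only: basis_expansion)
    then show ?thesis by (simp only: f.sum f.scale)
  qed
  have "\<kappa> v w = (\<Sum>i\<in>UNIV. cscale (v $ i) (\<Sum>j\<in>UNIV. cscale (w $ j) (\<kappa> (bas i) (bas j))))"
    by (subst L, subst R) (rule refl)
  also have "\<dots> = (\<Sum>i\<in>UNIV. \<Sum>j\<in>UNIV. cscale (v $ i * w $ j) (\<kappa> (bas i) (bas j)))"
    by (simp add: cscale_sum)
  also have "\<dots> = kmap_of (\<lambda>i j. \<kappa> (bas i) (bas j)) v w"
    unfolding kmap_of_def
    by (intro sum.cong refl sum.mono_neutral_right) (auto simp: diag)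
  finally show "\<kappa> v w = kmap_of (\<lambda>i j. \<kappa> (bas i) (bas j)) v w" .
qed

lemma kk_outside: "g \<notin> GG \<Longrightarrow> kk1 i j g = 0" "g \<notin> GG \<Longrightarrow> kk2 i j g = 0"
  by (simp_all add: kk1_def kk2_def cyc_class_def)

lemma admissible_kmap_of:
  assumes "\<And>i j g. i \<noteq> j \<Longrightarrow> g \<notin> GG \<Longrightarrow> Poly_Mapping.lookup (f i j) g = 0"
    and "\<And>i j. i \<noteq> j \<Longrightarrow> f i j = f j i"
  shows "admissible qs (kmap_of f)"
proof -
  have K: "Poly_Mapping.keys (kmap_of f v w) \<subseteq> GG" for v w
  proof
    fix g assume g: "g \<in> Poly_Mapping.keys (kmap_of f v w)"
    have "Poly_Mapping.lookup (kmap_of f v w) g = 0" if "g \<notin> GG"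
      using assms(1) [OF _ that] by (simp add: kmap_of_def lookup_sum)
    then show "g \<in> GG" using g by (auto simp: in_keys_iff)
  qed
  have S: "kmap_of f (bas i) (bas j) = cscale (- qs i j) (kmap_of f (bas j) (bas i))" for i j
    using assms(2) [of i j] by (simp add: kmap_of_bas qs_def)
  show ?thesis
    unfolding admissible_def by (intro conjI allI kmap_of_linear K S)
qed

lemma comb_in_quantum_DH_maps:
  "kscale c kappa1 + kscale c' kappa2 \<in> quantum_DH_maps (qs :: 'n::finite \<Rightarrow> _)"
proof -
  let ?k = "kscale c kappa1 + kscale c' kappa2 :: 'n kmap"
  have kc: "kcoef ?k = (\<lambda>i j g. c * kk1 i j g + c' * kk2 i j g)"
    by (intro ext) (simp only: kcoef_comb kcoef_kappa)
  have "admissible qs ?k"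
    unfolding kappa1_def kappa2_eq kmap_of_comb
  proof (rule admissible_kmap_of)
    fix i j :: 'n assume ij: "i \<noteq> j"
    let ?f = "\<lambda>i j. cscale c (gel (cyc [i, j]) - gel (zeta i ** zeta j ** cyc [i, j]))
        + cscale c' (\<Sum>k\<in>UNIV - {i, j}. k2_term i j k)"
    have *: "Poly_Mapping.lookup (?f i j) g = c * kk1 i j g + c' * kk2 i j g" if "i \<noteq> j" for i j :: 'n and g
      by (simp only: lookup_add lookup_cscale kcoef_kappa1 [OF that] kcoef_kappa2 [OF that])
    show "Poly_Mapping.lookup (?f i j) g = 0" if "g \<notin> GG" for g
      unfolding * [OF ij] using that by (simp add: kk_outside)
    show "?f i j = ?f j i"
      by (rule poly_mapping_eqI)
        (simp only: * [OF ij] * [OF ij [symmetric]] kk1_sym [of i j] kk2_sym [of i j])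
  qed
  then interpret dha ?k by unfold_locales
  have "invariant (kcoef ?k)" "jacobi (kcoef ?k)"
    unfolding kc by (intro invariant_comb jacobi_comb invariant_kk1 invariant_kk2 jacobi_kk1 jacobi_kk2)+
  then have "is_quantum_DH qs ?k"
    by (rule sufficient)
  then show ?thesis using adm by (simp add: quantum_DH_maps_def)
qed

text \<open>The classification compares values on basis pairs. Both sides are admissible, so
  \<open>kmap_of_expand\<close> extends the equality to all vectors.\<close>

lemma quantum_DH_maps_comb:
  fixes \<kappa> :: "'n::finite kmap"
  assumes xyz: "x \<noteq> y" "y \<noteq> z" "x \<noteq> (z :: 'n)" and \<kappa>: "\<kappa> \<in> quantum_DH_maps qs"
  shows "\<exists>c c'. \<kappa> = kscale c kappa1 + kscale c' kappa2"
proof -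
  have ad: "admissible qs \<kappa>" and DH: "is_quantum_DH qs \<kappa>"
    using \<kappa> by (auto simp: quantum_DH_maps_def)
  interpret dha \<kappa> by unfold_locales (rule ad)
  interpret solution k
    using DH k_sym unfolding quantum_DH_iff by unfold_locales auto
  define c c' where "c = k x y (cyc [x, y])" and "c' = k x y (cyc [x, y, z])"
  let ?k = "kscale c kappa1 + kscale c' kappa2"
  have kk: "k i j g = kcoef ?k i j g" for i j g
  proof (cases "i = j \<or> g \<notin> GG")
    case True
    then show ?thesis
      by (auto simp: kcoef_comb kcoef_kappa kk_outside k_outside simp del: k_diag)
        (simp add: kk1_def kk2_def)
  next
    case False
    then show ?thesis
      using classification [OF xyz, of g i j] by (simp add: kcoef_comb kcoef_kappa c_def c'_def)
  qed
  have eq: "\<kappa> (bas i) (bas j) = ?k (bas i) (bas j)" for i j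
    by (rule poly_mapping_eqI) (rule kk [unfolded kcoef_def])
  have "admissible qs ?k"
    using comb_in_quantum_DH_maps by (auto simp: quantum_DH_maps_def)
  then have "?k = kmap_of (\<lambda>i j. ?k (bas i) (bas j))"
    by (rule kmap_of_expand)
  also have "\<dots> = kmap_of (\<lambda>i j. \<kappa> (bas i) (bas j))"
    by (simp only: eq)
  also have "\<dots> = \<kappa>"
    by (rule kmap_of_expand [OF ad, symmetric])
  finally show ?thesis by metis
qed

theorem theorem6p11:
  fixes q :: "'n::finite \<Rightarrow> 'n \<Rightarrow> complex"
  assumes "CARD('n) \<ge> 4"
    and "\<And>i j. q i j = (if i = j then 1 else - 1)"
  shows "kmaps.subspace (quantum_DH_maps q)
    \<and> kmaps.dim (quantum_DH_maps q) = 2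
    \<and> kappa1 \<noteq> (kappa2 :: 'n kmap)
    \<and> kmaps.independent {kappa1, kappa2 :: 'n kmap}
    \<and> kmaps.span {kappa1, kappa2} = quantum_DH_maps q"
proof -
  have q: "q = qs"
    using assms(2) by (auto simp: qs_def fun_eq_iff)
  obtain S :: "'n set" where "card S = 3"
    using obtain_subset_with_card_n [of 3 "UNIV :: 'n set"] assms(1) by auto
  then obtain x y z :: 'n where "S = {x, y, z}" and xyz: "x \<noteq> y" "y \<noteq> z" "x \<noteq> z"
    by (auto simp: card_3_iff)
  have v: "kcoef kappa1 x y (cyc [x, y]) = 1" "kcoef kappa2 x y (cyc [x, y]) = 0"
    "kcoef kappa1 x y (cyc [x, y, z]) = 0" "kcoef kappa2 x y (cyc [x, y, z]) = 1"
    by (simp_all add: kcoef_kappa kk_values [OF xyz])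
  have kz: "kcoef 0 i j g = 0" for i j :: 'n and g
    by (simp add: kcoef_def)
  have ks: "kcoef (kscale c \<kappa>) i j g = c * kcoef \<kappa> i j g" for c \<kappa> and i j :: 'n and g
    by (simp add: kcoef_def kscale_def)
  have ne: "kappa1 \<noteq> (kappa2 :: 'n kmap)"
    using v by auto
  have "kappa2 \<noteq> (0 :: 'n kmap)"
    using v(4) kz by auto
  \<comment> \<open>The coefficient at (x y) separates them: it is 1 for \<open>kappa1\<close> and 0
    for every multiple of \<open>kappa2\<close>.\<close>
  moreover have "kappa1 \<notin> kmaps.span {kappa2 :: 'n kmap}"
  proof
    assume "kappa1 \<in> kmaps.span {kappa2 :: 'n kmap}"
    then obtain c where "kappa1 = kscale c (kappa2 :: 'n kmap)"
      by (auto simp: kmaps.span_singleton)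
    then have "kcoef kappa1 x y (cyc [x, y]) = c * kcoef kappa2 x y (cyc [x, y])"
      using ks by metis
    then show False using v by simp
  qed
  ultimately have ind: "kmaps.independent {kappa1, kappa2 :: 'n kmap}"
    using ne by (simp add: kmaps.independent_insert)
  have span: "kmaps.span {kappa1, kappa2 :: 'n kmap} = quantum_DH_maps qs"
  proof (intro equalityI subsetI)
    fix \<kappa> :: "'n kmap" assume "\<kappa> \<in> kmaps.span {kappa1, kappa2}"
    then obtain c c' where "\<kappa> - kscale c kappa1 = kscale c' kappa2"
      by (auto simp: kmaps.span_breakdown_eq [of _ kappa1] kmaps.span_singleton)
    then have "\<kappa> = kscale c kappa1 + kscale c' kappa2"
      by (metis add.commute diff_add_cancel)
    then show "\<kappa> \<in> quantum_DH_maps qs"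
      using comb_in_quantum_DH_maps by metis
  next
    fix \<kappa> :: "'n kmap" assume "\<kappa> \<in> quantum_DH_maps qs"
    then obtain c c' where \<kappa>: "\<kappa> = kscale c kappa1 + kscale c' kappa2"
      using quantum_DH_maps_comb [OF xyz] by metis
    show "\<kappa> \<in> kmaps.span {kappa1, kappa2}"
      unfolding \<kappa> by (intro kmaps.span_add kmaps.span_scale kmaps.span_base) auto
  qed
  have "kmaps.dim (quantum_DH_maps qs :: 'n kmap set) = card {kappa1, kappa2 :: 'n kmap}"
    unfolding span [symmetric] kmaps.dim_span by (rule kmaps.dim_eq_card_independent [OF ind])
  then have dim: "kmaps.dim (quantum_DH_maps qs :: 'n kmap set) = 2"
    using ne by simp
  have "kmaps.subspace (quantum_DH_maps qs :: 'n kmap set)"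
    unfolding span [symmetric] by (rule kmaps.subspace_span)
  then show ?thesis
    unfolding q using dim ne ind span by blast
qed

end
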